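(* Let $G$ be a non-bipartite projective quadrangulation on $n$ vertices. Then $G$ contains an odd cycle of length at most $\tfrac12\bigl(1+\sqrt{8n-7}\bigr)$.
   Context: A projective quadrangulation is a graph embedded in the real projective plane $\mathbb{P}^2$ so that every face is bounded by four edges. A non-bipartite projective quadrangulation is such a graph that is not bipartite. *)

theory Defs
  imports "HOL-Analysis.Analysis" "Graph_Theory.Graph_Theory"
begin

section \<open>The real projective plane\<close>

definition quotient_topology :: "'a topology \<Rightarrow> ('a \<Rightarrow> 'b) \<Rightarrow> 'b topology" where
  "quotient_topology X f =
     topology (\<lambda>U. U \<subseteq> f ` topspace X \<and> openin X {x \<in> topspace X. f x \<in> U})"

lemma openin_quotient_topology:
  "openin (quotient_topology X f) U \<longleftrightarrow>
     U \<subseteq> f ` topspace X \<and> openin X {x \<in> topspace X. f x \<in> U}"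
proof -
  let ?P = "\<lambda>U. {x \<in> topspace X. f x \<in> U}"
  let ?L = "\<lambda>U. U \<subseteq> f ` topspace X \<and> openin X (?P U)"
  have "istopology ?L"
    unfolding istopology_def
  proof (intro conjI allI impI)
    fix S T assume S: "?L S" and T: "?L T"
    show "S \<inter> T \<subseteq> f ` topspace X" using S by auto
    have "?P (S \<inter> T) = ?P S \<inter> ?P T" by auto
    then show "openin X (?P (S \<inter> T))"
      using openin_Int[of X "?P S" "?P T"] S T by presburger
  next
    fix K assume K: "\<forall>S\<in>K. ?L S"
    then show "\<Union>K \<subseteq> f ` topspace X" by auto
    have "?P (\<Union>K) = (\<Union>S\<in>K. ?P S)" by auto
    moreover have "openin X (\<Union>S\<in>K. ?P S)"
      by (rule openin_Union) (use K in auto)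
    ultimately show "openin X (?P (\<Union>K))" by presburger
  qed
  then show ?thesis
    unfolding quotient_topology_def by (simp only: topology_inverse')
qed

lemma topspace_quotient_topology: "topspace (quotient_topology X f) = f ` topspace X"
proof
  show "topspace (quotient_topology X f) \<subseteq> f ` topspace X"
    by (meson openin_quotient_topology openin_topspace)
  have "{x \<in> topspace X. f x \<in> f ` topspace X} = topspace X"
    by auto
  then have "openin (quotient_topology X f) (f ` topspace X)"
    unfolding openin_quotient_topology by (metis openin_topspace order_refl)
  then show "f ` topspace X \<subseteq> topspace (quotient_topology X f)"
    by (rule openin_subset)
qed

lemma quotient_map_quotient_topology: "quotient_map X (quotient_topology X f) f"
  unfolding quotient_map_def topspace_quotient_topology openin_quotient_topology
  by simp

definition antipodal_class :: "real^3 \<Rightarrow> (real^3) set" where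
  "antipodal_class x = {x, -x}"

definition projective_plane :: "(real^3) set topology" where
  "projective_plane = quotient_topology (top_of_set (sphere 0 1)) antipodal_class"

section \<open>Graphs embedded in a topological space\<close>

text \<open>
  Finite simple graphs are the graphs satisfying \<^const>\<open>pair_graph\<close>: an undirected edge \<open>uv\<close> is
  represented by the two arcs \<open>(u,v)\<close> and \<open>(v,u)\<close>. An embedding is a pair \<open>(\<phi>, \<gamma>)\<close> where \<open>\<phi>\<close> maps
  vertices to points and \<open>\<gamma>\<close> maps each arc of the graph to the point set of the curve representing
  it, opposite arcs being represented by the same point set.
\<close>

definition topological_arc :: "'b topology \<Rightarrow> 'b \<Rightarrow> 'b \<Rightarrow> 'b set \<Rightarrow> bool" where
  "topological_arc X x y A \<longleftrightarrow>
     (\<exists>g. embedding_map (top_of_set {0..1::real}) X g \<and> g 0 = x \<and> g 1 = y \<and> g ` {0..1} = A)"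

definition graph_embedding ::
  "'b topology \<Rightarrow> 'a pair_pre_digraph \<Rightarrow> ('a \<Rightarrow> 'b) \<Rightarrow> ('a \<times> 'a \<Rightarrow> 'b set) \<Rightarrow> bool" where
  "graph_embedding X G \<phi> \<gamma> \<longleftrightarrow>
     \<phi> ` pverts G \<subseteq> topspace X \<and> inj_on \<phi> (pverts G) \<and>
     (\<forall>(u, v) \<in> parcs G. topological_arc X (\<phi> u) (\<phi> v) (\<gamma> (u, v)) \<and> \<gamma> (v, u) = \<gamma> (u, v)) \<and>
     (\<forall>(u, v) \<in> parcs G. \<gamma> (u, v) \<inter> \<phi> ` pverts G = {\<phi> u, \<phi> v}) \<and>
     (\<forall>(u, v) \<in> parcs G. \<forall>(x, y) \<in> parcs G. {u, v} \<noteq> {x, y} \<longrightarrow>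
        \<gamma> (u, v) \<inter> \<gamma> (x, y) \<subseteq> \<phi> ` pverts G)"

definition embedding_faces ::
  "'b topology \<Rightarrow> 'a pair_pre_digraph \<Rightarrow> ('a \<Rightarrow> 'b) \<Rightarrow> ('a \<times> 'a \<Rightarrow> 'b set) \<Rightarrow> 'b set set" where
  "embedding_faces X G \<phi> \<gamma> = connected_components_of
     (subtopology X (topspace X - (\<phi> ` pverts G \<union> \<Union> (\<gamma> ` parcs G))))"

text \<open>
  The face \<open>F\<close> is an open disc with facial walk \<open>p\<close>: some continuous map of the closed unit disc
  takes the open disc homeomorphically onto \<open>F\<close>, and takes the \<open>length p\<close> consecutive equal
  circular arcs that make up the unit circle bijectively onto the consecutive edges of \<open>p\<close>.
  An edge with \<open>F\<close> on both sides would occur twice in \<open>p\<close>.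
\<close>

definition face_bounded_by ::
  "'b topology \<Rightarrow> 'a pair_pre_digraph \<Rightarrow> ('a \<Rightarrow> 'b) \<Rightarrow> ('a \<times> 'a \<Rightarrow> 'b set) \<Rightarrow> 'b set \<Rightarrow>
     ('a \<times> 'a) awalk \<Rightarrow> bool" where
  "face_bounded_by X G \<phi> \<gamma> F p \<longleftrightarrow>
     p \<noteq> [] \<and> (\<exists>u. pre_digraph.awalk (with_proj G) u p u) \<and>
     (\<exists>h :: complex \<Rightarrow> 'b.
        continuous_map (top_of_set (cball 0 1)) X h \<and>
        homeomorphic_map (top_of_set (ball 0 1)) (subtopology X F) h \<and>
        (\<forall>i < length p.
           let side = (\<lambda>t. h (cis (2 * pi * (real i + t) / real (length p))))
           in side 0 = \<phi> (fst (p ! i)) \<and> side 1 = \<phi> (snd (p ! i)) \<and>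
              bij_betw side {0..1} (\<gamma> (p ! i))))"

section \<open>Projective quadrangulations\<close>

definition projective_quadrangulation :: "'a pair_pre_digraph \<Rightarrow> bool" where
  "projective_quadrangulation G \<longleftrightarrow> pair_graph G \<and>
     (\<exists>\<phi> \<gamma>. graph_embedding projective_plane G \<phi> \<gamma> \<and>
        (\<forall>F \<in> embedding_faces projective_plane G \<phi> \<gamma>.
           \<exists>p. length p = 4 \<and> face_bounded_by projective_plane G \<phi> \<gamma> F p))"

definition bipartite :: "'a pair_pre_digraph \<Rightarrow> bool" where
  "bipartite G \<longleftrightarrow> (\<exists>A B. pverts G = A \<union> B \<and> A \<inter> B = {} \<and> parcs G \<subseteq> A \<times> B \<union> B \<times> A)"

text \<open>
  The closed directed walk \<open>u, v, u\<close> along a single edge is a cycle in the sense of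
  \<^const>\<open>pre_digraph.cycle\<close>; it has length 2, so cycles of odd length in a \<^const>\<open>pair_graph\<close> are
  exactly the odd cycles of the undirected graph.
\<close>

definition odd_cycle :: "'a pair_pre_digraph \<Rightarrow> ('a \<times> 'a) awalk \<Rightarrow> bool" where
  "odd_cycle G p \<longleftrightarrow> pre_digraph.cycle (with_proj G) p \<and> odd (length p)"

end

theory Submission
  imports Defs
begin

text \<open>
  Lift the embedding to the sphere. This gives a symmetric quadrangulation with \<open>2 * n\<close> vertices, in
  which a shortest odd cycle, of length \<open>k\<close>, lifts to an isometric cycle \<open>v 0, \<dots>, v (2 * k - 1)\<close>.
  The sphere enters only through two facts: each edge is on exactly two face sides (invariance of
  domain), and every 1-cochain modulo 2 that is closed on the faces is a coboundary (a map to the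
  projective plane built from the cochain lifts to the sphere).

  By the second fact the cycle bounds a set \<open>H\<close> of at most half of the faces. Let \<open>d i\<close> be the distance
  from \<open>v i\<close> inside \<open>H\<close>. For \<open>0 < s < k\<close> the map \<open>(d i, d (i + 1))\<close> winds the cycle around the lattice
  square with centre \<open>(s, s)\<close>, so some face of \<open>H\<close> is mapped onto this square: \<open>k - 1\<close> faces for each of
  the \<open>2 * k\<close> indices \<open>i\<close>. Two opposite sides of such a face separate \<open>d i < d (i + 1)\<close> from
  \<open>d i > d (i + 1)\<close>. But an edge \<open>xy\<close> does so for at most two indices: the vertices closer to \<open>x\<close> and the
  vertices closer to \<open>y\<close> induce connected graphs, so the cut between them is a minimal closed cochain,
  and a dimension count shows that it has at most two edges on the boundary cycle. Hence a face is
  used for at most four indices, and \<open>2 * k * (k - 1) \<le> 4 * card H\<close>. Euler's inequality, again a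
  dimension count, gives \<open>2 * card H < 2 * n\<close>, so \<open>k * (k - 1) \<le> 2 * n - 2\<close>.
\<close>

section \<open>Parity functionals\<close>

text \<open>The chain \<open>H\<close> comes from linear duality over the field with two elements:
  its boundary is known only through parities, and it is not known to be connected or a disc. This
  is why winding and separation are expressed by cochains. Distances are taken inside
  \<open>H\<close> because the dimension count for the cut of \<open>xy\<close> sees only the
  boundary of the face set over which it runs: over all faces there is no boundary, and nothing
  follows about the cycle. Isometry ensures that cycle vertices are as far apart in \<open>H\<close>
  as along the cycle. So \<open>(d i, d (i + 1))\<close> climbs from \<open>(1, 0)\<close> to
  \<open>(k, k - 1)\<close>, crosses the diagonal and descends from \<open>(k - 1, k)\<close> to
  \<open>(0, 1)\<close>; it encircles \<open>(s, s)\<close> exactly for \<open>0 < s < k\<close>.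
  The lifted graph is bipartite because all faces have four sides; hence each distance changes by
  exactly 1 along an edge, and one face can serve only one centre.\<close>

definition parity_functional :: "('a set \<Rightarrow> bool) \<Rightarrow> bool" where
  "parity_functional \<xi> \<longleftrightarrow> (\<forall>C D. \<xi> (sym_diff C D) \<longleftrightarrow> \<xi> C \<noteq> \<xi> D)"

lemma parity_functionalD:
  "parity_functional \<xi> \<Longrightarrow> \<xi> (sym_diff C D) \<longleftrightarrow> \<xi> C \<noteq> \<xi> D"
  unfolding parity_functional_def by blast

lemma parity_functional_odd_card:
  assumes "finite J"
  shows "parity_functional (\<lambda>C. odd (card {j \<in> J. e j \<in> C}))"
  unfolding parity_functional_def
proof (intro allI)
  fix C D
  have 1: "card {j \<in> J. e j \<in> C} = card {j \<in> J. e j \<in> C - D} + card {j \<in> J. e j \<in> C \<inter> D}"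
    using assms by (subst card_Un_disjoint [symmetric]) (auto intro!: arg_cong [where f = card])
  have 2: "card {j \<in> J. e j \<in> D} = card {j \<in> J. e j \<in> D - C} + card {j \<in> J. e j \<in> C \<inter> D}"
    using assms by (subst card_Un_disjoint [symmetric]) (auto intro!: arg_cong [where f = card])
  have 3: "card {j \<in> J. e j \<in> sym_diff C D} = card {j \<in> J. e j \<in> C - D} + card {j \<in> J. e j \<in> D - C}"
    using assms by (subst card_Un_disjoint [symmetric]) (auto intro!: arg_cong [where f = card])
  show "odd (card {j \<in> J. e j \<in> sym_diff C D}) \<longleftrightarrow>
      odd (card {j \<in> J. e j \<in> C}) \<noteq> odd (card {j \<in> J. e j \<in> D})"
    unfolding 1 2 3 by auto
qed

text \<open>Sets under \<open>sym_diff\<close> form a vector space over the field with two elements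
  and parity functionals are its linear forms, so this is rank-nullity in counting form: each form
  at most halves the common kernel, because translation by one element \<open>x0\<close> where it is
  true injects the part where it is true into the part where it is false.\<close>

lemma card_parity_kernel:
  assumes "finite I" "finite D" "\<And>i. i \<in> I \<Longrightarrow> parity_functional (\<xi> i)"
  shows "2 ^ card D \<le> 2 ^ card I * card {X. X \<subseteq> D \<and> (\<forall>i\<in>I. \<not> \<xi> i X)}"
  using assms(1,3)
proof (induction I rule: finite_induct)
  case empty
  then show ?case using card_Pow[OF assms(2)] by (simp add: Pow_def)
next
  case (insert i I)
  define X where "X = {X. X \<subseteq> D \<and> (\<forall>i\<in>I. \<not> \<xi> i X)}"
  define N where "N = {x \<in> X. \<not> \<xi> i x}"
  define Y where "Y = {x \<in> X. \<xi> i x}"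
  have "finite X"
    unfolding X_def by (rule finite_subset[of _ "Pow D"]) (use assms(2) in auto)
  then have fin: "finite N" "finite Y" by (auto simp: N_def Y_def)
  have "card X = card N + card Y"
    using fin by (subst card_Un_disjoint[symmetric]) (auto simp: N_def Y_def intro!: arg_cong[where f=card])
  moreover have "card Y \<le> card N"
  proof (cases "Y = {}")
    case False
    then obtain x0 where x0: "x0 \<in> Y" by auto
    have "inj_on (sym_diff x0) Y" by (auto simp: inj_on_def)
    moreover have "sym_diff x0 ` Y \<subseteq> N"
      using x0 insert.prems unfolding Y_def N_def X_def parity_functional_def by auto
    ultimately show ?thesis using fin(1) by (rule card_inj_on_le)
  qed auto
  ultimately have "card X \<le> 2 * card N" by simp
  have "2 ^ card D \<le> 2 ^ card I * card X"
    using insert by (simp add: X_def)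
  also have "\<dots> \<le> 2 ^ card I * (2 * card N)"
    using \<open>card X \<le> 2 * card N\<close> by simp
  also have "\<dots> = 2 ^ card (insert i I) * card N"
    using insert by simp
  also have "N = {X. X \<subseteq> D \<and> (\<forall>i\<in>insert i I. \<not> \<xi> i X)}"
    by (auto simp: N_def X_def)
  finally show ?case .
qed

text \<open>Linear duality: a form vanishing on the common kernel of finitely many forms is the sum
  of some of them. If \<open>\<psi>\<close> does not vanish on the kernel of the smaller family, a
  witness \<open>C0\<close> satisfies \<open>\<xi> i C0\<close>, and adding \<open>C0\<close> moves
  any \<open>C\<close> with \<open>\<xi> i C\<close> into the full kernel; so the sum of
  \<open>\<psi>\<close> and \<open>\<xi> i\<close> does vanish there.\<close>

lemma parity_duality:
  assumes "finite I" "\<And>i. i \<in> I \<Longrightarrow> parity_functional (\<xi> i)" "parity_functional \<psi>"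
    and "\<And>C. (\<And>i. i \<in> I \<Longrightarrow> \<not> \<xi> i C) \<Longrightarrow> \<not> \<psi> C"
  shows "\<exists>H\<subseteq>I. \<forall>C. \<psi> C \<longleftrightarrow> odd (card {i \<in> H. \<xi> i C})"
  using assms
proof (induction I arbitrary: \<psi> rule: finite_induct)
  case empty
  then show ?case by auto
next
  case (insert i I)
  show ?case
  proof (cases "\<forall>C. (\<forall>j\<in>I. \<not> \<xi> j C) \<longrightarrow> \<not> \<psi> C")
    case True
    then obtain H where "H \<subseteq> I" "\<forall>C. \<psi> C \<longleftrightarrow> odd (card {i \<in> H. \<xi> i C})"
      using insert.IH[of \<psi>] insert.prems by auto
    then show ?thesis by blast
  next
    case False
    then obtain C0 where C0: "\<forall>j\<in>I. \<not> \<xi> j C0" "\<psi> C0" by auto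
    then have iC0: "\<xi> i C0" using insert.prems(3)[of C0] by auto
    define \<phi> where "\<phi> C \<longleftrightarrow> \<psi> C \<noteq> \<xi> i C" for C
    have "parity_functional \<phi>"
      unfolding parity_functional_def \<phi>_def parity_functionalD[OF insert.prems(2)]
        parity_functionalD[OF insert.prems(1)[OF insertI1]] by (intro allI) argo
    moreover have "\<not> \<phi> C" if C: "\<And>j. j \<in> I \<Longrightarrow> \<not> \<xi> j C" for C
    proof (cases "\<xi> i C")
      case True
      have "\<not> \<xi> j (sym_diff C C0)" if "j \<in> insert i I" for j
        unfolding parity_functionalD[OF insert.prems(1)[OF that]] using that C C0 iC0 True by auto
      then have "\<not> \<psi> (sym_diff C C0)" by (rule insert.prems(3))
      then show ?thesis
        using C0 True unfolding parity_functionalD[OF insert.prems(2)] \<phi>_def by simp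
    next
      case False
      then show ?thesis using C insert.prems(3)[of C] by (auto simp: \<phi>_def)
    qed
    ultimately obtain H where H: "H \<subseteq> I" "\<forall>C. \<phi> C \<longleftrightarrow> odd (card {i \<in> H. \<xi> i C})"
      using insert.IH[of \<phi>] insert.prems by auto
    have "finite H" using H insert.hyps finite_subset by auto
    have "\<psi> C \<longleftrightarrow> odd (card {j \<in> insert i H. \<xi> j C})" for C
    proof -
      have "i \<notin> H" using H insert.hyps by auto
      have "{j \<in> insert i H. \<xi> j C} = (if \<xi> i C then insert i else id) {j \<in> H. \<xi> j C}"
        by auto
      then have "card {j \<in> insert i H. \<xi> j C} =
          (if \<xi> i C then Suc (card {j \<in> H. \<xi> j C}) else card {j \<in> H. \<xi> j C})"
        using \<open>finite H\<close> \<open>i \<notin> H\<close> by simp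
      then show ?thesis using H(2)[rule_format, of C] unfolding \<phi>_def by (cases "\<xi> i C") simp_all
    qed
    then show ?thesis using H(1) by (intro exI[of _ "insert i H"]) auto
  qed
qed

text \<open>With \<open>P 0 = P n\<close> this is the reason why coboundaries are closed: a
  two-valued function changes an even number of times around a closed walk.\<close>

lemma odd_card_changes:
  fixes P :: "nat \<Rightarrow> bool"
  shows "odd (card {i. i < n \<and> P i \<noteq> P (Suc i)}) \<longleftrightarrow> P 0 \<noteq> P n"
proof (induction n)
  case (Suc n)
  let ?b = "P n \<noteq> P (Suc n)"
  have "{i. i < Suc n \<and> P i \<noteq> P (Suc i)} =
      (if ?b then insert n else id) {i. i < n \<and> P i \<noteq> P (Suc i)}"
    by (auto simp: less_Suc_eq)
  then have "card {i. i < Suc n \<and> P i \<noteq> P (Suc i)} =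
      (if ?b then Suc (card {i. i < n \<and> P i \<noteq> P (Suc i)})
       else card {i. i < n \<and> P i \<noteq> P (Suc i)})"
    by simp
  then have "odd (card {i. i < Suc n \<and> P i \<noteq> P (Suc i)}) \<longleftrightarrow>
      odd (card {i. i < n \<and> P i \<noteq> P (Suc i)}) \<noteq> ?b"
    by presburger
  then show ?case unfolding Suc.IH by argo
qed auto

lemma relpow_sym:
  assumes "sym R" "(x, y) \<in> R ^^ n"
  shows "(y, x) \<in> R ^^ n"
  using assms(2)
proof (induction n arbitrary: y)
  case (Suc n)
  then obtain z where "(x, z) \<in> R ^^ n" "(z, y) \<in> R" by auto
  then have "(z, x) \<in> R ^^ n" "(y, z) \<in> R" using Suc.IH symD[OF assms(1)] by blast+
  then show ?case by (meson relpow_Suc_I2)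
qed simp

text \<open>Here \<open>p\<close> tells on which side of the diagonal a corner lies and
  \<open>t\<close> is its smaller coordinate. A side that crosses the diagonal keeps
  \<open>t\<close>, any other side changes it by 1. An odd number of crossings below
  \<open>s\<close> leaves one crossing at height \<open>s - 1\<close> and the opposite one at
  \<open>s\<close>, hence the sum \<open>2 * (s - 1) + 2 * s\<close>.\<close>

lemma quad_crossing_aux:
  fixes t0 t1 t2 t3 s :: nat and p0 p1 p2 p3 :: bool
  assumes t: "if p0 = p1 then t0 = Suc t1 \<or> t1 = Suc t0 else t0 = t1"
    "if p1 = p2 then t1 = Suc t2 \<or> t2 = Suc t1 else t1 = t2"
    "if p2 = p3 then t2 = Suc t3 \<or> t3 = Suc t2 else t2 = t3"
    "if p3 = p0 then t3 = Suc t0 \<or> t0 = Suc t3 else t3 = t0"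
   and o: "odd (of_bool (p0 \<noteq> p1 \<and> t0 < s) + of_bool (p1 \<noteq> p2 \<and> t1 < s) +
     of_bool (p2 \<noteq> p3 \<and> t2 < s) + (of_bool (p3 \<noteq> p0 \<and> t3 < s) :: nat))"
  shows "t0 + t1 + t2 + t3 + 2 = 4 * s"
proof -
  consider "p0 = p1" "p1 = p2" "p2 = p3" | "p0 = p1" "p1 = p2" "p2 \<noteq> p3"
    | "p0 = p1" "p1 \<noteq> p2" "p2 = p3" | "p0 = p1" "p1 \<noteq> p2" "p2 \<noteq> p3"
    | "p0 \<noteq> p1" "p1 = p2" "p2 = p3" | "p0 \<noteq> p1" "p1 = p2" "p2 \<noteq> p3"
    | "p0 \<noteq> p1" "p1 \<noteq> p2" "p2 = p3" | "p0 \<noteq> p1" "p1 \<noteq> p2" "p2 \<noteq> p3"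
    by argo
  then show ?thesis
  proof cases
    \<comment> \<open>Cases 3 and 6 are two crossings on opposite sides. In all others the crossings
      (none, two adjacent ones, or four) are at one common height, so an even number of them is
      counted.\<close>
    case 3
    then have e: "t1 = t2" "t3 = t0" and d: "t0 = Suc t1 \<or> t1 = Suc t0" using t by auto
    have "odd (of_bool (t1 < s) + (of_bool (t0 < s) :: nat))" using o 3 e by auto
    then have "(t1 < s) \<noteq> (t0 < s)" by (cases "t1 < s"; cases "t0 < s") auto
    with d e show ?thesis by linarith
  next
    case 6
    then have e: "t0 = t1" "t2 = t3" and d: "t1 = Suc t2 \<or> t2 = Suc t1" using t by auto
    have "odd (of_bool (t1 < s) + (of_bool (t2 < s) :: nat))" using o 6 e by auto
    then have "(t1 < s) \<noteq> (t2 < s)" by (cases "t1 < s"; cases "t2 < s") auto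
    with d e show ?thesis by linarith
  qed (use t o in auto)
qed

lemma min_step:
  fixes a a' b b' :: nat
  assumes A: "a = Suc a' \<or> a' = Suc a" and B: "b = Suc b' \<or> b' = Suc b"
    and C: "a = Suc b \<or> b = Suc a" and D: "a' = Suc b' \<or> b' = Suc a'"
  shows "if (a < b) = (a' < b') then min a b = Suc (min a' b') \<or> min a' b' = Suc (min a b) else min a b = min a' b'"
proof -
  have m: "min a b = (if a < b then a else b)" "min a' b' = (if a' < b' then a' else b')"
    using C D by (auto simp: min_def)
  have 1: "b = Suc a" if "a < b" using C that by linarith
  have 2: "a = Suc b" if "\<not> a < b" using C that by linarith
  have 3: "b' = Suc a'" if "a' < b'" using D that by linarith
  have 4: "a' = Suc b'" if "\<not> a' < b'" using D that by linarith
  consider "a < b" "a' < b'" | "a < b" "\<not> a' < b'" | "\<not> a < b" "a' < b'" | "\<not> a < b" "\<not> a' < b'" by blast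
  then show ?thesis
  proof cases
    case 1 then show ?thesis unfolding m using A by simp
  next
    case 2 then show ?thesis unfolding m using A B \<open>a < b \<Longrightarrow> b = Suc a\<close> \<open>\<not> a' < b' \<Longrightarrow> a' = Suc b'\<close> by simp linarith
  next
    case 3 then show ?thesis unfolding m using A B \<open>\<not> a < b \<Longrightarrow> a = Suc b\<close> \<open>a' < b' \<Longrightarrow> b' = Suc a'\<close> by simp linarith
  next
    case 4 then show ?thesis unfolding m using B by simp
  qed
qed

text \<open>
  Around a quadrilateral, \<open>a\<close> and \<open>b\<close> change by 1 along each side and differ by 1 at each corner.
  If the counted number of sides is odd, the points \<open>(a j, b j)\<close> are the four lattice points around
  \<open>(s, s)\<close>.
\<close>

lemma quad_crossing:
  fixes a b :: "nat \<Rightarrow> nat"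
  assumes a: "\<And>j. j < 4 \<Longrightarrow> a j = Suc (a (Suc j)) \<or> a (Suc j) = Suc (a j)"
    and b: "\<And>j. j < 4 \<Longrightarrow> b j = Suc (b (Suc j)) \<or> b (Suc j) = Suc (b j)"
    and ab: "\<And>j. j < 4 \<Longrightarrow> a j = Suc (b j) \<or> b j = Suc (a j)"
    and per: "a 4 = a 0" "b 4 = b 0"
    and odd: "odd (card {j. j < 4 \<and> (a j < b j) \<noteq> (a (Suc j) < b (Suc j)) \<and>
                      a j + b j < 2 * s \<and> a (Suc j) + b (Suc j) < 2 * s})"
  shows "(\<Sum>j<4. a j + b j) = 8 * s"
proof -
  define S where "S = (\<lambda>P. card {j::nat. j < 4 \<and> P j})"
  have S: "S P = of_bool (P 0) + of_bool (P 1) + of_bool (P 2) + of_bool (P 3)" for P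
  proof -
    have "S P = (\<Sum>j\<in>{..<4}. of_bool (P j))"
      unfolding S_def by (subst sum_of_bool_eq) (auto intro!: arg_cong[where f=card])
    also have "\<dots> = (\<Sum>j\<in>{0,1,2,3}. of_bool (P j))"
      by (rule sum.cong) auto
    finally show ?thesis by simp
  qed
  have n: "Suc 0 = 1" "Suc 1 = 2" "Suc 2 = 3" "Suc 3 = (4::nat)" by auto
  have lt: "0 < (4::nat)" "1 < (4::nat)" "2 < (4::nat)" "3 < (4::nat)" by auto
  have A: "a 0 = Suc (a 1) \<or> a 1 = Suc (a 0)" "a 1 = Suc (a 2) \<or> a 2 = Suc (a 1)"
    "a 2 = Suc (a 3) \<or> a 3 = Suc (a 2)" "a 3 = Suc (a 0) \<or> a 0 = Suc (a 3)"
    using a[OF lt(1)] a[OF lt(2)] a[OF lt(3)] a[OF lt(4)] by (simp_all only: n per)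
  have B: "b 0 = Suc (b 1) \<or> b 1 = Suc (b 0)" "b 1 = Suc (b 2) \<or> b 2 = Suc (b 1)"
    "b 2 = Suc (b 3) \<or> b 3 = Suc (b 2)" "b 3 = Suc (b 0) \<or> b 0 = Suc (b 3)"
    using b[OF lt(1)] b[OF lt(2)] b[OF lt(3)] b[OF lt(4)] by (simp_all only: n per)
  have AB: "a 0 = Suc (b 0) \<or> b 0 = Suc (a 0)" "a 1 = Suc (b 1) \<or> b 1 = Suc (a 1)"
    "a 2 = Suc (b 2) \<or> b 2 = Suc (a 2)" "a 3 = Suc (b 3) \<or> b 3 = Suc (a 3)"
    using ab[OF lt(1)] ab[OF lt(2)] ab[OF lt(3)] ab[OF lt(4)] by simp_all
  have o: "odd (of_bool ((a 0 < b 0) \<noteq> (a 1 < b 1) \<and> a 0 + b 0 < 2 * s \<and> a 1 + b 1 < 2 * s) +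
     of_bool ((a 1 < b 1) \<noteq> (a 2 < b 2) \<and> a 1 + b 1 < 2 * s \<and> a 2 + b 2 < 2 * s) +
     of_bool ((a 2 < b 2) \<noteq> (a 3 < b 3) \<and> a 2 + b 2 < 2 * s \<and> a 3 + b 3 < 2 * s) +
     (of_bool ((a 3 < b 3) \<noteq> (a 0 < b 0) \<and> a 3 + b 3 < 2 * s \<and> a 0 + b 0 < 2 * s) :: nat))"
    using odd S[unfolded S_def, of "\<lambda>j. (a j < b j) \<noteq> (a (Suc j) < b (Suc j)) \<and>
                      a j + b j < 2 * s \<and> a (Suc j) + b (Suc j) < 2 * s"] per
    by (simp only: n not_False_eq_True)
  define t where "t j = min (a j) (b j)" for j
  have T: "a j + b j = 2 * t j + 1" if "j < 4" for j
    using ab[OF that] unfolding t_def by linarith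
  have step: "if (a i < b i) = (a j < b j) then t i = Suc (t j) \<or> t j = Suc (t i) else t i = t j"
    if "a i = Suc (a j) \<or> a j = Suc (a i)" "b i = Suc (b j) \<or> b j = Suc (b i)"
      "a i = Suc (b i) \<or> b i = Suc (a i)" "a j = Suc (b j) \<or> b j = Suc (a j)" for i j
    unfolding t_def by (rule min_step[OF that])
  have t: "a j + b j < 2 * s \<longleftrightarrow> t j < s" if "j < 4" for j
    using T[OF that] by auto
  have "t 0 + t 1 + t 2 + t 3 + 2 = 4 * s"
  proof (rule quad_crossing_aux[OF step[OF A(1) B(1) AB(1,2)] step[OF A(2) B(2) AB(2,3)]
        step[OF A(3) B(3) AB(3,4)] step[OF A(4) B(4) AB(4,1)]])
    have "t 0 = t 1" if "(a 0 < b 0) \<noteq> (a 1 < b 1)"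
      using step[OF A(1) B(1) AB(1,2)] that by simp
    moreover have "t 1 = t 2" if "(a 1 < b 1) \<noteq> (a 2 < b 2)"
      using step[OF A(2) B(2) AB(2,3)] that by simp
    moreover have "t 2 = t 3" if "(a 2 < b 2) \<noteq> (a 3 < b 3)"
      using step[OF A(3) B(3) AB(3,4)] that by simp
    moreover have "t 3 = t 0" if "(a 3 < b 3) \<noteq> (a 0 < b 0)"
      using step[OF A(4) B(4) AB(4,1)] that by simp
    ultimately have c: "((a 0 < b 0) \<noteq> (a 1 < b 1) \<and> a 0 + b 0 < 2 * s \<and> a 1 + b 1 < 2 * s) =
        ((a 0 < b 0) \<noteq> (a 1 < b 1) \<and> t 0 < s)"
      "((a 1 < b 1) \<noteq> (a 2 < b 2) \<and> a 1 + b 1 < 2 * s \<and> a 2 + b 2 < 2 * s) =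
        ((a 1 < b 1) \<noteq> (a 2 < b 2) \<and> t 1 < s)"
      "((a 2 < b 2) \<noteq> (a 3 < b 3) \<and> a 2 + b 2 < 2 * s \<and> a 3 + b 3 < 2 * s) =
        ((a 2 < b 2) \<noteq> (a 3 < b 3) \<and> t 2 < s)"
      "((a 3 < b 3) \<noteq> (a 0 < b 0) \<and> a 3 + b 3 < 2 * s \<and> a 0 + b 0 < 2 * s) =
        ((a 3 < b 3) \<noteq> (a 0 < b 0) \<and> t 3 < s)"
      using t[of 0] t[of 1] t[of 2] t[of 3] by auto
    show "odd (of_bool ((a 0 < b 0) \<noteq> (a 1 < b 1) \<and> t 0 < s) +
       of_bool ((a 1 < b 1) \<noteq> (a 2 < b 2) \<and> t 1 < s) +
       of_bool ((a 2 < b 2) \<noteq> (a 3 < b 3) \<and> t 2 < s) +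
       (of_bool ((a 3 < b 3) \<noteq> (a 0 < b 0) \<and> t 3 < s) :: nat))"
      using o unfolding c .
  qed
  then have "a 0 + b 0 + (a 1 + b 1) + (a 2 + b 2) + (a 3 + b 3) = 8 * s"
    using T[of 0] T[of 1] T[of 2] T[of 3] by simp
  moreover have "(\<Sum>j<4. a j + b j) = (\<Sum>j\<in>{0,1,2,3}. a j + b j)"
    by (rule sum.cong) auto
  ultimately show ?thesis by simp
qed

section \<open>Quadrangulated complexes\<close>

text \<open>\<open>cocycle\<close> is the vanishing of the first cohomology modulo 2. Sides are
  pairs of a face and a position, so an edge that a face meets twice is counted twice.\<close>

locale quad_complex =
  fixes W :: "'v set" and E :: "'v set set" and Fs :: "'f set" and q :: "'f \<Rightarrow> nat \<Rightarrow> 'v"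
  assumes finite_W: "finite W" and W_nonempty: "W \<noteq> {}"
    and edgeD: "\<And>e. e \<in> E \<Longrightarrow> \<exists>x y. e = {x, y} \<and> x \<noteq> y \<and> x \<in> W \<and> y \<in> W"
    and finite_Fs: "finite Fs"
    and q4: "\<And>f. f \<in> Fs \<Longrightarrow> q f 4 = q f 0"
    and side_in_E: "\<And>f j. f \<in> Fs \<Longrightarrow> j < 4 \<Longrightarrow> {q f j, q f (Suc j)} \<in> E"
    and two_sides: "\<And>e. e \<in> E \<Longrightarrow> card {(f, j). f \<in> Fs \<and> j < (4::nat) \<and> {q f j, q f (Suc j)} = e} = 2"
    and cocycle: "\<And>C. (\<And>f. f \<in> Fs \<Longrightarrow> even (card {j. j < (4::nat) \<and> {q f j, q f (Suc j)} \<in> C})) \<Longrightarrow>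
                   \<exists>S. \<forall>x y. {x, y} \<in> E \<longrightarrow> ({x, y} \<in> C \<longleftrightarrow> (x \<in> S) \<noteq> (y \<in> S))"
begin

abbreviation side :: "'f \<Rightarrow> nat \<Rightarrow> 'v set" where "side f j \<equiv> {q f j, q f (Suc j)}"

definition sides :: "'f set \<Rightarrow> 'v set \<Rightarrow> ('f \<times> nat) set" where
  "sides H e = {(f, j). f \<in> H \<and> j < 4 \<and> side f j = e}"

definition odd_on :: "'f \<Rightarrow> 'v set set \<Rightarrow> bool" where
  "odd_on f C \<longleftrightarrow> odd (card {j. j < 4 \<and> side f j \<in> C})"

definition cob :: "'v set \<Rightarrow> 'v set set" where
  "cob S = {e \<in> E. \<exists>x\<in>e. \<exists>y\<in>e. x \<in> S \<and> y \<notin> S}"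

lemma finite_E: "finite E"
proof (rule finite_subset)
  show "E \<subseteq> Pow W" using edgeD by fastforce
qed (simp add: finite_W)

lemma in_cob_iff: "{x, y} \<in> E \<Longrightarrow> {x, y} \<in> cob S \<longleftrightarrow> (x \<in> S) \<noteq> (y \<in> S)"
  by (auto simp: cob_def)

lemma parity_functional_odd_on: "parity_functional (odd_on f)"
  unfolding odd_on_def using parity_functional_odd_card[of "{..<4}" "side f"] by simp

lemma odd_on_cong:
  "(\<And>j. j < 4 \<Longrightarrow> side f j \<in> C \<longleftrightarrow> side f j \<in> D) \<Longrightarrow> odd_on f C \<longleftrightarrow> odd_on f D"
  unfolding odd_on_def by (metis (mono_tags, lifting) Collect_cong)

lemma not_odd_on_changes:
  fixes P :: "'v \<Rightarrow> bool"
  assumes "f \<in> Fs" "\<And>j. j < 4 \<Longrightarrow> side f j \<in> C \<longleftrightarrow> P (q f j) \<noteq> P (q f (Suc j))"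
  shows "\<not> odd_on f C"
proof -
  have "{j. j < 4 \<and> side f j \<in> C} = {j. j < 4 \<and> P (q f j) \<noteq> P (q f (Suc j))}"
    using assms(2) by auto
  then show ?thesis
    unfolding odd_on_def using odd_card_changes[of 4 "\<lambda>j. P (q f j)"] q4[OF assms(1)] by simp
qed

lemma sum_sides:
  assumes "H \<subseteq> Fs"
  shows "(\<Sum>f\<in>H. card {j. j < 4 \<and> side f j \<in> C}) = (\<Sum>e\<in>E \<inter> C. card (sides H e))"
proof -
  have fH: "finite H" using assms finite_Fs finite_subset by blast
  define T where "T = (SIGMA f:H. {j. j < 4 \<and> side f j \<in> C})"
  have fT: "finite T" unfolding T_def using fH by auto
  have "(\<Sum>f\<in>H. card {j. j < 4 \<and> side f j \<in> C}) = card T"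
    unfolding T_def using fH by (subst card_SigmaI) auto
  also have "\<dots> = (\<Sum>e\<in>E \<inter> C. \<Sum>s\<in>{s \<in> T. (\<lambda>(f, j). side f j) s = e}. 1)"
  proof (subst sum.group)
    show "(\<lambda>(f, j). side f j) ` T \<subseteq> E \<inter> C"
      using side_in_E assms by (auto simp: T_def)
  qed (use fT finite_E in auto)
  also have "\<dots> = (\<Sum>e\<in>E \<inter> C. card (sides H e))"
  proof (rule sum.cong)
    fix e assume "e \<in> E \<inter> C"
    then have "{s \<in> T. (\<lambda>(f, j). side f j) s = e} = sides H e"
      by (auto simp: T_def sides_def)
    then show "(\<Sum>s\<in>{s \<in> T. (\<lambda>(f, j). side f j) s = e}. 1) = card (sides H e)" by simp
  qed auto
  finally show ?thesis .
qed

lemma card_sides_Fs: "e \<in> E \<Longrightarrow> card (sides Fs e) = 2"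
  using two_sides by (simp add: sides_def)

lemma finite_sides: "e \<in> E \<Longrightarrow> H \<subseteq> Fs \<Longrightarrow> finite (sides H e)"
  by (rule finite_subset[of _ "sides Fs e"], force simp: sides_def)
    (metis card.infinite card_sides_Fs zero_neq_numeral)

lemma odd_card_odd_on:
  assumes "H \<subseteq> Fs"
  shows "odd (card {f \<in> H. odd_on f C}) \<longleftrightarrow> odd (\<Sum>e\<in>E \<inter> C. card (sides H e))"
proof -
  have "finite H" using assms finite_Fs finite_subset by blast
  then show ?thesis
    unfolding sum_sides[OF assms, symmetric] odd_on_def by (simp add: even_sum_iff)
qed

text \<open>Counting sides gives \<open>card E = 2 * card Fs\<close>. The closed cochains have
  dimension at least \<open>card E - card Fs\<close>, the coboundaries at most
  \<open>card W - 1\<close>, and by \<open>cocycle\<close> every closed cochain is a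
  coboundary.\<close>

lemma card_faces_less: "card Fs < card W"
proof -
  have "4 * card Fs = (\<Sum>f\<in>Fs. card {j. j < (4::nat) \<and> side f j \<in> E})"
  proof -
    have "card {j. j < (4::nat) \<and> side f j \<in> E} = 4" if "f \<in> Fs" for f
    proof -
      have "{j. j < (4::nat) \<and> side f j \<in> E} = {..<4}" using side_in_E[OF that] by auto
      then show ?thesis by simp
    qed
    then show ?thesis by simp
  qed
  also have "\<dots> = 2 * card E"
    unfolding sum_sides[OF order_refl] by (simp add: card_sides_Fs)
  finally have EF: "card E = 2 * card Fs" by simp
  obtain x0 where x0: "x0 \<in> W" using W_nonempty by auto
  let ?Z = "{X. X \<subseteq> E \<and> (\<forall>f\<in>Fs. \<not> odd_on f X)}"
  let ?P = "insert x0 ` Pow (W - {x0})"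
  have "?Z \<subseteq> cob ` ?P"
  proof
    fix X assume X: "X \<in> ?Z"
    then obtain S where S: "\<forall>x y. {x, y} \<in> E \<longrightarrow> ({x, y} \<in> X \<longleftrightarrow> (x \<in> S) \<noteq> (y \<in> S))"
      using cocycle[of X] by (auto simp: odd_on_def)
    \<comment> \<open>A set and its complement have the same coboundary, so the one containing
      \<open>x0\<close> is taken; this saves one dimension and makes the inequality strict.\<close>
    define T where "T = {x \<in> W. x \<in> S \<longleftrightarrow> x0 \<in> S}"
    have "X = cob T"
    proof (rule set_eqI)
      fix e
      show "e \<in> X \<longleftrightarrow> e \<in> cob T"
      proof (cases "e \<in> E")
        case True
        then obtain x y where e: "e = {x, y}" "x \<in> W" "y \<in> W" using edgeD by blast
        have "e \<in> X \<longleftrightarrow> (x \<in> S) \<noteq> (y \<in> S)" using S True e by simp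
        also have "\<dots> \<longleftrightarrow> (x \<in> T) \<noteq> (y \<in> T)" using e unfolding T_def by blast
        also have "\<dots> \<longleftrightarrow> e \<in> cob T" using in_cob_iff True e by simp
        finally show ?thesis .
      qed (use X in \<open>auto simp: cob_def\<close>)
    qed
    moreover have "T = insert x0 (T - {x0})" "T - {x0} \<subseteq> W - {x0}"
      using x0 by (auto simp: T_def)
    ultimately show "X \<in> cob ` ?P" by blast
  qed
  then have "card ?Z \<le> card ?P"
    using finite_W by (meson card_image_le card_mono finite_Diff finite_Pow_iff finite_imageI order_trans)
  also have "\<dots> \<le> card (Pow (W - {x0}))"
    using finite_W by (intro card_image_le) auto
  also have "\<dots> = 2 ^ (card W - 1)"
    using finite_W x0 by (simp add: card_Pow)
  finally have "2 ^ card E \<le> 2 ^ card Fs * (2 :: nat) ^ (card W - 1)"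
    using card_parity_kernel[OF finite_Fs finite_E parity_functional_odd_on]
    by (meson mult_le_mono2 order_trans)
  then have "(2::nat) ^ card E \<le> 2 ^ (card Fs + (card W - 1))"
    by (simp add: power_add)
  then have "card E \<le> card Fs + (card W - 1)"
    by simp
  moreover have "card W > 0" using x0 finite_W card_gt_0_iff by blast
  ultimately show ?thesis using EF by linarith
qed

end

text \<open>The cycle is indexed by all natural numbers with period \<open>2 * k\<close>, so
  antipodal positions are \<open>i\<close> and \<open>i + k\<close> without reduction modulo
  \<open>2 * k\<close>. \<open>v_iso\<close> bounds walks in the whole graph; the bound passes to
  walks inside any part of it.\<close>

locale quad_complex_cycle = quad_complex W E Fs q
  for W :: "'v set" and E and Fs :: "'f set" and q +
  fixes v :: "nat \<Rightarrow> 'v" and k :: nat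
  assumes k2: "2 \<le> k"
    and v_per: "\<And>i. v (i + 2 * k) = v i"
    and v_edge: "\<And>i. {v i, v (Suc i)} \<in> E"
    and v_iso: "\<And>i j L. i \<le> j \<Longrightarrow> j \<le> i + k \<Longrightarrow> (v i, v j) \<in> {(x, y). {x, y} \<in> E} ^^ L \<Longrightarrow> j - i \<le> L"
begin

abbreviation ce :: "nat \<Rightarrow> 'v set" where "ce i \<equiv> {v i, v (Suc i)}"

definition odd_cyc :: "'v set set \<Rightarrow> bool" where
  "odd_cyc C \<longleftrightarrow> odd (card {i. i < 2 * k \<and> ce i \<in> C})"

lemma parity_functional_odd_cyc: "parity_functional odd_cyc"
  unfolding odd_cyc_def using parity_functional_odd_card[of "{..<2 * k}" ce] by simp

lemma v_2k: "v (2 * k) = v 0" using v_per[of 0] by simp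

lemma not_odd_cyc_changes:
  fixes P :: "'v \<Rightarrow> bool"
  assumes "\<And>i. i < 2 * k \<Longrightarrow> ce i \<in> C \<longleftrightarrow> P (v i) \<noteq> P (v (Suc i))"
  shows "\<not> odd_cyc C"
proof -
  have "{i. i < 2 * k \<and> ce i \<in> C} = {i. i < 2 * k \<and> P (v i) \<noteq> P (v (Suc i))}"
    using assms by auto
  then show ?thesis
    unfolding odd_cyc_def using odd_card_changes[of "2 * k" "\<lambda>i. P (v i)"] v_2k by simp
qed

lemma v_neq: "i < j \<Longrightarrow> j < i + 2 * k \<Longrightarrow> v i \<noteq> v j"
proof
  assume ij: "i < j" "j < i + 2 * k" and eq: "v i = v j"
  show False
  proof (cases "j \<le> i + k")
    case True
    then show False using v_iso[of i j 0] eq ij by simp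
  next
    case False
    then show False using v_iso[of j "i + 2 * k" 0] eq ij v_per[of i] by simp
  qed
qed

lemma v_inj: "i < 2 * k \<Longrightarrow> j < 2 * k \<Longrightarrow> v i = v j \<Longrightarrow> i = j"
  using v_neq[of i j] v_neq[of j i] by (cases i j rule: linorder_cases) auto

lemma v_mod: "v (i mod (2 * k)) = v i"
proof -
  have "v (a + b * (2 * k)) = v a" for a b
  proof (induction b)
    case (Suc b)
    have "v (a + Suc b * (2 * k)) = v (a + b * (2 * k) + 2 * k)"
      by (rule arg_cong[where f = v]) simp
    with Suc v_per show ?case by simp
  qed simp
  from this[of "i mod (2 * k)" "i div (2 * k)"] show ?thesis by (metis mod_div_mult_eq)
qed

lemma ce_inj:
  assumes "i < 2 * k" "j < 2 * k" "ce i = ce j"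
  shows "i = j"
proof (rule ccontr)
  assume "i \<noteq> j"
  then have "v i \<noteq> v j" using v_inj assms by blast
  then have e: "v i = v (Suc j)" "v j = v (Suc i)"
    using assms(3) by (auto simp: doubleton_eq_iff)
  have wrap: "a = Suc b \<or> a = 0 \<and> Suc b = 2 * k" if "a < 2 * k" "b < 2 * k" "v a = v (Suc b)" for a b
  proof (cases "Suc b < 2 * k")
    case False
    then have b: "Suc b = 2 * k" using that by linarith
    then have "v a = v 0" using that v_2k by simp
    then show ?thesis using v_inj[of a 0] that(1) b by simp
  qed (use v_inj[of a "Suc b"] that in blast)
  show False
    using wrap[OF assms(1,2) e(1)] wrap[OF assms(2,1) e(2)] k2 by linarith
qed

definition CE :: "'v set set" where "CE = ce ` {..<2 * k}"

lemma CE_subset: "CE \<subseteq> E" using v_edge by (auto simp: CE_def)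

lemma card_ce: "card {i. i < 2 * k \<and> ce i \<in> C} = card (C \<inter> CE)"
proof (rule bij_betw_same_card)
  show "bij_betw ce {i. i < 2 * k \<and> ce i \<in> C} (C \<inter> CE)"
    unfolding bij_betw_def inj_on_def using ce_inj by (auto simp: CE_def)
qed

text \<open>The form \<open>odd_cyc\<close> vanishes on closed cochains, since these are
  coboundaries, so \<open>parity_duality\<close> writes it as a sum of faces. The sum over all faces
  is zero because every edge has two sides; hence the complement of \<open>H\<close> serves as well,
  and the smaller of the two is taken.\<close>

lemma exists_hemisphere:
  obtains H where "H \<subseteq> Fs" "2 * card H \<le> card Fs" "\<And>C. odd_cyc C \<longleftrightarrow> odd (card {f \<in> H. odd_on f C})"
proof -
  have closed: "\<not> odd_cyc C" if C: "\<And>f. f \<in> Fs \<Longrightarrow> \<not> odd_on f C" for C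
  proof -
    obtain S where "\<forall>x y. {x, y} \<in> E \<longrightarrow> ({x, y} \<in> C \<longleftrightarrow> (x \<in> S) \<noteq> (y \<in> S))"
      using cocycle[of C] C by (auto simp: odd_on_def)
    then show ?thesis using v_edge by (intro not_odd_cyc_changes[of _ "\<lambda>x. x \<in> S"]) auto
  qed
  have "\<exists>H\<subseteq>Fs. \<forall>C. odd_cyc C \<longleftrightarrow> odd (card {f \<in> H. odd_on f C})"
    by (rule parity_duality[OF finite_Fs parity_functional_odd_on parity_functional_odd_cyc]) (rule closed)
  then obtain H where H: "H \<subseteq> Fs" "\<And>C. odd_cyc C \<longleftrightarrow> odd (card {f \<in> H. odd_on f C})"
    by auto
  have fH: "finite H" using H finite_Fs finite_subset by blast
  show thesis
  proof (cases "2 * card H \<le> card Fs")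
    case True
    then show thesis using H that by blast
  next
    case False
    have "odd_cyc C \<longleftrightarrow> odd (card {f \<in> Fs - H. odd_on f C})" for C
    proof -
      have "card {f \<in> Fs. odd_on f C} = card {f \<in> H. odd_on f C} + card {f \<in> Fs - H. odd_on f C}"
        using H(1) finite_Fs fH by (subst card_Un_disjoint[symmetric]) (auto intro!: arg_cong[where f = card])
      moreover have "even (card {f \<in> Fs. odd_on f C})"
        using odd_card_odd_on[OF order_refl, of C] by (simp add: card_sides_Fs)
      ultimately show ?thesis using H(2)[of C] by presburger
    qed
    moreover have "2 * card (Fs - H) \<le> card Fs"
      using False H(1) fH by (simp add: card_Diff_subset)
    ultimately show thesis using that[of "Fs - H"] by blast
  qed
qed

end

text \<open>\<open>boundary_H\<close> is Stokes' formula modulo 2, tested on every cochain: the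
  boundary of the chain \<open>H\<close> is the cycle.\<close>

locale quad_hemisphere = quad_complex_cycle W E Fs q v k
  for W :: "'v set" and E and Fs :: "'f set" and q v k +
  fixes H :: "'f set"
  assumes H_subset: "H \<subseteq> Fs"
    and boundary_H: "\<And>C. odd_cyc C \<longleftrightarrow> odd (card {f \<in> H. odd_on f C})"
begin

lemma finite_H: "finite H" using H_subset finite_Fs finite_subset by blast

lemma card_sides_H_le: "e \<in> E \<Longrightarrow> card (sides H e) \<le> 2"
  using card_mono[OF finite_sides[OF _ order_refl], of e "sides H e"] card_sides_Fs[of e] H_subset
  by (force simp: sides_def)

lemma odd_card_sides_H:
  assumes "e \<in> E" shows "odd (card (sides H e)) \<longleftrightarrow> e \<in> CE"
proof -
  have "E \<inter> {e} = {e}" using assms by auto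
  then have "odd (card (sides H e)) \<longleftrightarrow> odd_cyc {e}"
    unfolding boundary_H odd_card_odd_on[OF H_subset] by simp
  also have "\<dots> \<longleftrightarrow> e \<in> CE"
    unfolding odd_cyc_def card_ce by (cases "e \<in> CE") auto
  finally show ?thesis .
qed

definition EH :: "'v set set" where "EH = {e \<in> E. sides H e \<noteq> {}}"

lemma EH_subset: "EH \<subseteq> E" by (auto simp: EH_def)

lemma side_in_EH: "f \<in> H \<Longrightarrow> j < 4 \<Longrightarrow> side f j \<in> EH"
proof -
  assume fj: "f \<in> H" "j < 4"
  then have "(f, j) \<in> sides H (side f j)" by (simp add: sides_def)
  moreover have "side f j \<in> E" using fj H_subset side_in_E by blast
  ultimately show ?thesis unfolding EH_def by blast
qed

lemma CE_EH: "CE \<subseteq> EH"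
proof
  fix e assume e: "e \<in> CE"
  then have "e \<in> E" using CE_subset by auto
  then have "odd (card (sides H e))" using odd_card_sides_H e by simp
  then have "sides H e \<noteq> {}" by (intro notI) simp
  then show "e \<in> EH" using \<open>e \<in> E\<close> by (simp add: EH_def)
qed

lemma card_sides_H:
  assumes "e \<in> EH" shows "card (sides H e) + card ({e} \<inter> CE) = 2"
proof -
  have e: "e \<in> E" "sides H e \<noteq> {}" using assms by (auto simp: EH_def)
  have "card (sides H e) \<noteq> 0" using finite_sides[OF e(1) H_subset] e(2) by simp
  with card_sides_H_le[OF e(1)] consider "card (sides H e) = 1" | "card (sides H e) = 2"
    by linarith
  then show ?thesis
    using odd_card_sides_H[OF e(1)] by cases simp_all
qed

lemma EH_other_side:
  assumes "f \<in> Fs - H" "j < 4" "side f j \<in> EH" shows "side f j \<in> CE"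
proof (rule ccontr)
  assume n: "side f j \<notin> CE"
  have E: "side f j \<in> E" using assms EH_subset by auto
  have "card (sides H (side f j)) = 2" using card_sides_H[OF assms(3)] n by simp
  moreover have "sides H (side f j) \<subset> sides Fs (side f j)"
    using assms H_subset by (auto simp: sides_def)
  then have "card (sides H (side f j)) < card (sides Fs (side f j))"
    by (rule psubset_card_mono[OF finite_sides[OF E order_refl]])
  ultimately show False
    by (simp add: card_sides_Fs[OF E])
qed

definition adj :: "('v \<times> 'v) set" where "adj = {(x, y). {x, y} \<in> EH}"

text \<open>Duality does not show \<open>H\<close> to be connected, so distances are used only in
  the component of the cycle. Outside it the \<open>LEAST\<close> in \<open>dist\<close> may range
  over no walk at all.\<close>

definition R :: "'v set" where "R = {z. \<exists>L. (v 0, z) \<in> adj ^^ L}"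

definition dist :: "'v \<Rightarrow> 'v \<Rightarrow> nat" where "dist x y = (LEAST L. (x, y) \<in> adj ^^ L)"

lemma sym_adj: "sym adj" by (auto simp: adj_def sym_def insert_commute)

lemma adj_sym: "(x, y) \<in> adj \<Longrightarrow> (y, x) \<in> adj" using sym_adj by (rule symD)

lemma R_adj: "x \<in> R \<Longrightarrow> (x, y) \<in> adj \<Longrightarrow> y \<in> R"
  unfolding R_def by (auto intro: relpow_Suc_I)

lemma R_conn: assumes "x \<in> R" "y \<in> R" shows "\<exists>L. (x, y) \<in> adj ^^ L"
proof -
  obtain L M where "(v 0, x) \<in> adj ^^ L" "(v 0, y) \<in> adj ^^ M" using assms by (auto simp: R_def)
  then have "(x, y) \<in> adj ^^ (L + M)"
    using relpow_sym[OF sym_adj] unfolding relpow_add by blast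
  then show ?thesis by blast
qed

lemma dist_walk: "x \<in> R \<Longrightarrow> y \<in> R \<Longrightarrow> (x, y) \<in> adj ^^ dist x y"
  unfolding dist_def by (rule LeastI_ex) (rule R_conn)

lemma dist_le: "(x, y) \<in> adj ^^ L \<Longrightarrow> dist x y \<le> L"
  unfolding dist_def by (rule Least_le)

lemma dist_sym: "dist x y = dist y x"
  unfolding dist_def using relpow_sym[OF sym_adj] by metis

lemma ce_adj: "(v i, v (Suc i)) \<in> adj"
proof -
  have "ce (i mod (2 * k)) = ce i"
    by (metis mod_Suc_eq v_mod)
  moreover have "ce (i mod (2 * k)) \<in> CE" unfolding CE_def by (rule imageI) (use k2 in simp)
  ultimately have "ce i \<in> CE" by simp
  then show ?thesis using CE_EH by (auto simp: adj_def)
qed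

lemma v_walk: "(v i, v (i + m)) \<in> adj ^^ m"
  by (induction m) (auto intro: relpow_Suc_I ce_adj)

lemma v_R: "v i \<in> R"
  using v_walk[of 0 i] by (auto simp: R_def)

lemma dist_v:
  assumes "i \<le> j" "j \<le> i + k" shows "dist (v i) (v j) = j - i"
proof (rule antisym)
  show "dist (v i) (v j) \<le> j - i" using dist_le[OF v_walk[of i "j - i"]] assms by simp
  have "adj \<subseteq> {(x, y). {x, y} \<in> E}" using EH_subset by (auto simp: adj_def)
  then have "adj ^^ n \<subseteq> {(x, y). {x, y} \<in> E} ^^ n" for n
    by (induction n) auto
  then show "j - i \<le> dist (v i) (v j)"
    using v_iso[OF assms] dist_walk[OF v_R v_R] by blast
qed

text \<open>Every face has four sides, so the cochain of all edges is closed and thus a coboundary: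
  the graph is bipartite. Hence the two distances, which differ by at most 1, have different
  parity.\<close>

lemma dist_adj:
  assumes "x \<in> R" "y \<in> R" "(y, z) \<in> adj"
  shows "dist x y = Suc (dist x z) \<or> dist x z = Suc (dist x y)"
proof -
  have "\<exists>S. \<forall>x y. {x, y} \<in> E \<longrightarrow> ({x, y} \<in> E \<longleftrightarrow> (x \<in> S) \<noteq> (y \<in> S))"
  proof (rule cocycle)
    fix f assume "f \<in> Fs"
    then have "{j. j < (4::nat) \<and> side f j \<in> E} = {..<4}" using side_in_E by auto
    then show "even (card {j. j < (4::nat) \<and> side f j \<in> E})" by simp
  qed
  then obtain S where S: "\<And>x y. {x, y} \<in> E \<Longrightarrow> (x \<in> S) \<noteq> (y \<in> S)" by blast
  have walk: "odd L \<longleftrightarrow> (x \<in> S) \<noteq> (y \<in> S)" if "(x, y) \<in> adj ^^ L" for x y L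
    using that
  proof (induction L arbitrary: y)
    case (Suc L)
    then obtain z where z: "(x, z) \<in> adj ^^ L" "(z, y) \<in> adj" by auto
    then have "(z \<in> S) \<noteq> (y \<in> S)" using S EH_subset by (auto simp: adj_def)
    then show ?case unfolding even_Suc using Suc.IH[OF z(1)] by argo
  qed simp
  have z: "z \<in> R" using R_adj assms by blast
  have yz: "(y \<in> S) \<noteq> (z \<in> S)" using S EH_subset assms(3) by (auto simp: adj_def)
  have "dist x z \<le> Suc (dist x y)"
    using relpow_Suc_I[OF dist_walk[OF assms(1,2)] assms(3)] by (rule dist_le)
  moreover have "dist x y \<le> Suc (dist x z)"
    using relpow_Suc_I[OF dist_walk[OF assms(1) z] adj_sym[OF assms(3)]] by (rule dist_le)
  moreover have "odd (dist x y) \<noteq> odd (dist x z)"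
    unfolding walk[OF dist_walk[OF assms(1,2)]] walk[OF dist_walk[OF assms(1) z]] using yz by argo
  then have "dist x y \<noteq> dist x z" by auto
  ultimately show ?thesis by linarith
qed

end

section \<open>Cuts in the hemisphere and their connected halves\<close>

context quad_hemisphere
begin

text \<open>Restricted to edges of \<open>H\<close> in the component \<open>R\<close>, where
  \<open>dist\<close> is meaningful. A face of \<open>H\<close> has all its corners in
  \<open>R\<close> or none, so cuts stay closed on \<open>H\<close>.\<close>

definition cut :: "('v \<Rightarrow> bool) \<Rightarrow> 'v set set" where
  "cut P = {e \<in> EH. e \<subseteq> R \<and> (\<exists>x\<in>e. \<exists>y\<in>e. P x \<and> \<not> P y)}"

lemma in_cut_iff:
  assumes "(x, y) \<in> adj" "x \<in> R" shows "{x, y} \<in> cut P \<longleftrightarrow> P x \<noteq> P y"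
proof -
  have "{x, y} \<in> EH" "{x, y} \<subseteq> R" using assms R_adj by (auto simp: adj_def)
  then show ?thesis unfolding cut_def by blast
qed

lemma cut_subset: "cut P \<subseteq> E"
  using EH_subset by (auto simp: cut_def)

lemma face_adj: "f \<in> H \<Longrightarrow> j < 4 \<Longrightarrow> (q f j, q f (Suc j)) \<in> adj"
  using side_in_EH by (simp add: adj_def)

lemma face_R:
  assumes f: "f \<in> H" and i: "i < 4" "q f i \<in> R" and j: "j \<le> 4"
  shows "q f j \<in> R"
proof -
  have up: "q f m \<in> R \<Longrightarrow> m + n \<le> 4 \<Longrightarrow> q f (m + n) \<in> R" for m n
  proof (induction n)
    case (Suc n)
    then have "q f (m + n) \<in> R" "m + n < 4" by simp_all
    then show ?case using R_adj[OF _ face_adj[OF f]] by simp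
  qed simp
  have "q f 4 \<in> R" using up[of i "4 - i"] i by simp
  then have "q f 0 \<in> R" using q4 f H_subset by auto
  then show ?thesis using up[of 0 j] j by simp
qed

lemma not_odd_on_cut:
  assumes "f \<in> H" shows "\<not> odd_on f (cut P)"
proof (cases "q f 0 \<in> R")
  case True
  have "side f j \<in> cut P \<longleftrightarrow> P (q f j) \<noteq> P (q f (Suc j))" if "j < 4" for j
    using in_cut_iff[OF face_adj[OF assms that]] face_R[OF assms _ True] that by simp
  then show ?thesis
    by (rule not_odd_on_changes[OF subsetD[OF H_subset assms]])
next
  case False
  have none: "{j. j < 4 \<and> side f j \<in> cut P} = {}"
  proof (rule ccontr)
    assume "\<not> ?thesis"
    then obtain j where "j < 4" "q f j \<in> R" by (auto simp: cut_def)
    then show False using face_R[OF assms, of j 0] False by simp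
  qed
  show ?thesis unfolding odd_on_def none by simp
qed

text \<open>
  A cochain that is closed on the hemisphere \<open>H\<close> extends to one that is closed on all faces:
  it has an even number of edges on the cycle, so there it is the coboundary of some set \<open>S'\<close> of
  vertices, and outside \<open>H\<close> the coboundary of \<open>S'\<close> can be used.
\<close>

lemma hemisphere_cocycle:
  assumes X: "X \<subseteq> EH" and closed: "\<And>f. f \<in> H \<Longrightarrow> \<not> odd_on f X"
  shows "\<exists>S. \<forall>x y. (x, y) \<in> adj \<longrightarrow> ({x, y} \<in> X \<longleftrightarrow> (x \<in> S) \<noteq> (y \<in> S))"
proof -
  have none: "{f \<in> H. odd_on f X} = {}" using closed by blast
  have even: "\<not> odd_cyc X" unfolding boundary_H none by simp
  \<comment> \<open>A potential along the cycle: the parity of the number of edges of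
    \<open>X\<close> passed before position \<open>i\<close>. As \<open>odd_cyc X\<close> is false,
    it is back at its start value after \<open>2 * k\<close> steps, which settles the last
    edge.\<close>
  define P where "P i \<longleftrightarrow> odd (card {l. l < i \<and> ce l \<in> X})" for i
  have P_Suc: "P (Suc i) \<noteq> P i \<longleftrightarrow> ce i \<in> X" for i
  proof -
    have "{l. l < Suc i \<and> ce l \<in> X} = (if ce i \<in> X then insert i else id) {l. l < i \<and> ce l \<in> X}"
      by (auto simp: less_Suc_eq)
    then have "card {l. l < Suc i \<and> ce l \<in> X} =
        (if ce i \<in> X then Suc (card {l. l < i \<and> ce l \<in> X}) else card {l. l < i \<and> ce l \<in> X})"
      by simp
    then show ?thesis unfolding P_def by simp
  qed
  define S' where "S' = {v i | i. i < 2 * k \<and> P i}"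
  have v_S': "v i \<in> S' \<longleftrightarrow> P i" if "i < 2 * k" for i
    using that v_inj unfolding S'_def by blast
  have ce_S': "ce i \<in> X \<longleftrightarrow> (v i \<in> S') \<noteq> (v (Suc i) \<in> S')" if "i < 2 * k" for i
  proof (cases "Suc i < 2 * k")
    case True
    then show ?thesis using P_Suc[of i] v_S'[of i] v_S'[of "Suc i"] that by argo
  next
    case False
    then have i: "Suc i = 2 * k" using that by simp
    have "\<not> P (2 * k)" using even by (simp add: P_def odd_cyc_def)
    moreover have "\<not> P 0" by (simp add: P_def)
    moreover have "v (Suc i) = v 0" using i v_2k by simp
    ultimately show ?thesis using P_Suc[of i] v_S'[of i] v_S'[of 0] that i by simp
  qed
  define Y where "Y = X \<union> (cob S' - EH)"
  have Y_EH: "e \<in> Y \<longleftrightarrow> e \<in> X" if "e \<in> EH" for e using that by (auto simp: Y_def)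
  have "even (card {j. j < (4::nat) \<and> side f j \<in> Y})" if f: "f \<in> Fs" for f
  proof (cases "f \<in> H")
    case True
    then have "odd_on f Y \<longleftrightarrow> odd_on f X"
      by (intro odd_on_cong Y_EH side_in_EH)
    then show ?thesis using closed[OF True] by (simp add: odd_on_def)
  next
    case False
    have "side f j \<in> Y \<longleftrightarrow> (q f j \<in> S') \<noteq> (q f (Suc j) \<in> S')" if j: "j < 4" for j
    proof (cases "side f j \<in> EH")
      case True
      then have "side f j \<in> CE" using EH_other_side f False j by blast
      then obtain i where i: "i < 2 * k" "side f j = ce i" by (auto simp: CE_def)
      have "(q f j \<in> S') \<noteq> (q f (Suc j) \<in> S') \<longleftrightarrow> (v i \<in> S') \<noteq> (v (Suc i) \<in> S')"
        using i(2) unfolding doubleton_eq_iff by metis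
      then show ?thesis using ce_S'[OF i(1)] Y_EH[OF True] i(2) by simp
    next
      case False
      then have "side f j \<in> Y \<longleftrightarrow> side f j \<in> cob S'" using X by (auto simp: Y_def)
      then show ?thesis using in_cob_iff side_in_E f j by simp
    qed
    then have "\<not> odd_on f Y" using not_odd_on_changes[OF f, of Y "\<lambda>x. x \<in> S'"] by simp
    then show ?thesis by (simp add: odd_on_def)
  qed
  then have "\<exists>S. \<forall>x y. {x, y} \<in> E \<longrightarrow> ({x, y} \<in> Y \<longleftrightarrow> (x \<in> S) \<noteq> (y \<in> S))"
    by (rule cocycle)
  then obtain S where S: "\<And>x y. {x, y} \<in> E \<Longrightarrow> {x, y} \<in> Y \<longleftrightarrow> (x \<in> S) \<noteq> (y \<in> S)"
    by blast
  show ?thesis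
  proof (intro exI[of _ S] allI impI)
    fix x y assume "(x, y) \<in> adj"
    then have "{x, y} \<in> EH" "{x, y} \<in> E" using EH_subset by (auto simp: adj_def)
    then show "{x, y} \<in> X \<longleftrightarrow> (x \<in> S) \<noteq> (y \<in> S)"
      using S[of x y] Y_EH[of "{x, y}"] by argo
  qed
qed

text \<open>A geodesic from \<open>z\<close> to \<open>x\<close> stays among the vertices closer to
  \<open>x\<close> than to \<open>y\<close>: each step reduces the distance to \<open>x\<close> by 1
  and that to \<open>y\<close> by at most 1. It thus avoids \<open>X\<close>, and membership in
  \<open>S\<close> is constant along it. So each half of the cut is connected.\<close>

lemma closer_const:
  assumes x: "x \<in> R" and y: "y \<in> R" and z: "z \<in> R" "dist z x < dist z y"
    and S: "\<And>a b. (a, b) \<in> adj \<Longrightarrow> {a, b} \<in> X \<longleftrightarrow> (a \<in> S) \<noteq> (b \<in> S)"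
    and X: "\<And>a b. (a, b) \<in> adj \<Longrightarrow> dist a x < dist a y \<Longrightarrow> dist b x < dist b y \<Longrightarrow> {a, b} \<notin> X"
  shows "z \<in> S \<longleftrightarrow> x \<in> S"
  using z
proof (induction "dist x z" arbitrary: z)
  case 0
  then have "(x, z) \<in> adj ^^ 0" using dist_walk[OF x] by metis
  then show ?case by simp
next
  case (Suc n)
  then have "(x, z) \<in> adj ^^ Suc n" using dist_walk[OF x] by metis
  then obtain w where w: "(x, w) \<in> adj ^^ n" "(w, z) \<in> adj" by auto
  have wR: "w \<in> R" using R_adj adj_sym Suc.prems(1) w(2) by blast
  have "dist x w \<le> n" using dist_le w(1) by blast
  moreover have "dist x z = Suc (dist x w) \<or> dist x w = Suc (dist x z)"
    using dist_adj[OF x Suc.prems(1) adj_sym[OF w(2)]] by blast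
  ultimately have dw: "dist x w = n" using Suc.hyps(2) by linarith
  have "dist y z = Suc (dist y w) \<or> dist y w = Suc (dist y z)"
    using dist_adj[OF y Suc.prems(1) adj_sym[OF w(2)]] by blast
  then have c: "dist w x < dist w y"
    using Suc.prems(2) Suc.hyps(2) dw
    unfolding dist_sym[of z x] dist_sym[of z y] dist_sym[of w x] dist_sym[of w y] by linarith
  then have "w \<in> S \<longleftrightarrow> x \<in> S" using Suc.hyps(1)[OF dw[symmetric] wR] by blast
  moreover have "{w, z} \<notin> X" using X[OF w(2) c Suc.prems(2)] .
  ultimately show ?case using S[OF w(2)] by blast
qed

text \<open>Both halves of the cut \<open>D\<close> are connected, so a closed subset of
  \<open>D\<close> is empty or \<open>D\<close>, and the kernel count gives
  \<open>card D \<le> card H' + 1\<close> for the set \<open>H'\<close> of faces of \<open>H\<close>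
  that meet \<open>D\<close>. Each of these has at least two sides in \<open>D\<close>, while an
  edge of \<open>D\<close> has two sides in \<open>H\<close>, or one if it is on the cycle, so
  \<open>2 * card H' \<le> 2 * card D - card (D \<inter> CE)\<close>. Together these leave at most 2
  cycle edges.\<close>

lemma card_closer_cut_le_2:
  assumes xy: "(x, y) \<in> adj" and x: "x \<in> R"
  shows "card (cut (\<lambda>z. dist z x < dist z y) \<inter> CE) \<le> 2"
proof -
  define D where "D = cut (\<lambda>z. dist z x < dist z y)"
  have y: "y \<in> R" using R_adj x xy by blast
  have "dist x x = 0" "dist y y = 0" using dist_le[of x x 0] dist_le[of y y 0] by auto
  moreover have "dist x y \<noteq> 0" using dist_adj[OF x x xy] \<open>dist x x = 0\<close> by auto
  ultimately have xP: "dist x x < dist x y" and yP: "\<not> dist y x < dist y y"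
    by (auto simp: dist_sym)
  have finD: "finite D" using cut_subset finite_E finite_subset unfolding D_def by blast
  have comp: "X = {} \<or> X = D" if X: "X \<subseteq> D" and closed: "\<And>f. f \<in> H \<Longrightarrow> \<not> odd_on f X" for X
  proof -
    have XEH: "X \<subseteq> EH" using X by (auto simp: D_def cut_def)
    from hemisphere_cocycle[OF XEH closed]
    obtain S where S0: "\<forall>x y. (x, y) \<in> adj \<longrightarrow> ({x, y} \<in> X \<longleftrightarrow> (x \<in> S) \<noteq> (y \<in> S))"
      by (rule exE)
    note S = S0[rule_format]
    have nX: "{a, b} \<notin> X"
      if "(a, b) \<in> adj" "a \<in> R" "dist a x < dist a y \<longleftrightarrow> dist b x < dist b y" for a b
    proof -
      have "{a, b} \<notin> D"
        unfolding D_def in_cut_iff[OF that(1,2)] using that(3) by simp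
      then show ?thesis using X by blast
    qed
    have XR: "a \<in> R" if "{a, b} \<in> X" for a b using that X by (auto simp: D_def cut_def)
    have A: "z \<in> S \<longleftrightarrow> x \<in> S" if "z \<in> R" "dist z x < dist z y" for z
      by (rule closer_const[OF x y that S]) (use nX XR in blast)+
    have B: "z \<in> S \<longleftrightarrow> y \<in> S" if "z \<in> R" "\<not> dist z x < dist z y" for z
    proof -
      have "dist z x \<noteq> dist z y" using dist_adj[OF that(1) x xy] by auto
      then have z: "dist z y < dist z x" using that(2) by simp
      have nY: "{a, b} \<notin> X" if "(a, b) \<in> adj" "dist a y < dist a x" "dist b y < dist b x" for a b
      proof
        assume ab: "{a, b} \<in> X"
        have "dist a x < dist a y \<longleftrightarrow> dist b x < dist b y" using that(2,3) by simp
        then show False using nX[OF that(1) XR[OF ab]] ab by blast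
      qed
      show ?thesis by (rule closer_const[OF y x that(1) z S nY])
    qed
    have iff: "e \<in> X \<longleftrightarrow> (x \<in> S) \<noteq> (y \<in> S)" if e: "e \<in> D" for e
    proof -
      obtain a b where ab: "e = {a, b}" using e cut_subset edgeD unfolding D_def by blast
      then have "(a, b) \<in> adj" "a \<in> R" "b \<in> R" using e by (auto simp: D_def cut_def adj_def)
      moreover have "(dist a x < dist a y) \<noteq> (dist b x < dist b y)"
        using e unfolding D_def ab in_cut_iff[OF \<open>(a, b) \<in> adj\<close> \<open>a \<in> R\<close>] .
      ultimately show ?thesis unfolding ab using S[of a b] A[of a] A[of b] B[of a] B[of b] by argo
    qed
    show ?thesis using iff X by blast
  qed
  define H' where "H' = {f \<in> H. \<exists>j<4. side f j \<in> D}"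
  have fH': "finite H'" using finite_H by (simp add: H'_def)
  have "{X. X \<subseteq> D \<and> (\<forall>f\<in>H'. \<not> odd_on f X)} \<subseteq> {{}, D}"
  proof
    fix X assume X: "X \<in> {X. X \<subseteq> D \<and> (\<forall>f\<in>H'. \<not> odd_on f X)}"
    have "\<not> odd_on f X" if "f \<in> H" for f
    proof (cases "f \<in> H'")
      case False
      then have none: "{j. j < 4 \<and> side f j \<in> X} = {}" using X that by (auto simp: H'_def)
      show ?thesis unfolding odd_on_def none by simp
    qed (use X in blast)
    then show "X \<in> {{}, D}" using comp X by blast
  qed
  then have "card {X. X \<subseteq> D \<and> (\<forall>f\<in>H'. \<not> odd_on f X)} \<le> card {{}, D}"
    by (rule card_mono[rotated]) simp
  also have "\<dots> \<le> 2" by (simp add: card_insert_if)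
  finally have c2: "card {X. X \<subseteq> D \<and> (\<forall>f\<in>H'. \<not> odd_on f X)} \<le> 2" .
  have "2 ^ card D \<le> 2 ^ card H' * card {X. X \<subseteq> D \<and> (\<forall>f\<in>H'. \<not> odd_on f X)}"
    by (rule card_parity_kernel[OF fH' finD parity_functional_odd_on])
  also have "\<dots> \<le> 2 ^ card H' * 2" using c2 by simp
  finally have "(2::nat) ^ card D \<le> 2 ^ Suc (card H')" by simp
  then have 1: "card D \<le> Suc (card H')"
    by (rule power_le_imp_le_exp[rotated]) simp
  have "2 * card H' = (\<Sum>f\<in>H'. 2)" by simp
  also have "\<dots> \<le> (\<Sum>f\<in>H'. card {j. j < 4 \<and> side f j \<in> D})"
  proof (rule sum_mono)
    fix f assume f: "f \<in> H'"
    then have "{j. j < 4 \<and> side f j \<in> D} \<noteq> {}" by (auto simp: H'_def)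
    then have "card {j. j < 4 \<and> side f j \<in> D} \<noteq> 0" by simp
    moreover have "even (card {j. j < 4 \<and> side f j \<in> D})"
      using not_odd_on_cut[of f "\<lambda>z. dist z x < dist z y"] f by (simp add: D_def H'_def odd_on_def)
    ultimately show "2 \<le> card {j. j < 4 \<and> side f j \<in> D}" by presburger
  qed
  also have "\<dots> \<le> (\<Sum>f\<in>H. card {j. j < 4 \<and> side f j \<in> D})"
    by (rule sum_mono2[OF finite_H]) (auto simp: H'_def)
  also have "\<dots> = (\<Sum>e\<in>D. card (sides H e))"
    unfolding sum_sides[OF H_subset] using cut_subset D_def by (simp add: Int_absorb1)
  finally have 2: "2 * card H' \<le> (\<Sum>e\<in>D. card (sides H e))" .
  have "(\<Sum>e\<in>D. card (sides H e)) + (\<Sum>e\<in>D. card ({e} \<inter> CE)) = (\<Sum>e\<in>D. 2)"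
    unfolding sum.distrib[symmetric]
    by (rule sum.cong) (auto simp: D_def cut_def card_sides_H)
  moreover have "(\<Sum>e\<in>D. card ({e} \<inter> CE)) = card (D \<inter> CE)"
  proof -
    have "(\<Sum>e\<in>D. card ({e} \<inter> CE)) = (\<Sum>e\<in>D. if e \<in> CE then 1 else 0)"
      by (rule sum.cong) auto
    also have "\<dots> = card (D \<inter> CE)" using finD by (simp add: sum.If_cases Int_def)
    finally show ?thesis .
  qed
  ultimately have "(\<Sum>e\<in>D. card (sides H e)) + card (D \<inter> CE) = 2 * card D" by simp
  with 1 2 have "card (D \<inter> CE) \<le> 2" by linarith
  then show ?thesis by (simp add: D_def)
qed

end

lemma sum_card_swap:
  assumes "finite A" "finite B"
  shows "(\<Sum>a\<in>A. card {b \<in> B. P a b}) = (\<Sum>b\<in>B. card {a \<in> A. P a b})"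
proof -
  have "(\<Sum>a\<in>A. card {b \<in> B. P a b}) = (\<Sum>a\<in>A. \<Sum>b\<in>B. of_bool (P a b))"
    using assms by (simp add: Int_def)
  also have "\<dots> = (\<Sum>b\<in>B. \<Sum>a\<in>A. of_bool (P a b))" by (rule sum.swap)
  also have "\<dots> = (\<Sum>b\<in>B. card {a \<in> A. P a b})"
    using assms by (simp add: Int_def)
  finally show ?thesis .
qed

lemma odd_card_nonempty: "odd (card A) \<Longrightarrow> A \<noteq> {}"
  by auto

lemma even_nonzero_ge_2: "even n \<Longrightarrow> n \<noteq> 0 \<Longrightarrow> 2 \<le> (n::nat)"
  by presburger

text \<open>Symmetry of the Djokovic relation on edges of a bipartite graph. Let \<open>a\<close>,
  \<open>b\<close> be the distances of \<open>v i\<close> from \<open>x\<close>, \<open>y\<close>,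
  and \<open>c\<close>, \<open>d\<close> those of \<open>v (Suc i)\<close>: if nearness to
  \<open>v i\<close> or \<open>v (Suc i)\<close> separates the ends of \<open>xy\<close>, then
  nearness to \<open>x\<close> or \<open>y\<close> separates the ends of the cycle edge. This
  exchanges many cuts at one edge for one cut on the cycle.\<close>

lemma square_comparison:
  fixes a b c d :: nat
  assumes "a = Suc b \<or> b = Suc a" "c = Suc d \<or> d = Suc c" "a = Suc c \<or> c = Suc a" "b = Suc d \<or> d = Suc b"
    and "(a < c) \<noteq> (b < d)"
  shows "(a < b) \<noteq> (c < d)"
proof (cases "a < c")
  case True
  then have "c = Suc a" "b = Suc d" using assms by linarith+
  then show ?thesis using assms(1,2) by linarith
next
  case False
  then have "a = Suc c" "d = Suc b" using assms by linarith+
  then show ?thesis using assms(1,2) by linarith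
qed

section \<open>Counting the lattice squares covered by the hemisphere\<close>

context quad_hemisphere
begin

definition hyper :: "nat \<Rightarrow> 'v set set" where
  "hyper i = cut (\<lambda>z. dist (v i) z < dist (v (Suc i)) z)"

lemma card_hyper_le_2: "card {i. i < 2 * k \<and> e \<in> hyper i} \<le> 2"
proof (cases "e \<in> EH \<and> e \<subseteq> R")
  case False
  then have none: "{i. i < 2 * k \<and> e \<in> hyper i} = {}" by (auto simp: hyper_def cut_def)
  show ?thesis unfolding none by simp
next
  case True
  then obtain x y where e: "e = {x, y}" using EH_subset edgeD by blast
  then have xy: "(x, y) \<in> adj" and R: "x \<in> R" "y \<in> R" using True by (auto simp: adj_def)
  have "{i. i < 2 * k \<and> e \<in> hyper i} \<subseteq> {i. i < 2 * k \<and> ce i \<in> cut (\<lambda>z. dist z x < dist z y)}"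
  proof clarify
    fix i assume i: "e \<in> hyper i"
    have "(dist (v i) x < dist (v i) y) \<noteq> (dist (v (Suc i)) x < dist (v (Suc i)) y)"
    proof (rule square_comparison)
      show "dist (v i) x = Suc (dist (v i) y) \<or> dist (v i) y = Suc (dist (v i) x)"
        by (rule dist_adj[OF v_R R(1) xy])
      show "dist (v (Suc i)) x = Suc (dist (v (Suc i)) y) \<or> dist (v (Suc i)) y = Suc (dist (v (Suc i)) x)"
        by (rule dist_adj[OF v_R R(1) xy])
      show "dist (v i) x = Suc (dist (v (Suc i)) x) \<or> dist (v (Suc i)) x = Suc (dist (v i) x)"
        using dist_adj[OF R(1) v_R ce_adj, of i] by (simp add: dist_sym)
      show "dist (v i) y = Suc (dist (v (Suc i)) y) \<or> dist (v (Suc i)) y = Suc (dist (v i) y)"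
        using dist_adj[OF R(2) v_R ce_adj, of i] by (simp add: dist_sym)
      show "(dist (v i) x < dist (v (Suc i)) x) \<noteq> (dist (v i) y < dist (v (Suc i)) y)"
        using i unfolding e hyper_def in_cut_iff[OF xy R(1)] .
    qed
    then show "ce i \<in> cut (\<lambda>z. dist z x < dist z y)"
      unfolding in_cut_iff[OF ce_adj v_R] .
  qed
  then have "card {i. i < 2 * k \<and> e \<in> hyper i} \<le> card {i. i < 2 * k \<and> ce i \<in> cut (\<lambda>z. dist z x < dist z y)}"
    by (rule card_mono[rotated]) simp
  also have "\<dots> \<le> 2" unfolding card_ce by (rule card_closer_cut_le_2[OF xy R(1)])
  finally show ?thesis .
qed

lemma dist_v_far:
  assumes "i + k \<le> m" "m \<le> i + 2 * k" shows "dist (v i) (v m) = i + 2 * k - m"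
  using dist_v[of m "i + 2 * k"] assms by (simp add: v_per dist_sym)

text \<open>The cycle is isometric, so the positions closer to \<open>v i\<close> are
  \<open>i\<close> itself and those beyond \<open>i + k\<close>; \<open>hyper i\<close> meets the
  cycle in \<open>ce i\<close> and the opposite edge.\<close>

lemma in_hyper_ce:
  assumes "i \<le> l" "l < i + 2 * k"
  shows "ce l \<in> hyper i \<longleftrightarrow> l = i \<or> l = i + k"
proof -
  have P: "dist (v i) (v m) < dist (v (Suc i)) (v m) \<longleftrightarrow> m = i \<or> i + k < m"
    if m: "i \<le> m" "m \<le> i + 2 * k" for m
  proof -
    consider "m = i" | "i < m" "m \<le> i + k" | "i + k < m" using m by linarith
    then show ?thesis
    proof cases
      case 1
      then show ?thesis using dist_v[of i "Suc i"] dist_v[of i i] k2 by (simp add: dist_sym)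
    next
      case 2
      then show ?thesis using dist_v[of i m] dist_v[of "Suc i" m] by simp
    next
      case 3
      then show ?thesis using dist_v_far[of i m] dist_v_far[of "Suc i" m] m by simp
    qed
  qed
  have "(l = i \<or> i + k < l) \<noteq> (Suc l = i \<or> i + k < Suc l) \<longleftrightarrow> l = i \<or> l = i + k"
    using assms k2 by auto
  then show ?thesis
    unfolding hyper_def in_cut_iff[OF ce_adj v_R] using P[of l] P[of "Suc l"] assms by simp
qed

definition dsum :: "nat \<Rightarrow> 'v \<Rightarrow> nat" where "dsum i z = dist (v i) z + dist (v (Suc i)) z"

text \<open>The winding number is replaced by a cochain: \<open>C\<close> is the part of
  \<open>hyper i\<close> below \<open>(s, s)\<close>. Of the two cycle edges in
  \<open>hyper i\<close>, \<open>ce i\<close> has \<open>dsum\<close> 1 at both ends and belongs to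
  \<open>C\<close>, while the opposite one has \<open>2 * k - 1\<close> and does not, as
  \<open>s < k\<close>. So \<open>C\<close> is odd on the cycle, hence on some face of
  \<open>H\<close>, and \<open>quad_crossing\<close> places this face around
  \<open>(s, s)\<close>.\<close>

lemma crossing_exists:
  assumes i: "i < 2 * k" and s: "1 \<le> s" "s < k"
  shows "\<exists>f\<in>H. (\<Sum>j<4. dsum i (q f j)) = 8 * s \<and> 2 \<le> card {j. j < 4 \<and> side f j \<in> hyper i}"
proof -
  define C where "C = {e \<in> hyper i. \<forall>z\<in>e. dsum i z < 2 * s}"
  have "ce l \<in> C \<longleftrightarrow> l = i" if l: "l < 2 * k" for l
  proof -
    \<comment> \<open>Positions before \<open>i\<close> are shifted by one period, so that
      \<open>in_hyper_ce\<close> applies.\<close>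
    define m where "m = (if i \<le> l then l else l + 2 * k)"
    have vm: "v l = v m" "v (Suc l) = v (Suc m)" using v_per[of l] v_per[of "Suc l"] by (auto simp: m_def)
    have m: "i \<le> m" "m < i + 2 * k" using i l by (auto simp: m_def)
    have mi: "m = i \<longleftrightarrow> l = i" using i by (auto simp: m_def)
    have "ce m \<in> C \<longleftrightarrow> m = i"
    proof
      assume C: "ce m \<in> C"
      show "m = i"
      proof (rule ccontr)
        assume "m \<noteq> i"
        then have "m = i + k" using C in_hyper_ce[OF m] by (auto simp: C_def)
        moreover have "dsum i (v m) < 2 * s" using C by (auto simp: C_def)
        ultimately show False using dist_v[of i m] dist_v[of "Suc i" m] k2 s by (simp add: dsum_def)
      qed
    next
      assume "m = i"
      then show "ce m \<in> C"
        using in_hyper_ce[OF m] dist_v[of i i] dist_v[of i "Suc i"] dist_v[of "Suc i" "Suc i"] k2 s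
        by (simp add: C_def dsum_def dist_sym)
    qed
    then show ?thesis using vm mi by simp
  qed
  then have single: "{l. l < 2 * k \<and> ce l \<in> C} = {i}" using i by auto
  have "odd_cyc C" unfolding odd_cyc_def single by simp
  then have "{f \<in> H. odd_on f C} \<noteq> {}" unfolding boundary_H by (rule odd_card_nonempty)
  then obtain f where f: "f \<in> H" "odd_on f C" by blast
  from f(2) have "{j. j < 4 \<and> side f j \<in> C} \<noteq> {}" unfolding odd_on_def by (rule odd_card_nonempty)
  then obtain j0 where j0: "j0 < 4" "side f j0 \<in> C" by blast
  then have "q f j0 \<in> R" by (auto simp: C_def hyper_def cut_def)
  then have fR: "q f j \<in> R" if "j \<le> 4" for j using face_R[OF f(1) j0(1)] that by blast
  have sideC: "side f j \<in> C \<longleftrightarrow>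
      (dist (v i) (q f j) < dist (v (Suc i)) (q f j)) \<noteq>
      (dist (v i) (q f (Suc j)) < dist (v (Suc i)) (q f (Suc j))) \<and>
      dsum i (q f j) < 2 * s \<and> dsum i (q f (Suc j)) < 2 * s" if j: "j < 4" for j
  proof -
    have "q f j \<in> R" using fR j by simp
    then show ?thesis unfolding C_def mem_Collect_eq hyper_def in_cut_iff[OF face_adj[OF f(1) j] \<open>q f j \<in> R\<close>]
      by simp
  qed
  have "(\<Sum>j<4. dist (v i) (q f j) + dist (v (Suc i)) (q f j)) = 8 * s"
  proof (rule quad_crossing)
    fix j :: nat assume j: "j < 4"
    have R: "q f j \<in> R" using fR j by simp
    show "dist (v i) (q f j) = Suc (dist (v i) (q f (Suc j))) \<or> dist (v i) (q f (Suc j)) = Suc (dist (v i) (q f j))"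
      by (rule dist_adj[OF v_R R face_adj[OF f(1) j]])
    show "dist (v (Suc i)) (q f j) = Suc (dist (v (Suc i)) (q f (Suc j))) \<or>
        dist (v (Suc i)) (q f (Suc j)) = Suc (dist (v (Suc i)) (q f j))"
      by (rule dist_adj[OF v_R R face_adj[OF f(1) j]])
    show "dist (v i) (q f j) = Suc (dist (v (Suc i)) (q f j)) \<or> dist (v (Suc i)) (q f j) = Suc (dist (v i) (q f j))"
      using dist_adj[OF R v_R ce_adj, of i] by (simp add: dist_sym)
  next
    have "q f 4 = q f 0" using q4 f(1) H_subset by blast
    then show "dist (v i) (q f 4) = dist (v i) (q f 0)" "dist (v (Suc i)) (q f 4) = dist (v (Suc i)) (q f 0)"
      by simp_all
  next
    have "{j. j < 4 \<and> side f j \<in> C} = {j. j < 4 \<and> (dist (v i) (q f j) < dist (v (Suc i)) (q f j)) \<noteq>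
      (dist (v i) (q f (Suc j)) < dist (v (Suc i)) (q f (Suc j))) \<and>
      dsum i (q f j) < 2 * s \<and> dsum i (q f (Suc j)) < 2 * s}"
      using sideC by blast
    then show "odd (card {j. j < 4 \<and> (dist (v i) (q f j) < dist (v (Suc i)) (q f j)) \<noteq>
      (dist (v i) (q f (Suc j)) < dist (v (Suc i)) (q f (Suc j))) \<and>
      dist (v i) (q f j) + dist (v (Suc i)) (q f j) < 2 * s \<and>
      dist (v i) (q f (Suc j)) + dist (v (Suc i)) (q f (Suc j)) < 2 * s})"
      using f(2) unfolding odd_on_def dsum_def by simp
  qed
  then have 1: "(\<Sum>j<4. dsum i (q f j)) = 8 * s" by (simp only: dsum_def)
  have "j0 \<in> {j. j < 4 \<and> side f j \<in> hyper i}" using j0 by (simp add: C_def)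
  then have "card {j. j < 4 \<and> side f j \<in> hyper i} \<noteq> 0" by auto
  moreover have "even (card {j. j < 4 \<and> side f j \<in> hyper i})"
    using not_odd_on_cut[OF f(1)] unfolding hyper_def odd_on_def by blast
  ultimately have "2 \<le> card {j. j < 4 \<and> side f j \<in> hyper i}" by (intro even_nonzero_ge_2)
  with 1 f(1) show ?thesis by blast
qed

lemma card_hemisphere: "k * (k - 1) \<le> 2 * card H"
proof -
  define cr where "cr i f \<longleftrightarrow> 2 \<le> card {j. j < 4 \<and> side f j \<in> hyper i}" for i f
  have 1: "k - 1 \<le> card {f \<in> H. cr i f}" if i: "i \<in> {..<2 * k}" for i
  proof -
    have "\<forall>s\<in>{1..<k}. \<exists>f. f \<in> H \<and> cr i f \<and> (\<Sum>j<4. dsum i (q f j)) = 8 * s"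
      using crossing_exists[of i] i unfolding cr_def by fastforce
    then obtain g where g: "\<forall>s\<in>{1..<k}. g s \<in> H \<and> cr i (g s) \<and> (\<Sum>j<4. dsum i (q (g s) j)) = 8 * s"
      by (rule bchoice[THEN exE])
    \<comment> \<open>The corner sum \<open>8 * s\<close> determines \<open>s\<close>, so different
      \<open>s\<close> give different faces.\<close>
    have "inj_on g {1..<k}"
    proof (rule inj_onI)
      fix s t assume "s \<in> {1..<k}" "t \<in> {1..<k}" "g s = g t"
      then have "8 * s = 8 * t" using g by metis
      then show "s = t" by simp
    qed
    then have "card {1..<k} \<le> card {f \<in> H. cr i f}"
      by (rule card_inj_on_le) (use g finite_H in auto)
    then show ?thesis by simp
  qed
  \<comment> \<open>Each index counted takes at least two of the four sides and each side serves at
    most two indices, which gives \<open>4 * 2 / 2\<close>.\<close>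
  have 2: "card {i \<in> {..<2 * k}. cr i f} \<le> 4" for f
  proof -
    have "2 * card {i \<in> {..<2 * k}. cr i f} = (\<Sum>i\<in>{i \<in> {..<2 * k}. cr i f}. 2)" by simp
    also have "\<dots> \<le> (\<Sum>i\<in>{i \<in> {..<2 * k}. cr i f}. card {j \<in> {..<4}. side f j \<in> hyper i})"
      by (rule sum_mono) (simp add: cr_def)
    also have "\<dots> \<le> (\<Sum>i\<in>{..<2 * k}. card {j \<in> {..<4}. side f j \<in> hyper i})"
      by (rule sum_mono2) auto
    also have "\<dots> = (\<Sum>j\<in>{..<4}. card {i \<in> {..<2 * k}. side f j \<in> hyper i})"
      by (rule sum_card_swap) auto
    also have "\<dots> \<le> (\<Sum>j\<in>{..<4::nat}. 2)"
      by (rule sum_mono) (use card_hyper_le_2 in simp)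
    finally show ?thesis by simp
  qed
  have "2 * k * (k - 1) = (\<Sum>i\<in>{..<2 * k}. k - 1)" by simp
  also have "\<dots> \<le> (\<Sum>i\<in>{..<2 * k}. card {f \<in> H. cr i f})" by (rule sum_mono) (rule 1)
  also have "\<dots> = (\<Sum>f\<in>H. card {i \<in> {..<2 * k}. cr i f})"
    by (rule sum_card_swap) (auto simp: finite_H)
  also have "\<dots> \<le> (\<Sum>f\<in>H. 4)" by (rule sum_mono) (rule 2)
  finally show ?thesis by simp
qed

end

context quad_complex_cycle
begin

lemma card_W_bound: "k * (k - 1) < card W"
proof -
  obtain H where H: "H \<subseteq> Fs" "2 * card H \<le> card Fs" "\<And>C. odd_cyc C \<longleftrightarrow> odd (card {f \<in> H. odd_on f C})"
    using exists_hemisphere by metis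
  interpret quad_hemisphere W E Fs q v k H
    by unfold_locales (use H in auto)
  show ?thesis using card_hemisphere H(2) card_faces_less by linarith
qed

end

section \<open>The double covering of the projective plane by the sphere\<close>

text \<open>The projection matrix onto the line through \<open>x\<close>, for a unit vector
  \<open>x\<close>. It identifies exactly antipodal points and so models the projective plane as a
  subset of a Euclidean space, where \<open>covering_space\<close> applies.\<close>

definition outer :: "real^3 \<Rightarrow> real^3^3" where
  "outer x = (\<chi> i j. x $ i * x $ j)"

lemma outer_mult: "outer x *v y = (x \<bullet> y) *\<^sub>R x"
  by (simp add: outer_def vec_eq_iff matrix_vector_mult_def inner_vec_def sum_distrib_left algebra_simps)

lemma outer_minus [simp]: "outer (- x) = outer x"
  by (simp add: outer_def)

lemma outer_eq_iff:
  assumes "norm x = 1" "norm y = 1"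
  shows "outer x = outer y \<longleftrightarrow> x = y \<or> x = - y"
proof
  assume eq: "outer x = outer y"
  have "outer y *v y = y" using assms by (simp add: outer_mult norm_eq_1)
  then have xy: "(x \<bullet> y) *\<^sub>R x = y" using eq by (simp add: outer_mult[symmetric])
  then have "\<bar>x \<bullet> y\<bar> = 1" using assms by (metis mult.right_neutral norm_scaleR)
  then show "x = y \<or> x = - y" using xy by (metis abs_eq_iff' abs_minus_cancel abs_one minus_equation_iff scaleR_minus1_left scaleR_one)
qed auto

lemma continuous_on_outer: "continuous_on A outer"
  unfolding outer_def by (intro continuous_intros continuous_on_vec_lambda)

lemma continuous_on_matrix_vector: "continuous_on A (\<lambda>M :: real^3^3. M *v x)"
  unfolding matrix_vector_mult_def by (intro continuous_intros continuous_on_vec_lambda continuous_on_component)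

abbreviation S2 :: "(real^3) set" where "S2 \<equiv> sphere 0 1"

text \<open>As \<open>outer y *v x\<close> is \<open>y \<bullet> x\<close> times \<open>y\<close>,
  normalising \<open>M *v x\<close> recovers \<open>y\<close> up to sign, and
  \<open>\<sigma>\<close> chooses the half of the sphere facing \<open>x\<close> or the half facing
  away.\<close>

lemma outer_sheet:
  assumes x: "norm x = 1" and \<sigma>: "\<sigma> = 1 \<or> \<sigma> = -1"
  shows "homeomorphism {y \<in> S2. 0 < \<sigma> * (y \<bullet> x)} {M \<in> outer ` S2. M *v x \<noteq> 0}
           outer (\<lambda>M. \<sigma> *\<^sub>R (M *v x /\<^sub>R norm (M *v x)))"
  (is "homeomorphism ?U ?T outer ?q")
proof -
  have q: "?q (outer y) = y" if "y \<in> ?U" for y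
  proof -
    have "\<sigma> * (y \<bullet> x) > 0" "norm y = 1" using that by auto
    then have "\<bar>y \<bullet> x\<bar> = \<sigma> * (y \<bullet> x)" "y \<bullet> x \<noteq> 0" using \<sigma> by auto
    then show ?thesis using \<open>norm y = 1\<close> \<sigma> by (auto simp: outer_mult)
  qed
  have UT: "outer y \<in> ?T" if "y \<in> ?U" for y
    using that \<sigma> by (auto simp: outer_mult)
  have TU: "\<exists>y\<in>?U. M = outer y" if M: "M \<in> ?T" for M
  proof -
    obtain y where y: "norm y = 1" "M = outer y" "y \<bullet> x \<noteq> 0" using M by (auto simp: outer_mult)
    then have "0 < \<sigma> * (y \<bullet> x) \<or> 0 < \<sigma> * (- y \<bullet> x)" using \<sigma> by auto
    then show ?thesis
    proof
      assume "0 < \<sigma> * (y \<bullet> x)" then show ?thesis using y by auto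
    next
      assume "0 < \<sigma> * (- y \<bullet> x)" then show ?thesis using y by (intro bexI[of _ "- y"]) auto
    qed
  qed
  show ?thesis
  proof (rule homeomorphismI)
    show "continuous_on ?T ?q"
      by (intro continuous_intros continuous_on_matrix_vector) auto
    show "outer ` ?U \<subseteq> ?T" using UT by blast
    show "?q (outer y) = y" if "y \<in> ?U" for y using q that .
    show "?q ` ?T \<subseteq> ?U"
    proof
      fix z assume "z \<in> ?q ` ?T"
      then obtain M where M: "M \<in> ?T" "z = ?q M" by (rule imageE)
      then obtain y where "y \<in> ?U" "M = outer y" using TU by blast
      then show "z \<in> ?U" using q M(2) by simp
    qed
    show "outer (?q M) = M" if M: "M \<in> ?T" for M
    proof -
      obtain y where "y \<in> ?U" "M = outer y" using TU[OF M] by blast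
      then show ?thesis using q by simp
    qed
  qed (rule continuous_on_outer)
qed

lemma covering_space_outer: "covering_space S2 outer (outer ` S2)"
proof (rule covering_spaceI)
  fix M assume "M \<in> outer ` S2"
  then obtain x where x: "norm x = 1" "M = outer x" by auto
  let ?T = "{M \<in> outer ` S2. M *v x \<noteq> 0}"
  let ?U = "\<lambda>\<sigma>. {y \<in> S2. 0 < \<sigma> * (y \<bullet> x)}"
  have ope: "openin (top_of_set S2) (?U \<sigma>)" for \<sigma>
  proof -
    have "?U \<sigma> = S2 \<inter> {y. 0 < \<sigma> * (y \<bullet> x)}" by auto
    moreover have "open {y. 0 < \<sigma> * (y \<bullet> x)}"
      by (intro open_Collect_less continuous_intros)
    ultimately show ?thesis by auto
  qed
  have "?T = outer ` S2 \<inter> {M. M *v x \<noteq> 0}" by auto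
  moreover have "open {M :: real^3^3. M *v x \<noteq> 0}"
    by (intro open_Collect_neq continuous_on_matrix_vector continuous_intros)
  ultimately have opT: "openin (top_of_set (outer ` S2)) ?T" by auto
  show "\<exists>T. M \<in> T \<and> openin (top_of_set (outer ` S2)) T \<and>
       (\<exists>v. \<Union>v = S2 \<inter> outer -` T \<and> (\<forall>u\<in>v. openin (top_of_set S2) u) \<and> pairwise disjnt v \<and>
         (\<forall>u\<in>v. \<exists>q. homeomorphism u T outer q))"
  proof (intro exI[of _ ?T] exI[of _ "{?U 1, ?U (-1)}"] conjI)
    have "x \<bullet> x = 1" "x \<noteq> 0" using x(1) by (auto simp: norm_eq_1)
    then show "M \<in> ?T" using x by (auto simp: outer_mult)
    show "\<Union>{?U 1, ?U (- 1)} = S2 \<inter> outer -` ?T"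
      by (auto simp: outer_mult)
    show "pairwise disjnt {?U 1, ?U (- 1)}"
      by (auto simp: pairwise_def disjnt_def)
    show "\<forall>u\<in>{?U 1, ?U (- 1)}. \<exists>q. homeomorphism u ?T outer q"
    proof
      fix u assume "u \<in> {?U 1, ?U (- 1)}"
      then obtain \<sigma> :: real where "u = ?U \<sigma>" "\<sigma> = 1 \<or> \<sigma> = -1" by blast
      then show "\<exists>q. homeomorphism u ?T outer q" using outer_sheet[OF x(1)] by blast
    qed
  qed (use opT ope in blast)+
qed (auto simp: continuous_on_outer)

text \<open>The inner product of the two lifts is continuous and takes only the values 1 and -1, so
  it is constant on a connected set.\<close>

lemma outer_lifts_agree:
  fixes T :: "'c::real_normed_vector set"
  assumes T: "topological_space_class.connected T" and a: "continuous_on T a" "a \<in> T \<rightarrow> S2" and b: "continuous_on T b" "b \<in> T \<rightarrow> S2"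
    and ab: "\<And>t. t \<in> T \<Longrightarrow> outer (a t) = outer (b t)"
  shows "(\<forall>t\<in>T. a t = b t) \<or> (\<forall>t\<in>T. a t = - b t)"
proof -
  have pm: "a t = b t \<or> a t = - b t" if "t \<in> T" for t
    using outer_eq_iff[of "a t" "b t"] ab[OF that] that a b by (auto simp: Pi_iff)
  have nb: "b t \<bullet> b t = 1" if "t \<in> T" for t
    using that b by (auto simp: Pi_iff norm_eq_1)
  have "(\<lambda>t. a t \<bullet> b t) ` T \<subseteq> {1, -1}"
    using pm nb by fastforce
  then have "(\<lambda>t. a t \<bullet> b t) constant_on T"
    by (intro continuous_finite_range_constant[OF T] continuous_intros a b) (rule finite_subset, auto)
  then obtain c where c: "\<And>t. t \<in> T \<Longrightarrow> a t \<bullet> b t = c" by (auto simp: constant_on_def)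
  show ?thesis
  proof (cases "c = 1")
    case True
    then have "a t = b t" if "t \<in> T" for t using pm[OF that] c[OF that] nb[OF that] by auto
    then show ?thesis by blast
  next
    case False
    then have "a t = - b t" if "t \<in> T" for t using pm[OF that] c[OF that] nb[OF that] by auto
    then show ?thesis by blast
  qed
qed

text \<open>A continuous map from a compact space to a Hausdorff space is closed, hence a quotient
  map onto its image.\<close>

lemma continuous_on_compact_quotient:
  fixes g :: "'a::topological_space \<Rightarrow> 'b::t2_space" and f :: "'b \<Rightarrow> 'c::topological_space"
  assumes "compact K" "continuous_on K g" "continuous_on K (\<lambda>x. f (g x))"
  shows "continuous_on (g ` K) f"
  unfolding continuous_closedin_preimage_eq
proof (intro allI impI)
  fix T :: "'c set" assume "closed T"
  then have "closedin (top_of_set K) (K \<inter> (\<lambda>x. f (g x)) -` T)"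
    using assms(3) continuous_closedin_preimage_eq by blast
  then have "compact (K \<inter> (\<lambda>x. f (g x)) -` T)"
    using assms(1) closedin_compact by blast
  then have "compact (g ` (K \<inter> (\<lambda>x. f (g x)) -` T))"
    using assms(2) by (meson compact_continuous_image continuous_on_subset inf_le1)
  moreover have "g ` (K \<inter> (\<lambda>x. f (g x)) -` T) = g ` K \<inter> f -` T" by auto
  ultimately show "closedin (top_of_set (g ` K)) (g ` K \<inter> f -` T)"
    by (simp add: closed_subset compact_imp_closed)
qed

lemma continuous_on_inv_into_compact:
  fixes g :: "'a::topological_space \<Rightarrow> 'b::t2_space"
  assumes "compact K" "continuous_on K g" "inj_on g K"
  shows "continuous_on (g ` K) (inv_into K g)"
proof (rule continuous_on_compact_quotient[OF assms(1,2)])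
  show "continuous_on K (\<lambda>x. inv_into K g (g x))"
    using continuous_on_id by (rule continuous_on_eq) (simp add: assms(3))
qed

text \<open>Period 4, so that side \<open>j\<close> of a quadrilateral is the parameter interval
  from \<open>j\<close> to \<open>j + 1\<close>.\<close>

definition circ :: "real \<Rightarrow> complex" where "circ s = cis (2 * pi * s / 4)"

lemma norm_circ [simp]: "norm (circ s) = 1"
  by (simp add: circ_def)

lemma circ_4 [simp]: "circ 4 = circ 0"
  by (simp add: circ_def)

lemma continuous_on_circ [continuous_intros]:
  "continuous_on A g \<Longrightarrow> continuous_on A (\<lambda>x. circ (g x))"
  unfolding circ_def cis_conv_exp by (intro continuous_intros) auto

lemma Arg2pi_circ:
  assumes "0 < r" "0 \<le> s" "s < 4"
  shows "Arg2pi (of_real r * circ s) = 2 * pi * s / 4"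
  unfolding circ_def cis_conv_exp
  by (rule Arg2pi_unique) (use assms in auto)

lemma polar_circ: "z = of_real (norm z) * circ (4 * Arg2pi z / (2 * pi))"
  using Arg2pi_eq[of z] by (simp add: circ_def cis_conv_exp)

lemma polar_eq:
  assumes "of_real r * circ s = of_real r' * circ s'" "0 < r" "0 < r'" "0 \<le> s" "s < 4" "0 \<le> s'" "s' < 4"
  shows "r = r' \<and> s = s'"
proof
  have "norm (of_real r * circ s) = norm (of_real r' * circ s')" using assms(1) by simp
  then show "r = r'" using assms(2,3) by (simp add: norm_mult)
  show "s = s'" using Arg2pi_circ[of r s] Arg2pi_circ[of r' s'] assms by simp
qed

text \<open>Stereographic projection from the missed point \<open>p\<close> turns the map into one
  from an open set to the plane, where invariance of domain applies.\<close>

lemma openin_sphere_image: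
  fixes \<Phi> :: "complex \<Rightarrow> real^3"
  assumes V: "open V" and \<Phi>: "continuous_on V \<Phi>" "inj_on \<Phi> V" "\<Phi> ` V \<subseteq> S2"
    and p: "p \<in> S2" "p \<notin> \<Phi> ` V"
  shows "openin (top_of_set S2) (\<Phi> ` V)"
proof -
  have "(S2 - {p}) homeomorphic {x :: real^3. axis 1 1 \<bullet> x = 0}"
    by (rule homeomorphic_punctured_sphere_hyperplane) (use p in \<open>auto simp: axis_eq_0_iff\<close>)
  also have "{x :: real^3. axis 1 1 \<bullet> x = 0} homeomorphic (UNIV :: complex set)"
    by (rule homeomorphic_subspaces)
       (auto simp: subspace_hyperplane dim_hyperplane axis_eq_0_iff)
  finally obtain u w where hom: "homeomorphism (S2 - {p}) (UNIV :: complex set) u w"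
    unfolding homeomorphic_def by blast
  have \<Phi>p: "\<Phi> ` V \<subseteq> S2 - {p}" using \<Phi>(3) p(2) by blast
  have "open ((u \<circ> \<Phi>) ` V)"
  proof (rule invariance_of_domain[OF _ V])
    have "continuous_on (S2 - {p}) u" using hom by (simp add: homeomorphism_def)
    then show "continuous_on V (u \<circ> \<Phi>)"
      by (intro continuous_on_compose \<Phi>(1)) (rule continuous_on_subset[OF _ \<Phi>p])
    have "inj_on u (S2 - {p})" using hom by (intro inj_on_inverseI[of _ w]) (simp add: homeomorphism_def)
    then show "inj_on (u \<circ> \<Phi>) V"
      using inj_on_subset[OF _ \<Phi>p] by (intro comp_inj_on \<Phi>(2)) blast
  qed
  then have "openin (top_of_set (S2 - {p})) (w ` (u \<circ> \<Phi>) ` V)"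
    using homeomorphism_imp_open_map[OF homeomorphism_symD[OF hom]] by auto
  moreover have "w ` (u \<circ> \<Phi>) ` V = \<Phi> ` V"
    unfolding image_comp o_def using hom \<Phi>p by (intro image_cong) (auto simp: homeomorphism_def image_subset_iff)
  moreover have "openin (top_of_set S2) (S2 - {p})"
    by (intro openin_delete) simp
  ultimately show ?thesis using openin_trans[of "S2 - {p}" "\<Phi> ` V" S2] by simp
qed

text \<open>The opposite direction of invariance of domain: the inverse of the chart carries an open
  piece of the sphere onto an open set of the plane. It excludes neighbourhoods in the sphere that
  fit into a segment or have the point on the edge of a half-disc.\<close>

lemma sphere_chart_interior:
  fixes g :: "complex \<Rightarrow> real^3"
  assumes K: "compact K" and g: "continuous_on K g" "inj_on g K"
    and U: "openin (top_of_set S2) U" "U \<subseteq> g ` K" and z: "z \<in> K" "g z \<in> U"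
  shows "z \<in> interior K"
proof -
  let ?\<psi> = "inv_into K g"
  have "openin (top_of_set (UNIV :: complex set)) (?\<psi> ` U)"
  proof (rule invariance_of_domain_sphere_affine_set[OF _ _ _ _ _ _ U(1)])
    show "continuous_on U ?\<psi>"
      using continuous_on_inv_into_compact[OF K g] U(2) by (rule continuous_on_subset)
    show "inj_on ?\<psi> U" using U(2) by (rule inj_on_inv_into)
    show "aff_dim (UNIV :: complex set) < int DIM(real^3)" by simp
  qed auto
  then have "open (?\<psi> ` U)" by simp
  moreover have "?\<psi> ` U \<subseteq> K" using U(2) by (auto intro: inv_into_into)
  moreover have "z \<in> ?\<psi> ` U" using z g(2) by (metis image_eqI inv_into_f_f)
  ultimately show ?thesis using interior_maximal by blast
qed

lemma card_le_2I:
  assumes "\<And>a b c. a \<in> A \<Longrightarrow> b \<in> A \<Longrightarrow> c \<in> A \<Longrightarrow> a = b \<or> b = c \<or> a = c"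
  shows "finite A \<and> card A \<le> 2"
proof (cases "\<exists>a\<in>A. \<exists>b\<in>A. a \<noteq> b")
  case True
  then obtain a b where ab: "a \<in> A" "b \<in> A" "a \<noteq> b" by blast
  then have A: "A \<subseteq> {a, b}" using assms by blast
  then have "card A \<le> card {a, b}" by (rule card_mono[rotated]) simp
  then show ?thesis using A ab finite_subset by fastforce
next
  case False
  show ?thesis
  proof (cases "A = {}")
    case False
    then obtain a where "a \<in> A" by blast
    then have "A = {a}" using \<open>\<not> (\<exists>a\<in>A. \<exists>b\<in>A. a \<noteq> b)\<close> by blast
    then show ?thesis by simp
  qed simp
qed

section \<open>Quadrangulations of the sphere\<close>

text \<open>A face map \<open>h f\<close> is injective on the open disc only, since a face boundary
  may run through a vertex or an edge twice. The parametrizations of sides and of \<open>arc\<close>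
  are independent; only their point sets are matched.\<close>

locale sphere_quadrangulation =
  fixes W :: "(real^3) set" and E :: "(real^3) set set" and arc :: "(real^3) set \<Rightarrow> real \<Rightarrow> real^3"
    and Fs :: "'f set" and h :: "'f \<Rightarrow> complex \<Rightarrow> real^3" and q :: "'f \<Rightarrow> nat \<Rightarrow> real^3"
  assumes finite_W: "finite W" and W_nonempty: "W \<noteq> {}" and W_sphere: "W \<subseteq> S2"
    and cont_arc: "\<And>e. e \<in> E \<Longrightarrow> continuous_on {0..1} (arc e)"
    and inj_arc: "\<And>e. e \<in> E \<Longrightarrow> inj_on (arc e) {0..1}"
    and arc_sphere: "\<And>e. e \<in> E \<Longrightarrow> arc e ` {0..1} \<subseteq> S2"
    and arc_ends: "\<And>e. e \<in> E \<Longrightarrow> e = {arc e 0, arc e 1}"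
    and arc_W: "\<And>e. e \<in> E \<Longrightarrow> arc e ` {0..1} \<inter> W = e"
    and arcs_meet: "\<And>e e'. e \<in> E \<Longrightarrow> e' \<in> E \<Longrightarrow> e \<noteq> e' \<Longrightarrow> arc e ` {0..1} \<inter> arc e' ` {0..1} \<subseteq> W"
    and cont_h: "\<And>f. f \<in> Fs \<Longrightarrow> continuous_on (cball 0 1) (h f)"
    and h_sphere: "\<And>f. f \<in> Fs \<Longrightarrow> h f ` cball 0 1 \<subseteq> S2"
    and h_inj: "\<And>f f' z z'. f \<in> Fs \<Longrightarrow> f' \<in> Fs \<Longrightarrow> norm z < 1 \<Longrightarrow> norm z' < 1 \<Longrightarrow> h f z = h f' z' \<Longrightarrow> f = f' \<and> z = z'"
    and h_notin_W: "\<And>f z. f \<in> Fs \<Longrightarrow> norm z < 1 \<Longrightarrow> h f z \<notin> W"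
    and h_notin_arc: "\<And>f z e. f \<in> Fs \<Longrightarrow> norm z < 1 \<Longrightarrow> e \<in> E \<Longrightarrow> h f z \<notin> arc e ` {0..1}"
    and cover: "\<And>x. x \<in> S2 \<Longrightarrow> x \<in> W \<or> (\<exists>e\<in>E. x \<in> arc e ` {0..1}) \<or> (\<exists>f\<in>Fs. x \<in> h f ` ball 0 1)"
    and q4: "\<And>f. f \<in> Fs \<Longrightarrow> q f 4 = q f 0"
    and side_in_E: "\<And>f j. f \<in> Fs \<Longrightarrow> j < 4 \<Longrightarrow> {q f j, q f (Suc j)} \<in> E"
    and h_corner: "\<And>f j. f \<in> Fs \<Longrightarrow> j \<le> 4 \<Longrightarrow> h f (circ (real j)) = q f j"
    and side_bij: "\<And>f j. f \<in> Fs \<Longrightarrow> j < 4 \<Longrightarrow>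
        bij_betw (\<lambda>t. h f (circ (real j + t))) {0..1} (arc {q f j, q f (Suc j)} ` {0..1})"
begin

abbreviation side :: "'f \<Rightarrow> nat \<Rightarrow> (real^3) set" where "side f j \<equiv> {q f j, q f (Suc j)}"

definition sides :: "(real^3) set \<Rightarrow> ('f \<times> nat) set" where
  "sides e = {(f, j). f \<in> Fs \<and> j < 4 \<and> side f j = e}"

definition intr :: "(real^3) set \<Rightarrow> (real^3) set" where "intr e = arc e ` {0..1} - e"

text \<open>The open sector of the face next to side \<open>j\<close>, without the centre, so that
  polar coordinates are unique and the pages at different sides of a face are disjoint.\<close>

definition page :: "'f \<Rightarrow> nat \<Rightarrow> (real^3) set" where
  "page f j = {h f (of_real r * circ (real j + t)) | r t. 0 < r \<and> r < 1 \<and> 0 < t \<and> t < 1}"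

lemma E_subset: "e \<in> E \<Longrightarrow> e \<subseteq> W" using arc_W by blast

lemma finite_E: "finite E"
  by (rule finite_subset[of _ "Pow W"]) (use E_subset finite_W in auto)

lemma edge_two: "e \<in> E \<Longrightarrow> \<exists>x y. e = {x, y} \<and> x \<noteq> y \<and> x \<in> W \<and> y \<in> W"
proof -
  assume e: "e \<in> E"
  have "arc e 0 \<noteq> arc e 1" using inj_onD[OF inj_arc[OF e], of 0 1] by auto
  then show ?thesis using arc_ends[OF e] E_subset[OF e] by blast
qed

lemma intr_W: "e \<in> E \<Longrightarrow> intr e \<inter> W = {}"
  using arc_W by (auto simp: intr_def)

lemma arc_intr: "e \<in> E \<Longrightarrow> 0 < t \<Longrightarrow> t < 1 \<Longrightarrow> arc e t \<in> intr e"
proof -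
  assume e: "e \<in> E" and t: "0 < t" "t < 1"
  have "arc e t \<noteq> arc e 0" "arc e t \<noteq> arc e 1"
    using inj_onD[OF inj_arc[OF e], of t 0] inj_onD[OF inj_arc[OF e], of t 1] t by auto
  then have "arc e t \<notin> e" using arc_ends[OF e] by blast
  then show ?thesis using t by (simp add: intr_def)
qed

lemma cont_side:
  assumes "f \<in> Fs" shows "continuous_on A (\<lambda>t. h f (circ (c + t)))"
  by (rule continuous_on_compose2[OF cont_h[OF assms]]) (auto intro!: continuous_intros)

lemma side_intr_iff:
  assumes f: "f \<in> Fs" "j < 4" and t: "0 \<le> t" "t \<le> 1"
  shows "h f (circ (real j + t)) \<in> intr (side f j) \<longleftrightarrow> 0 < t \<and> t < 1"
proof -
  have bij: "bij_betw (\<lambda>t. h f (circ (real j + t))) {0..1} (arc (side f j) ` {0..1})"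
    by (rule side_bij[OF f])
  have c: "h f (circ (real j + 0)) = q f j" "h f (circ (real j + 1)) = q f (Suc j)"
    using h_corner[OF f(1), of j] h_corner[OF f(1), of "Suc j"] f(2) by (auto simp: add.commute)
  have inA: "h f (circ (real j + t)) \<in> arc (side f j) ` {0..1}"
    using bij_betwE[OF bij] t by auto
  have inj: "inj_on (\<lambda>t. h f (circ (real j + t))) {0..1}" using bij by (rule bij_betw_imp_inj_on)
  have "h f (circ (real j + t)) = q f j \<longleftrightarrow> t = 0"
    using inj_onD[OF inj, of t 0] c t by auto
  moreover have "h f (circ (real j + t)) = q f (Suc j) \<longleftrightarrow> t = 1"
    using inj_onD[OF inj, of t 1] c t by auto
  ultimately show ?thesis using inA t unfolding intr_def by auto
qed

lemma page_disjoint: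
  assumes "f \<in> Fs" "f' \<in> Fs" "j < 4" "j' < 4" "y \<in> page f j" "y \<in> page f' j'"
  shows "f = f' \<and> j = j'"
proof -
  obtain r t where y: "y = h f (of_real r * circ (real j + t))" "0 < r" "r < 1" "0 < t" "t < 1"
    using assms(5) by (auto simp: page_def)
  obtain r' t' where y': "y = h f' (of_real r' * circ (real j' + t'))" "0 < r'" "r' < 1" "0 < t'" "t' < 1"
    using assms(6) by (auto simp: page_def)
  have n: "norm (of_real r * circ (real j + t)) < 1" "norm (of_real r' * circ (real j' + t')) < 1"
    using y y' by (simp_all add: norm_mult)
  have fz: "f = f' \<and> of_real r * circ (real j + t) = of_real r' * circ (real j' + t')"
    using h_inj[OF assms(1,2) n] y(1) y'(1) by metis
  have "real j + t < 4" "real j' + t' < 4" using assms(3,4) y y' by linarith+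
  then have "real j + t = real j' + t'" using polar_eq[OF conjunct2[OF fz]] y y' by simp
  then have "j = j'" using y y' by linarith
  then show ?thesis using fz by blast
qed

lemma page_notin_arc: "f \<in> Fs \<Longrightarrow> y \<in> page f j \<Longrightarrow> e \<in> E \<Longrightarrow> y \<notin> arc e ` {0..1}"
  using h_notin_arc by (force simp: page_def norm_mult)

lemma page_notin_W: "f \<in> Fs \<Longrightarrow> y \<in> page f j \<Longrightarrow> y \<notin> W"
  using h_notin_W by (force simp: page_def norm_mult)

text \<open>Two pages along the same edge are glued to an injective image of an open rectangle.\<close>

lemma two_pages_open:
  assumes s: "(f1, j1) \<in> sides e" "(f2, j2) \<in> sides e" "(f1, j1) \<noteq> (f2, j2)"
  obtains U where "openin (top_of_set S2) U" "U \<subseteq> page f1 j1 \<union> page f2 j2 \<union> intr e"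
    "U \<inter> intr e \<noteq> {}"
proof -
  have f: "f1 \<in> Fs" "f2 \<in> Fs" "j1 < 4" "j2 < 4" and e: "side f1 j1 = e" "side f2 j2 = e"
    using s by (auto simp: sides_def)
  have eE: "e \<in> E" using side_in_E[OF f(1,3)] e by simp
  define s1 where "s1 t = h f1 (circ (real j1 + t))" for t
  define s2 where "s2 t = h f2 (circ (real j2 + t))" for t
  have b1: "bij_betw s1 {0..1} (arc e ` {0..1})" and b2: "bij_betw s2 {0..1} (arc e ` {0..1})"
    using side_bij[OF f(1,3)] side_bij[OF f(2,4)] e unfolding s1_def s2_def by simp_all
  have c1: "continuous_on A s1" and c2: "continuous_on A s2" for A
    unfolding s1_def s2_def using cont_side f by auto
  have i1: "s1 t \<in> intr e \<longleftrightarrow> 0 < t \<and> t < 1" and i2: "s2 t \<in> intr e \<longleftrightarrow> 0 < t \<and> t < 1"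
    if "0 \<le> t" "t \<le> 1" for t
    using side_intr_iff[OF f(1,3) that] side_intr_iff[OF f(2,4) that] e unfolding s1_def s2_def by simp_all
  \<comment> \<open>The two faces parametrize the common edge differently, perhaps in opposite
    directions; \<open>\<tau>\<close> translates one parameter into the other.\<close>
  define \<tau> where "\<tau> t = inv_into {0..1} s2 (s1 t)" for t
  have s1_img: "s1 t \<in> s2 ` {0..1}" if "t \<in> {0..1}" for t
    using bij_betwE[OF b1] that unfolding bij_betw_imp_surj_on[OF b2] by blast
  have s2\<tau>: "s2 (\<tau> t) = s1 t" "\<tau> t \<in> {0..1}" if "t \<in> {0..1}" for t
    unfolding \<tau>_def by (rule f_inv_into_f[OF s1_img[OF that]], rule inv_into_into[OF s1_img[OF that]])
  have \<tau>01: "0 < \<tau> t" "\<tau> t < 1" if "0 < t" "t < 1" for t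
    using i1[of t] i2[of "\<tau> t"] s2\<tau>[of t] that by auto
  have c\<tau>: "continuous_on {0..1} \<tau>"
  proof -
    have "continuous_on (s2 ` {0..1}) (inv_into {0..1} s2)"
      using b2 c2 by (intro continuous_on_inv_into_compact) (auto simp: bij_betw_def)
    then show ?thesis
      unfolding \<tau>_def by (rule continuous_on_compose2[OF _ c1]) (use s1_img in auto)
  qed
  have \<tau>inj: "t = t'" if "t \<in> {0..1}" "t' \<in> {0..1}" "\<tau> t = \<tau> t'" for t t'
    using s2\<tau>[OF that(1)] s2\<tau>[OF that(2)] that bij_betw_imp_inj_on[OF b1] by (auto dest: inj_onD)
  \<comment> \<open>The real part runs along the edge and the imaginary part away from it: the first
    page lies over the upper half of the rectangle, the second over the lower half, and radius 1 in
    both is the real axis.\<close>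
  define A where "A z = h f1 (of_real (1 - Im z) * circ (real j1 + Re z))" for z
  define B where "B z = h f2 (of_real (1 + Im z) * circ (real j2 + \<tau> (Re z)))" for z
  define \<Phi> where "\<Phi> z = (if 0 \<le> Im z then A z else B z)" for z
  define V where "V = box (Complex 0 (- 1)) (Complex 1 1)"
  have V_iff: "z \<in> V \<longleftrightarrow> 0 < Re z \<and> Re z < 1 \<and> - 1 < Im z \<and> Im z < 1" for z
    by (auto simp: V_def in_box_complex_iff)
  have "open V" unfolding V_def by (rule open_box)
  have A_page: "A z \<in> page f1 j1" if "z \<in> V" "0 < Im z" for z
    using that unfolding V_iff A_def page_def by (intro CollectI exI[of _ "1 - Im z"] exI[of _ "Re z"]) auto
  have B_page: "B z \<in> page f2 j2" if "z \<in> V" "Im z < 0" for z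
    using that \<tau>01[of "Re z"] unfolding V_iff B_def page_def
    by (intro CollectI exI[of _ "1 + Im z"] exI[of _ "\<tau> (Re z)"]) auto
  have A_arc: "A z = s1 (Re z)" if "Im z = 0" for z
    using that by (simp add: A_def s1_def)
  have B_arc: "B z = s1 (Re z)" if "Im z = 0" "Re z \<in> {0..1}" for z
    using that s2\<tau>(1)[of "Re z"] by (simp add: B_def s2_def)
  have \<Phi>_cases: "(Im z > 0 \<and> \<Phi> z \<in> page f1 j1) \<or> (Im z = 0 \<and> \<Phi> z = s1 (Re z) \<and> \<Phi> z \<in> intr e) \<or>
      (Im z < 0 \<and> \<Phi> z \<in> page f2 j2)" if z: "z \<in> V" for z
    using A_page[OF z] B_page[OF z] A_arc[of z] i1[of "Re z"] z
    by (cases "Im z" "0 :: real" rule: linorder_cases) (auto simp: \<Phi>_def V_iff)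
  have intr_page: "y \<notin> page f1 j1" "y \<notin> page f2 j2" if "y \<in> intr e" for y
    using page_notin_arc[OF _ _ eE] f that by (auto simp: intr_def)
  have pages: "\<not> (y \<in> page f1 j1 \<and> y \<in> page f2 j2)" for y
    using page_disjoint[OF f] s(3) by blast
  have cont: "continuous_on V \<Phi>"
  proof -
    define K where "K = {z. 0 \<le> Re z \<and> Re z \<le> 1 \<and> - 1 \<le> Im z \<and> Im z \<le> 1}"
    have clK: "closed (K \<inter> {z. 0 \<le> Im z})" "closed (K \<inter> {z. Im z \<le> 0})"
      unfolding K_def Collect_conj_eq
      by (intro closed_Int closed_halfspace_Re_ge closed_halfspace_Re_le closed_halfspace_Im_ge closed_halfspace_Im_le)+
    have n: "norm (of_real r * circ s) \<le> 1" if "0 \<le> r" "r \<le> 1" for r s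
      using that by (simp add: norm_mult)
    have cA: "continuous_on (K \<inter> {z. 0 \<le> Im z}) A"
      unfolding A_def
    proof (rule continuous_on_compose2[OF cont_h[OF f(1)]])
      show "continuous_on (K \<inter> {z. 0 \<le> Im z}) (\<lambda>z. of_real (1 - Im z) * circ (real j1 + Re z))"
        by (intro continuous_intros)
      show "(\<lambda>z. of_real (1 - Im z) * circ (real j1 + Re z)) ` (K \<inter> {z. 0 \<le> Im z}) \<subseteq> cball 0 1"
        unfolding image_subset_iff mem_cball_0 by (intro ballI n) (simp_all add: K_def)
    qed
    have c\<tau>': "continuous_on (K \<inter> {z. Im z \<le> 0}) (\<lambda>z. \<tau> (Re z))"
      by (rule continuous_on_compose2[OF c\<tau> continuous_on_Re[OF continuous_on_id]]) (auto simp: K_def)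
    have cB: "continuous_on (K \<inter> {z. Im z \<le> 0}) B"
      unfolding B_def
    proof (rule continuous_on_compose2[OF cont_h[OF f(2)]])
      show "continuous_on (K \<inter> {z. Im z \<le> 0}) (\<lambda>z. of_real (1 + Im z) * circ (real j2 + \<tau> (Re z)))"
        by (intro continuous_intros c\<tau>')
      show "(\<lambda>z. of_real (1 + Im z) * circ (real j2 + \<tau> (Re z))) ` (K \<inter> {z. Im z \<le> 0}) \<subseteq> cball 0 1"
        unfolding image_subset_iff mem_cball_0 by (intro ballI n) (simp_all add: K_def)
    qed
    have "continuous_on ((K \<inter> {z. 0 \<le> Im z}) \<union> (K \<inter> {z. Im z \<le> 0})) (\<lambda>z. if 0 \<le> Im z then A z else B z)"
    proof (rule continuous_on_cases[OF clK cA cB])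
      show "\<forall>x. x \<in> K \<inter> {z. 0 \<le> Im z} \<and> \<not> 0 \<le> Im x \<or> x \<in> K \<inter> {z. Im z \<le> 0} \<and> 0 \<le> Im x \<longrightarrow> A x = B x"
        using A_arc B_arc by (auto simp: K_def)
    qed
    then show ?thesis unfolding \<Phi>_def
      by (rule continuous_on_subset) (auto simp: K_def V_iff)
  qed
  have inj: "inj_on \<Phi> V"
  proof (rule inj_onI)
    have lt: "norm (of_real r * circ s) < 1" if "0 \<le> r" "r < 1" for r s
      using that by (simp add: norm_mult)
    fix z z' assume z: "z \<in> V" "z' \<in> V" and eq: "\<Phi> z = \<Phi> z'"
    consider "Im z > 0" "Im z' > 0" | "Im z = 0" "Im z' = 0" "s1 (Re z) = s1 (Re z')" | "Im z < 0" "Im z' < 0"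
      using \<Phi>_cases[OF z(1)] \<Phi>_cases[OF z(2)] eq intr_page pages by metis
    then show "z = z'"
    proof cases
      case 1
      then have "h f1 (of_real (1 - Im z) * circ (real j1 + Re z)) = h f1 (of_real (1 - Im z') * circ (real j1 + Re z'))"
        using eq by (simp add: \<Phi>_def A_def)
      then have "of_real (1 - Im z) * circ (real j1 + Re z) = of_real (1 - Im z') * circ (real j1 + Re z')"
        by (intro conjunct2[OF h_inj[OF f(1) f(1) lt lt]]) (use 1 z in \<open>auto simp: V_iff\<close>)
      then have "1 - Im z = 1 - Im z' \<and> real j1 + Re z = real j1 + Re z'"
        by (rule polar_eq) (use z f in \<open>auto simp: V_iff\<close>)
      then show ?thesis by (simp add: complex_eq_iff)
    next
      case 2
      then have "Re z = Re z'" using bij_betw_imp_inj_on[OF b1] z by (auto simp: V_iff dest: inj_onD)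
      then show ?thesis using 2 by (simp add: complex_eq_iff)
    next
      case 3
      then have "h f2 (of_real (1 + Im z) * circ (real j2 + \<tau> (Re z))) = h f2 (of_real (1 + Im z') * circ (real j2 + \<tau> (Re z')))"
        using eq by (simp add: \<Phi>_def B_def)
      then have "of_real (1 + Im z) * circ (real j2 + \<tau> (Re z)) = of_real (1 + Im z') * circ (real j2 + \<tau> (Re z'))"
        by (intro conjunct2[OF h_inj[OF f(2) f(2) lt lt]]) (use 3 z in \<open>auto simp: V_iff\<close>)
      then have "1 + Im z = 1 + Im z' \<and> real j2 + \<tau> (Re z) = real j2 + \<tau> (Re z')"
        by (rule polar_eq) (use z f \<tau>01[of "Re z"] \<tau>01[of "Re z'"] in \<open>auto simp: V_iff\<close>)
      then have "Im z = Im z'" "\<tau> (Re z) = \<tau> (Re z')" by auto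
      moreover from this(2) have "Re z = Re z'" using \<tau>inj z by (auto simp: V_iff)
      ultimately show ?thesis by (simp add: complex_eq_iff)
    qed
  qed
  have sub: "\<Phi> ` V \<subseteq> page f1 j1 \<union> page f2 j2 \<union> intr e"
    using \<Phi>_cases by blast
  have page_S2: "page f j \<subseteq> S2" if "f \<in> Fs" for f j
    using h_sphere[OF that] by (force simp: page_def norm_mult)
  \<comment> \<open>A vertex is missed by both pages and by the interior of the edge, so it can
    serve as the centre of the projection.\<close>
  obtain p where p: "p \<in> W" using W_nonempty by blast
  show thesis
  proof (rule that[OF openin_sphere_image[OF \<open>open V\<close> cont inj] sub])
    have "intr e \<subseteq> S2" using arc_sphere[OF eE] unfolding intr_def by blast
    then show "\<Phi> ` V \<subseteq> S2" using sub page_S2[OF f(1), of j1] page_S2[OF f(2), of j2] by blast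
    show "p \<in> S2" using p W_sphere by blast
    show "p \<notin> \<Phi> ` V" using sub p page_notin_W f intr_W[OF eE] by blast
    have v: "Complex (1/2) 0 \<in> V" by (simp add: V_iff)
    then have "\<Phi> (Complex (1/2) 0) \<in> intr e" using \<Phi>_cases[OF v] by auto
    then show "\<Phi> ` V \<inter> intr e \<noteq> {}" using v by blast
  qed
qed

end

section \<open>Every edge has exactly two sides\<close>

context sphere_quadrangulation
begin

lemma side_in_arc:
  assumes "f \<in> Fs" "j < 4" "0 \<le> t" "t \<le> 1"
  shows "h f (circ (real j + t)) \<in> arc (side f j) ` {0..1}"
  using bij_betwE[OF side_bij[OF assms(1,2)]] assms(3,4) by simp

lemma intr_on_side:
  assumes "(f, j) \<in> sides e" "x \<in> intr e"
  obtains t where "0 < t" "t < 1" "x = h f (circ (real j + t))"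
proof -
  have f: "f \<in> Fs" "j < 4" and e: "side f j = e" using assms(1) by (auto simp: sides_def)
  have "x \<in> (\<lambda>t. h f (circ (real j + t))) ` {0..1}"
    unfolding bij_betw_imp_surj_on[OF side_bij[OF f]] e using assms(2) by (simp add: intr_def)
  then obtain t where t: "0 \<le> t" "t \<le> 1" "x = h f (circ (real j + t))" by auto
  have "0 < t \<and> t < 1" using side_intr_iff[OF f t(1,2)] assms(2) unfolding e t(3) by blast
  then show thesis using that t(3) by blast
qed

lemma page_near_side:
  assumes f: "f \<in> Fs" and t: "0 < t" "t < 1" and Q: "open Q" "h f (circ (real j + t)) \<in> Q"
  obtains y where "y \<in> Q" "y \<in> page f j"
proof -
  define g where "g r = h f (of_real r * circ (real j + t))" for r
  have "continuous_on {0..1} g"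
    unfolding g_def
    by (rule continuous_on_compose2[OF cont_h[OF f]]) (auto intro!: continuous_intros simp: norm_mult)
  then have "(g \<longlongrightarrow> g 1) (at 1 within {0..1})" by (simp add: continuous_on_def)
  moreover have "g 1 \<in> Q" using Q(2) by (simp add: g_def)
  ultimately have "eventually (\<lambda>r. g r \<in> Q) (at 1 within {0..1})"
    using Q(1) topological_tendstoD by blast
  then obtain d where d: "d > 0" "\<And>r. r \<in> {0..1} \<Longrightarrow> r \<noteq> 1 \<Longrightarrow> dist r 1 < d \<Longrightarrow> g r \<in> Q"
    unfolding eventually_at by blast
  define r where "r = max (1/2) (1 - d/2)"
  have r: "0 < r" "r < 1" "dist r 1 < d" using d(1) by (auto simp: r_def dist_real_def)
  have "g r \<in> Q" by (rule d(2)) (use r in auto)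
  moreover have "g r \<in> page f j" using r t unfolding page_def g_def by blast
  ultimately show thesis by (rule that)
qed

text \<open>Two pages and the edge already fill a neighbourhood of some interior point of the edge.
  A third page comes arbitrarily close to that point, but it is disjoint from all of them.\<close>

lemma sides_le_2: "e \<in> E \<Longrightarrow> finite (sides e) \<and> card (sides e) \<le> 2"
proof (rule card_le_2I, rule ccontr)
  fix s1 s2 s3
  assume e: "e \<in> E" and s: "s1 \<in> sides e" "s2 \<in> sides e" "s3 \<in> sides e"
    and n: "\<not> (s1 = s2 \<or> s2 = s3 \<or> s1 = s3)"
  obtain f1 j1 f2 j2 f3 j3 where p: "s1 = (f1, j1)" "s2 = (f2, j2)" "s3 = (f3, j3)"
    by (metis surj_pair)
  have f: "f1 \<in> Fs" "f2 \<in> Fs" "f3 \<in> Fs" "j1 < 4" "j2 < 4" "j3 < 4"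
    using s p by (auto simp: sides_def)
  have "(f1, j1) \<noteq> (f2, j2)" using n p by simp
  then obtain U where U: "openin (top_of_set S2) U" "U \<subseteq> page f1 j1 \<union> page f2 j2 \<union> intr e"
    "U \<inter> intr e \<noteq> {}"
    using two_pages_open[of f1 j1 e f2 j2] s p by metis
  obtain Q where Q: "open Q" "U = S2 \<inter> Q" using U(1) by (auto simp: openin_open)
  obtain x where x: "x \<in> U" "x \<in> intr e" using U(3) by blast
  obtain t where t: "0 < t" "t < 1" "x = h f3 (circ (real j3 + t))"
    using intr_on_side[of f3 j3 e x] s(3) p(3) x(2) by blast
  obtain y where y: "y \<in> Q" "y \<in> page f3 j3"
    using page_near_side[OF f(3) t(1,2) Q(1), of j3] x(1) t(3) Q(2) by blast
  have "y \<in> S2" using y(2) h_sphere[OF f(3)] by (force simp: page_def norm_mult)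
  then have "y \<in> page f1 j1 \<union> page f2 j2 \<union> intr e" using y(1) Q U(2) by blast
  then consider "y \<in> page f1 j1" | "y \<in> page f2 j2" | "y \<in> intr e" by blast
  then show False
  proof cases
    case 1
    then show ?thesis using page_disjoint[OF f(1,3,4,6) _ y(2)] n p by blast
  next
    case 2
    then show ?thesis using page_disjoint[OF f(2,3,5,6) _ y(2)] n p by blast
  next
    case 3
    then show ?thesis using page_notin_arc[OF f(3) y(2) e] by (simp add: intr_def)
  qed
qed

text \<open>Every face has its side 0 on one of finitely many edges, and each edge has at most two
  sides.\<close>

lemma finite_Fs: "finite Fs"
proof (rule finite_subset)
  show "Fs \<subseteq> fst ` (\<Union>e\<in>E. sides e)"
  proof
    fix f assume f: "f \<in> Fs"
    then have "(f, 0) \<in> sides (side f 0)" "side f 0 \<in> E" using side_in_E by (auto simp: sides_def)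
    then show "f \<in> fst ` (\<Union>e\<in>E. sides e)" by (intro image_eqI[of _ _ "(f, 0)"]) auto
  qed
  show "finite (fst ` (\<Union>e\<in>E. sides e))" using finite_E sides_le_2 by blast
qed

text \<open>A closed quarter of the disc. The face map is injective here, though not always on the
  closed disc, because the only boundary points are those of one side.\<close>

definition sector :: "nat \<Rightarrow> complex set" where
  "sector j = (\<lambda>(r, t). of_real r * circ (real j + t)) ` ({0..1} \<times> {0..1})"

lemma compact_sector: "compact (sector j)"
  unfolding sector_def case_prod_unfold
  by (intro compact_continuous_image compact_Times) (auto intro!: continuous_intros)

lemma sectorE:
  assumes "z \<in> sector j"
  obtains "norm z < 1" | t where "0 \<le> t" "t \<le> 1" "z = circ (real j + t)"
proof -
  obtain r t where "0 \<le> r" "r \<le> 1" "0 \<le> t" "t \<le> 1" "z = of_real r * circ (real j + t)"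
    using assms by (auto simp: sector_def)
  then show thesis using that by (cases "r = 1") (auto simp: norm_mult)
qed

lemma sector_subset: "sector j \<subseteq> cball 0 1"
  by (auto simp: sector_def norm_mult)

lemma inj_on_sector:
  assumes f: "f \<in> Fs" "j < 4" shows "inj_on (h f) (sector j)"
proof (rule inj_onI)
  fix z z' assume z: "z \<in> sector j" "z' \<in> sector j" and eq: "h f z = h f z'"
  have arc: "h f (circ (real j + t)) \<in> arc (side f j) ` {0..1}" if "0 \<le> t" "t \<le> 1" for t
    using side_in_arc[OF f that] .
  have no: "h f z \<notin> arc (side f j) ` {0..1}" if "norm z < 1" for z
    using h_notin_arc[OF f(1) that side_in_E[OF f]] .
  from z(1) show "z = z'"
  proof (cases rule: sectorE)
    case 1
    from z(2) show ?thesis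
    proof (cases rule: sectorE)
      case 1
      then show ?thesis using h_inj[OF f(1) f(1) \<open>norm z < 1\<close> 1 eq] by simp
    next
      case (2 t)
      then show ?thesis using no[OF \<open>norm z < 1\<close>] arc[of t] eq by simp
    qed
  next
    case (2 t)
    note t = 2
    from z(2) show ?thesis
    proof (cases rule: sectorE)
      case 1
      then show ?thesis using no[OF 1] arc[of t] eq t by simp
    next
      case (2 t')
      then have "t = t'"
        using inj_onD[OF bij_betw_imp_inj_on[OF side_bij[OF f]], of t t'] eq t by simp
      then show ?thesis using 2 t by simp
    qed
  qed
qed

lemma ball_in_sector:
  assumes "norm z < 1" obtains j where "j < 4" "z \<in> sector j"
proof -
  define s where "s = 4 * Arg2pi z / (2 * pi)"
  have s: "0 \<le> s" "s < 4" using Arg2pi[of z] by (auto simp: s_def field_simps)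
  define j where "j = nat \<lfloor>s\<rfloor>"
  have j: "real j \<le> s" "s \<le> real j + 1" "j < 4" using s unfolding j_def by linarith+
  have "z = of_real (norm z) * circ (real j + (s - real j))"
    using polar_circ[of z] by (simp add: s_def)
  then have "z \<in> sector j"
    unfolding sector_def using assms j by (intro image_eqI[of _ _ "(norm z, s - real j)"]) auto
  then show thesis using that j(3) by blast
qed

text \<open>
  If an edge had fewer than two sides, a neighbourhood in the sphere of an interior point of the
  edge would lie in a closed half-disc, with the point on its boundary, or in an arc.
\<close>

lemma sides_ge_2: assumes e: "e \<in> E" shows "2 \<le> card (sides e)"
proof (rule ccontr)
  assume "\<not> 2 \<le> card (sides e)"
  then have c: "sides e = {} \<or> (\<exists>s. sides e = {s})"
    using sides_le_2[OF e] by (metis One_nat_def card_1_singletonE card_eq_0_iff less_2_cases not_le)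
  define x where "x = arc e (1/2)"
  have x: "x \<in> intr e" unfolding x_def using e by (intro arc_intr) auto
  then have xW: "x \<notin> W" and xarc: "x \<in> arc e ` {0..1}" using intr_W[OF e] by (auto simp: intr_def)
  \<comment> \<open>All that misses \<open>x\<close>: the sectors on other sides, the other arcs and
    the vertices. It is closed, so near \<open>x\<close> the sphere consists of the arc and the
    sectors along \<open>e\<close>.\<close>
  define B where "B = (\<Union>(f, j)\<in>Fs \<times> {..<4} - sides e. h f ` sector j) \<union> (\<Union>e'\<in>E - {e}. arc e' ` {0..1}) \<union> W"
  have cpt: "compact (h f ` sector j)" if "f \<in> Fs" for f j
    using compact_continuous_image[OF continuous_on_subset[OF cont_h[OF that] sector_subset] compact_sector] .
  have "closed B"
    unfolding B_def
  proof (intro closed_Un closed_UN finite_imp_closed finite_W)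
    show "finite (Fs \<times> {..<4} - sides e)" using finite_Fs by simp
    show "\<forall>s\<in>Fs \<times> {..<4} - sides e. closed (case s of (f, j) \<Rightarrow> h f ` sector j)"
      using cpt compact_imp_closed by auto
    show "finite (E - {e})" using finite_E by simp
    show "\<forall>e'\<in>E - {e}. closed (arc e' ` {0..1})"
      using compact_continuous_image[OF cont_arc] compact_imp_closed compact_Icc by blast
  qed
  have xB: "x \<notin> B"
  proof
    assume "x \<in> B"
    then consider f j where "f \<in> Fs" "j < 4" "(f, j) \<notin> sides e" "x \<in> h f ` sector j"
      | e' where "e' \<in> E" "e' \<noteq> e" "x \<in> arc e' ` {0..1}"
      using xW unfolding B_def by blast
    then show False
    proof cases
      case 1
      then obtain z where z: "z \<in> sector j" "x = h f z" by blast
      have ne: "side f j \<noteq> e" using 1 by (auto simp: sides_def)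
      from z(1) show False
      proof (cases rule: sectorE)
        case 1
        then show False using h_notin_arc[OF \<open>f \<in> Fs\<close> 1 e] xarc z(2) by simp
      next
        case (2 t)
        then have "x \<in> arc (side f j) ` {0..1}" using side_in_arc[OF 1(1,2)] z(2) by simp
        then show False using arcs_meet[OF side_in_E[OF 1(1,2)] e ne] xarc xW by blast
      qed
    next
      case 2
      then show False using arcs_meet[OF 2(1) e 2(2)] xarc xW by blast
    qed
  qed
  define U where "U = S2 - B"
  have opU: "openin (top_of_set S2) U"
    unfolding U_def using \<open>closed B\<close> by (simp add: Diff_eq open_Compl openin_open_Int)
  have xU: "x \<in> U" using xB xarc arc_sphere[OF e] by (auto simp: U_def)
  have U: "y \<in> arc e ` {0..1} \<or> (\<exists>(f, j)\<in>sides e. y \<in> h f ` sector j)" if y: "y \<in> U" for y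
  proof -
    have yB: "y \<in> S2" "y \<notin> B" using y by (auto simp: U_def)
    then consider e' where "e' \<in> E" "y \<in> arc e' ` {0..1}" | f where "f \<in> Fs" "y \<in> h f ` ball 0 1"
      using cover[of y] by (auto simp: B_def)
    then show ?thesis
    proof cases
      case 1
      then have "e' = e" using yB(2) unfolding B_def by blast
      then show ?thesis using 1 by blast
    next
      case 2
      then obtain z where z: "norm z < 1" "y = h f z" by auto
      obtain j where "j < 4" "z \<in> sector j" using ball_in_sector[OF z(1)] .
      then have "(f, j) \<in> sides e" "y \<in> h f ` sector j" using yB(2) 2 z(2) unfolding B_def by blast+
      then show ?thesis by blast
    qed
  qed
  from c show False
  proof
    assume n: "sides e = {}"
    define K where "K = complex_of_real ` {0..1}"
    have "complex_of_real (1/2) \<in> interior K"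
    proof (rule sphere_chart_interior[OF _ _ _ opU])
      show "compact K" unfolding K_def by (intro compact_continuous_image continuous_intros compact_Icc)
      show "continuous_on K (\<lambda>z. arc e (Re z))"
        by (rule continuous_on_compose2[OF cont_arc[OF e]]) (auto intro!: continuous_intros simp: K_def)
      show "inj_on (\<lambda>z. arc e (Re z)) K"
        using inj_arc[OF e] by (auto simp: inj_on_def K_def)
      have "arc e ` {0..1} \<subseteq> (\<lambda>z. arc e (Re z)) ` K" by (auto simp: K_def image_image)
      then show "U \<subseteq> (\<lambda>z. arc e (Re z)) ` K" using U n by blast
      show "complex_of_real (1/2) \<in> K" unfolding K_def by (intro imageI) auto
      show "arc e (Re (complex_of_real (1/2))) \<in> U" using xU by (simp add: x_def)
    qed
    moreover have "interior K \<subseteq> interior {z. \<i> \<bullet> z = 0}"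
      by (rule interior_mono) (auto simp: K_def)
    moreover have "interior {z. \<i> \<bullet> z = 0} = {}" by (rule interior_hyperplane) simp
    ultimately show False by blast
  next
    assume "\<exists>s. sides e = {s}"
    then obtain f j where s: "sides e = {(f, j)}" by auto
    then have mem: "(f, j) \<in> sides e" by simp
    then have f: "f \<in> Fs" "j < 4" and fj: "side f j = e" unfolding sides_def by auto
    obtain t where t: "0 < t" "t < 1" "x = h f (circ (real j + t))"
      using intr_on_side[OF mem x] .
    have circ_sector: "circ (real j + t) \<in> sector j" if "0 \<le> t" "t \<le> 1" for t
      unfolding sector_def using that by (intro image_eqI[of _ _ "(1, t)"]) auto
    have "arc e ` {0..1} = (\<lambda>t. h f (circ (real j + t))) ` {0..1}"
      using bij_betw_imp_surj_on[OF side_bij[OF f]] fj by simp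
    then have "arc e ` {0..1} \<subseteq> h f ` sector j" using circ_sector by auto
    then have "U \<subseteq> h f ` sector j" using U s by fast
    then have "circ (real j + t) \<in> interior (sector j)"
      using sphere_chart_interior[OF compact_sector continuous_on_subset[OF cont_h[OF f(1)] sector_subset] inj_on_sector[OF f] opU]
        circ_sector[of t] t xU by simp
    then have "circ (real j + t) \<in> interior (cball 0 1)" using interior_mono[OF sector_subset] by blast
    then show False by simp
  qed
qed

lemma card_sides: "e \<in> E \<Longrightarrow> card (sides e) = 2"
  using sides_le_2 sides_ge_2 by (meson le_antisym)

end

section \<open>First cohomology of the sphere modulo 2\<close>

context sphere_quadrangulation
begin

context
  fixes C :: "(real^3) set set"
  assumes C_even: "\<And>f. f \<in> Fs \<Longrightarrow> even (card {j. j < (4::nat) \<and> side f j \<in> C})"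
begin

definition e1 :: "real^3" where "e1 = axis 1 1"
definition e2 :: "real^3" where "e2 = axis 2 1"
definition e3 :: "real^3" where "e3 = axis 3 1"

lemma inner_e: "e1 \<bullet> e1 = 1" "e2 \<bullet> e2 = 1" "e3 \<bullet> e3 = 1" "e1 \<bullet> e2 = 0" "e2 \<bullet> e1 = 0"
  "e1 \<bullet> e3 = 0" "e2 \<bullet> e3 = 0"
  by (simp_all add: e1_def e2_def e3_def inner_axis_axis)

text \<open>Turning a unit vector through half a revolution sends an edge of \<open>C\<close> once
  around a projective line, the nontrivial loop; other edges are constant. So \<open>C\<close>
  becomes the pullback of the generator of the first cohomology modulo 2 of the projective
  plane.\<close>

definition turn :: "(real^3) set \<Rightarrow> real \<Rightarrow> real^3" where
  "turn e t = (if e \<in> C then cos (pi * t) *\<^sub>R e1 + sin (pi * t) *\<^sub>R e2 else e1)"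

lemma norm_turn [simp]: "norm (turn e t) = 1"
proof -
  have "turn e t \<bullet> turn e t = 1"
    using sin_cos_squared_add2[of "pi * t"]
    by (auto simp: turn_def inner_add_left inner_add_right inner_e power2_eq_square)
  then show ?thesis by (simp add: norm_eq_1)
qed

lemma turn_e3: "turn e t \<bullet> e3 = 0"
  by (simp add: turn_def inner_add_left inner_e)

lemma turn_ends: "turn e 0 = e1" "turn e 1 = (if e \<in> C then - e1 else e1)"
  by (auto simp: turn_def)

lemma continuous_on_turn: "continuous_on A (g :: real \<Rightarrow> real) \<Longrightarrow> continuous_on A (\<lambda>x. turn e (g x))"
  unfolding turn_def by (cases "e \<in> C") (auto intro!: continuous_intros)

text \<open>The map on vertices and edges. Each turn starts and ends on the line of
  \<open>e1\<close>, so all edges agree at a vertex; elsewhere the edge chosen by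
  \<open>SOME\<close> is the only one.\<close>

definition skel :: "real^3 \<Rightarrow> real^3^3" where
  "skel y = (if y \<in> W then outer e1
             else let e = SOME e. e \<in> E \<and> y \<in> arc e ` {0..1} in outer (turn e (inv_into {0..1} (arc e) y)))"

lemma skel_arc:
  assumes e: "e \<in> E" and t: "0 \<le> t" "t \<le> 1"
  shows "skel (arc e t) = outer (turn e t)"
proof (cases "arc e t \<in> W")
  case True
  then have "arc e t \<in> e" using arc_W[OF e] t by auto
  then have "arc e t = arc e 0 \<or> arc e t = arc e 1" using arc_ends[OF e] by blast
  then have "t = 0 \<or> t = 1"
    using inj_onD[OF inj_arc[OF e], of t 0] inj_onD[OF inj_arc[OF e], of t 1] t by auto
  then show ?thesis using True by (auto simp: skel_def turn_ends)
next
  case False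
  have "e' = e" if "e' \<in> E \<and> arc e t \<in> arc e' ` {0..1}" for e'
  proof (rule ccontr)
    assume "e' \<noteq> e"
    moreover have "arc e t \<in> arc e' ` {0..1} \<inter> arc e ` {0..1}" using that t by simp
    ultimately show False using arcs_meet[of e' e] that e False by blast
  qed
  then have "(SOME e'. e' \<in> E \<and> arc e t \<in> arc e' ` {0..1}) = e"
    using e t by (intro some_equality) auto
  then show ?thesis
    using False inv_into_f_f[OF inj_arc[OF e], of t] t by (simp add: skel_def)
qed

lemma continuous_on_skel: "e \<in> E \<Longrightarrow> continuous_on (arc e ` {0..1}) skel"
proof (rule continuous_on_compact_quotient)
  assume e: "e \<in> E"
  have "continuous_on {0..1} (\<lambda>t. outer (turn e t))"
    by (rule continuous_on_compose2[OF continuous_on_outer continuous_on_turn[OF continuous_on_id]]) auto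
  then show "continuous_on {0..1} (\<lambda>t. skel (arc e t))"
    by (rule continuous_on_eq) (simp add: skel_arc[OF e])
qed (auto intro: cont_arc)

text \<open>Lifted to unit vectors, the boundary of a face changes sign along each side in
  \<open>C\<close>. The number of these is even by \<open>C_even\<close>, so the lift closes
  up.\<close>

lemma boundary_lift:
  assumes f: "f \<in> Fs"
  shows "\<exists>\<alpha>. continuous_on {0..4} \<alpha> \<and> (\<forall>s\<in>{0..4}. norm (\<alpha> s) = 1 \<and> \<alpha> s \<bullet> e3 = 0 \<and>
           outer (\<alpha> s) = skel (h f (circ s))) \<and> \<alpha> 4 = \<alpha> 0"
proof -
  have side_t: "\<exists>j<4. real j \<le> s \<and> s \<le> real j + 1" if "s \<in> {0..4}" for s
  proof (cases "s = 4")
    case True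
    then show ?thesis by (intro exI[of _ 3]) auto
  next
    case False
    then have s: "0 \<le> s" "s < 4" using that by auto
    show ?thesis by (intro exI[of _ "nat \<lfloor>s\<rfloor>"]) (use s in linarith)
  qed
  have on_arc: "h f (circ s) \<in> arc (side f j) ` {0..1}" if "j < 4" "real j \<le> s" "s \<le> real j + 1" for j s
    using side_in_arc[OF f that(1), of "s - real j"] that by simp
  define \<tau> where "\<tau> j s = inv_into {0..1} (arc (side f j)) (h f (circ s))" for j s
  have \<tau>: "\<tau> j s \<in> {0..1}" "arc (side f j) (\<tau> j s) = h f (circ s)"
    if "j < 4" "real j \<le> s" "s \<le> real j + 1" for j s
    unfolding \<tau>_def by (rule inv_into_into[OF on_arc[OF that]], rule f_inv_into_f[OF on_arc[OF that]])
  have skel_\<tau>: "skel (h f (circ s)) = outer (turn (side f j) (\<tau> j s))"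
    if "j < 4" "real j \<le> s" "s \<le> real j + 1" for j s
    using skel_arc[OF side_in_E[OF f that(1)], of "\<tau> j s"] \<tau>[OF that] by simp
  have cont_hc: "continuous_on A (\<lambda>s. h f (circ s))" for A
    by (rule continuous_on_compose2[OF cont_h[OF f]]) (auto intro!: continuous_intros)
  have cont_skel: "continuous_on {real j..real j + 1} (\<lambda>s. skel (h f (circ s)))" if j: "j < 4" for j
    by (rule continuous_on_compose2[OF continuous_on_skel[OF side_in_E[OF f j]] cont_hc])
       (use on_arc[OF j] in auto)
  have cont_\<tau>: "continuous_on {real j..real j + 1} (\<tau> j)" if j: "j < 4" for j
  proof -
    have "continuous_on (arc (side f j) ` {0..1}) (inv_into {0..1} (arc (side f j)))"
      using cont_arc inj_arc side_in_E[OF f j] by (intro continuous_on_inv_into_compact) auto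
    then show ?thesis unfolding \<tau>_def
      by (rule continuous_on_compose2[OF _ cont_hc]) (use on_arc[OF j] in auto)
  qed
  have "continuous_on (\<Union>j\<in>{..<4}. {real j..real j + 1}) (\<lambda>s. skel (h f (circ s)))"
    using cont_skel by (intro continuous_on_closed_Union) auto
  then have cont: "continuous_on {0..4} (\<lambda>s. skel (h f (circ s)))"
    by (rule continuous_on_subset) (use side_t in fastforce)
  have im: "(\<lambda>s. skel (h f (circ s))) \<in> {0..4} \<rightarrow> outer ` S2"
  proof
    fix s :: real assume "s \<in> {0..4}"
    then obtain j where "j < 4" "real j \<le> s" "s \<le> real j + 1" using side_t by blast
    then show "skel (h f (circ s)) \<in> outer ` S2" using skel_\<tau> by simp
  qed
  obtain \<alpha> where \<alpha>: "continuous_on {0..4} \<alpha>" "\<alpha> \<in> {0..4} \<rightarrow> S2"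
    "\<And>s. s \<in> {0..4} \<Longrightarrow> outer (\<alpha> s) = skel (h f (circ s))"
    using covering_space_lift[OF covering_space_outer _ _ cont im]
    by (metis convex_imp_locally_path_connected convex_imp_simply_connected convex_real_interval(5))
  have n\<alpha>: "norm (\<alpha> s) = 1" if "s \<in> {0..4}" for s using \<alpha>(2) that by auto
  have perp: "\<alpha> s \<bullet> e3 = 0" if s: "s \<in> {0..4}" for s
  proof -
    obtain j where j: "j < 4" "real j \<le> s" "s \<le> real j + 1" using side_t[OF s] by blast
    have "\<alpha> s = turn (side f j) (\<tau> j s) \<or> \<alpha> s = - turn (side f j) (\<tau> j s)"
      using outer_eq_iff[OF n\<alpha>[OF s] norm_turn] \<alpha>(3)[OF s] skel_\<tau>[OF j] by metis
    then show ?thesis using turn_e3 by auto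
  qed
  \<comment> \<open>On one side the lift is \<open>turn\<close> up to a global sign, whichever way
    the side is traversed; its end values are opposite exactly for edges of
    \<open>C\<close>.\<close>
  have flip: "\<alpha> (real (Suc j)) = (if side f j \<in> C then - \<alpha> (real j) else \<alpha> (real j))" if j: "j < 4" for j
  proof -
    let ?I = "{real j..real j + 1}" and ?e = "side f j"
    let ?b = "\<lambda>s. turn ?e (\<tau> j s)"
    have I4: "?I \<subseteq> {0..4}" using j by auto
    have e: "?e \<in> E" by (rule side_in_E[OF f j])
    have "(\<forall>s\<in>?I. \<alpha> s = ?b s) \<or> (\<forall>s\<in>?I. \<alpha> s = - ?b s)"
    proof (rule outer_lifts_agree)
      show "continuous_on ?I \<alpha>" using \<alpha>(1) I4 by (rule continuous_on_subset)
      show "\<alpha> \<in> ?I \<rightarrow> S2" using \<alpha>(2) I4 by blast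
      show "continuous_on ?I ?b" by (rule continuous_on_turn[OF cont_\<tau>[OF j]])
      show "outer (\<alpha> s) = outer (?b s)" if "s \<in> ?I" for s
        using \<alpha>(3)[of s] skel_\<tau>[OF j, of s] that I4 by auto
    qed auto
    then have \<alpha>b: "\<alpha> (real j) = ?b (real j) \<and> \<alpha> (real j + 1) = ?b (real j + 1) \<or>
        \<alpha> (real j) = - ?b (real j) \<and> \<alpha> (real j + 1) = - ?b (real j + 1)" by auto
    have c: "arc ?e (\<tau> j (real j)) = q f j" "arc ?e (\<tau> j (real j + 1)) = q f (Suc j)"
      using \<tau>(2)[OF j, of "real j"] \<tau>(2)[OF j, of "real j + 1"] h_corner[OF f, of j] h_corner[OF f, of "Suc j"] j
      by (auto simp: add.commute)
    have I: "\<tau> j (real j) \<in> {0..1}" "\<tau> j (real j + 1) \<in> {0..1}"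
      using \<tau>(1)[OF j, of "real j"] \<tau>(1)[OF j, of "real j + 1"] by auto
    have end01: "t = 0 \<or> t = 1" if "t \<in> {0..1}" "arc ?e t \<in> ?e" for t
    proof -
      have "arc ?e t = arc ?e 0 \<or> arc ?e t = arc ?e 1" using that(2) arc_ends[OF e] by blast
      then show ?thesis
        using inj_onD[OF inj_arc[OF e], of t 0] inj_onD[OF inj_arc[OF e], of t 1] that(1) by auto
    qed
    have "q f j \<noteq> q f (Suc j)" using edge_two[OF e] by (auto simp: doubleton_eq_iff)
    then have "\<tau> j (real j) \<noteq> \<tau> j (real j + 1)" using c by metis
    then have "\<tau> j (real j) = 0 \<and> \<tau> j (real j + 1) = 1 \<or> \<tau> j (real j) = 1 \<and> \<tau> j (real j + 1) = 0"
      using end01[OF I(1)] end01[OF I(2)] c by auto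
    then have "?b (real j + 1) = (if ?e \<in> C then - ?b (real j) else ?b (real j))"
      by (auto simp: turn_ends)
    then show ?thesis using \<alpha>b by (auto simp: add.commute)
  qed
  have sgn: "\<alpha> (real j) = (if even (card {i. i < j \<and> side f i \<in> C}) then \<alpha> 0 else - \<alpha> 0)" if "j \<le> 4" for j
    using that
  proof (induction j)
    case (Suc j)
    have "{i. i < Suc j \<and> side f i \<in> C} = (if side f j \<in> C then insert j else id) {i. i < j \<and> side f i \<in> C}"
      by (auto simp: less_Suc_eq)
    then have "card {i. i < Suc j \<and> side f i \<in> C} =
        (if side f j \<in> C then Suc (card {i. i < j \<and> side f i \<in> C}) else card {i. i < j \<and> side f i \<in> C})"
      by simp
    then show ?case using flip[of j] Suc by simp
  qed simp
  have "\<alpha> 4 = \<alpha> 0" using sgn[of 4] C_even[OF f] by simp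
  then show ?thesis using \<alpha> n\<alpha> perp by blast
qed

text \<open>The value on the face with boundary lift \<open>\<alpha>\<close>: the line through the cone over \<open>\<alpha>\<close> with apex \<open>e3\<close>.\<close>

definition cone_pt :: "(real \<Rightarrow> real^3) \<Rightarrow> real \<Rightarrow> real \<Rightarrow> real^3" where
  "cone_pt \<alpha> r s = r *\<^sub>R \<alpha> s + (1 - r) *\<^sub>R e3"

lemma cone_pt_nonzero:
  assumes "norm (\<alpha> s) = 1" "\<alpha> s \<bullet> e3 = 0" shows "cone_pt \<alpha> r s \<noteq> 0"
proof
  assume "cone_pt \<alpha> r s = 0"
  then have "cone_pt \<alpha> r s \<bullet> e3 = 0" "cone_pt \<alpha> r s \<bullet> \<alpha> s = 0" by simp_all
  moreover have "e3 \<bullet> \<alpha> s = 0" "\<alpha> s \<bullet> \<alpha> s = 1" using assms by (simp_all add: inner_commute norm_eq_1)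
  ultimately show False
    using assms(2) by (simp add: cone_pt_def inner_add_left inner_e)
qed

text \<open>The closed lift of each face boundary lies in the plane orthogonal to \<open>e3\<close>,
  so the straight cone to \<open>e3\<close> avoids 0 and its normalisation fills the face. The
  pieces form a finite closed cover of the sphere, which gives continuity.\<close>

lemma continuous_line_map:
  "\<exists>\<Psi>. continuous_on S2 \<Psi> \<and> \<Psi> ` S2 \<subseteq> outer ` S2 \<and> (\<forall>x\<in>W. \<Psi> x = outer e1) \<and>
     (\<forall>e\<in>E. \<forall>t\<in>{0..1}. \<Psi> (arc e t) = outer (turn e t))"
proof -
  obtain \<alpha> where \<alpha>: "\<And>f. f \<in> Fs \<Longrightarrow> continuous_on {0..4} (\<alpha> f)"
    "\<And>f s. f \<in> Fs \<Longrightarrow> s \<in> {0..4} \<Longrightarrow> norm (\<alpha> f s) = 1"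
    "\<And>f s. f \<in> Fs \<Longrightarrow> s \<in> {0..4} \<Longrightarrow> \<alpha> f s \<bullet> e3 = 0"
    "\<And>f s. f \<in> Fs \<Longrightarrow> s \<in> {0..4} \<Longrightarrow> outer (\<alpha> f s) = skel (h f (circ s))"
    "\<And>f. f \<in> Fs \<Longrightarrow> \<alpha> f 4 = \<alpha> f 0"
    using bchoice[of Fs "\<lambda>f \<alpha>. continuous_on {0..4} \<alpha> \<and> (\<forall>s\<in>{0..4}. norm (\<alpha> s) = 1 \<and> \<alpha> s \<bullet> e3 = 0 \<and>
           outer (\<alpha> s) = skel (h f (circ s))) \<and> \<alpha> 4 = \<alpha> 0"] boundary_lift by blast
  define N where "N v = outer (v /\<^sub>R norm v)" for v
  define val where "val f z = N (cone_pt (\<alpha> f) (norm z) (4 * Arg2pi z / (2 * pi)))" for f z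
  define \<Psi> where "\<Psi> y = (if \<exists>f\<in>Fs. y \<in> h f ` ball 0 1
      then let p = (SOME p. fst p \<in> Fs \<and> norm (snd p) < 1 \<and> y = h (fst p) (snd p)) in val (fst p) (snd p)
      else skel y)" for y
  have \<Psi>_ball: "\<Psi> (h f z) = val f z" if f: "f \<in> Fs" and z: "norm z < 1" for f z
  proof -
    have "p = (f, z)" if "fst p \<in> Fs \<and> norm (snd p) < 1 \<and> h f z = h (fst p) (snd p)" for p
      using h_inj[of f "fst p" z "snd p"] that f z by (cases p) auto
    then have "(SOME p. fst p \<in> Fs \<and> norm (snd p) < 1 \<and> h f z = h (fst p) (snd p)) = (f, z)"
      using f z by (intro some_equality) auto
    then show ?thesis using f z by (auto simp: \<Psi>_def)
  qed
  have \<Psi>_skel: "\<Psi> y = skel y" if "y \<in> W \<or> (\<exists>e\<in>E. y \<in> arc e ` {0..1})" for y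
  proof -
    have "\<not> (\<exists>f\<in>Fs. y \<in> h f ` ball 0 1)"
      using that h_notin_W h_notin_arc by (auto simp: image_iff)
    then show ?thesis by (simp add: \<Psi>_def)
  qed
  have \<Psi>_W: "\<Psi> x = outer e1" if "x \<in> W" for x
    using \<Psi>_skel[of x] that by (simp add: skel_def)
  have \<Psi>_arc: "\<Psi> (arc e t) = outer (turn e t)" if "e \<in> E" "t \<in> {0..1}" for e t
  proof -
    have "arc e t \<in> W \<or> (\<exists>e'\<in>E. arc e t \<in> arc e' ` {0..1})" using that by blast
    then show ?thesis using \<Psi>_skel skel_arc[of e t] that by simp
  qed
  have \<Psi>_face: "\<Psi> (h f (of_real r * circ s)) = N (cone_pt (\<alpha> f) r s)"
    if f: "f \<in> Fs" and r: "r \<in> {0..1}" and s: "s \<in> {0..4}" for f r s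
  proof (cases "r = 1")
    case True
    obtain j where j: "j < 4" "real j \<le> s" "s \<le> real j + 1"
    proof (cases "s = 4")
      case True
      then show thesis using that[of 3] by simp
    next
      case False
      show thesis by (rule that[of "nat \<lfloor>s\<rfloor>"]) (use s False in \<open>auto simp: of_nat_nat\<close>, linarith+)
    qed
    have "h f (circ s) \<in> arc (side f j) ` {0..1}"
      using side_in_arc[OF f j(1), of "s - real j"] j by simp
    then have "\<Psi> (h f (circ s)) = outer (\<alpha> f s)"
      using \<Psi>_skel side_in_E[OF f j(1)] \<alpha>(4)[OF f s] by metis
    then show ?thesis using True \<alpha>(2)[OF f s] by (simp add: N_def cone_pt_def)
  next
    case False
    then have r': "0 \<le> r" "r < 1" using r by auto
    have nz: "norm (of_real r * circ s) = r" using r' by (simp add: norm_mult)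
    \<comment> \<open>The angle recovers \<open>s\<close> except for \<open>s = 4\<close>, where it
      gives 0 and \<open>\<alpha> f\<close> closes up, and for \<open>r = 0\<close>, where the cone
      is at its apex for every angle.\<close>
    have "cone_pt (\<alpha> f) r (4 * Arg2pi (of_real r * circ s) / (2 * pi)) = cone_pt (\<alpha> f) r s"
    proof (cases "r = 0")
      case False
      then have rp: "0 < r" using r' by simp
      show ?thesis
      proof (cases "s = 4")
        case True
        then show ?thesis using Arg2pi_circ[OF rp, of 0] \<alpha>(5)[OF f] by (simp add: cone_pt_def)
      next
        case False
        then have "Arg2pi (of_real r * circ s) = 2 * pi * s / 4"
          using s by (intro Arg2pi_circ[OF rp]) auto
        then show ?thesis unfolding \<open>Arg2pi _ = _\<close> by simp
      qed
    qed (simp add: cone_pt_def)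
    then show ?thesis using \<Psi>_ball[OF f, of "of_real r * circ s"] nz r' by (simp add: val_def)
  qed
  have polar: "(\<lambda>(r, s). of_real r * circ s) ` ({0..1} \<times> {0..4}) = cball 0 1"
  proof
    show "(\<lambda>(r, s). of_real r * circ s) ` ({0..1} \<times> {0..4}) \<subseteq> cball 0 1"
      by (auto simp: norm_mult)
    show "cball 0 1 \<subseteq> (\<lambda>(r, s). of_real r * circ s) ` ({0..1} \<times> {0..4})"
    proof
      fix z :: complex assume "z \<in> cball 0 1"
      then have "(norm z, 4 * Arg2pi z / (2 * pi)) \<in> {0..1} \<times> {0..4}"
        using Arg2pi[of z] by (auto simp: field_simps)
      then show "z \<in> (\<lambda>(r, s). of_real r * circ s) ` ({0..1} \<times> {0..4})"
        using polar_circ[of z] by (intro image_eqI[of _ _ "(norm z, 4 * Arg2pi z / (2 * pi))"]) auto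
    qed
  qed
  have cont_face: "continuous_on (h f ` cball 0 1) \<Psi>" if f: "f \<in> Fs" for f
  proof -
    let ?K = "{0..1::real} \<times> {0..4::real}"
    let ?g = "\<lambda>p. h f (of_real (fst p) * circ (snd p))"
    have "continuous_on (?g ` ?K) \<Psi>"
    proof (rule continuous_on_compact_quotient)
      show "compact ?K" by (intro compact_Times compact_Icc)
      show "continuous_on ?K ?g"
        by (rule continuous_on_compose2[OF cont_h[OF f]]) (auto intro!: continuous_intros simp: norm_mult)
      have c\<alpha>: "continuous_on ?K (\<lambda>p. \<alpha> f (snd p))"
        by (rule continuous_on_compose2[OF \<alpha>(1)[OF f]]) (auto intro!: continuous_intros)
      have cc: "continuous_on ?K (\<lambda>p. cone_pt (\<alpha> f) (fst p) (snd p))"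
        unfolding cone_pt_def by (intro continuous_intros c\<alpha>)
      have nz: "\<forall>p\<in>?K. norm (cone_pt (\<alpha> f) (fst p) (snd p)) \<noteq> 0"
        using cone_pt_nonzero \<alpha>(2,3)[OF f] by auto
      have "continuous_on ?K (\<lambda>p. N (cone_pt (\<alpha> f) (fst p) (snd p)))"
        unfolding N_def by (rule continuous_on_compose2[OF continuous_on_outer])
          (auto intro!: continuous_intros cc nz[rule_format])
      then show "continuous_on ?K (\<lambda>p. \<Psi> (?g p))"
        by (rule continuous_on_eq) (use \<Psi>_face[OF f] in auto)
    qed
    moreover have "?g ` ?K = h f ` cball 0 1"
      unfolding polar[symmetric] image_image by (simp add: case_prod_unfold)
    ultimately show ?thesis by simp
  qed
  have cont_arcs: "continuous_on (arc e ` {0..1}) \<Psi>" if e: "e \<in> E" for e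
    by (rule continuous_on_eq[OF continuous_on_skel[OF e]]) (use \<Psi>_skel e in metis)
  let ?P = "(\<lambda>f. h f ` cball 0 1) ` Fs \<union> (\<lambda>e. arc e ` {0..1}) ` E \<union> (\<lambda>x. {x}) ` W"
  have "continuous_on (\<Union>K\<in>?P. K) \<Psi>"
  proof (rule continuous_on_closed_Union)
    show "finite ?P" using finite_Fs finite_E finite_W by simp
    have "closed (h f ` cball 0 1)" if "f \<in> Fs" for f
      by (rule compact_imp_closed[OF compact_continuous_image[OF cont_h[OF that] compact_cball]])
    moreover have "closed (arc e ` {0..1})" if "e \<in> E" for e
      by (rule compact_imp_closed[OF compact_continuous_image[OF cont_arc[OF that] compact_Icc]])
    ultimately show "closed K" if "K \<in> ?P" for K
      using that by (elim UnE imageE) simp_all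
    show "continuous_on K \<Psi>" if "K \<in> ?P" for K
      using that cont_face cont_arcs by (elim UnE imageE) simp_all
  qed
  then have "continuous_on S2 \<Psi>"
  proof (rule continuous_on_subset)
    show "S2 \<subseteq> (\<Union>K\<in>?P. K)"
    proof
      fix x assume "x \<in> S2"
      then consider "x \<in> W" | e where "e \<in> E" "x \<in> arc e ` {0..1}" | f where "f \<in> Fs" "x \<in> h f ` ball 0 1"
        using cover by blast
      then show "x \<in> (\<Union>K\<in>?P. K)"
      proof cases
        case 1
        show ?thesis by (rule UN_I[of "{x}"]) (use 1 in simp_all)
      next
        case 2
        show ?thesis by (rule UN_I[of "arc e ` {0..1}"]) (use 2 in simp_all)
      next
        case 3
        then have x: "x \<in> h f ` cball 0 1" using ball_subset_cball by blast
        show ?thesis by (rule UN_I[of "h f ` cball 0 1"]) (use 3 x in simp_all)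
      qed
    qed
  qed
  moreover have "\<Psi> x \<in> outer ` S2" if xS: "x \<in> S2" for x
  proof -
    consider "x \<in> W" | e where "e \<in> E" "x \<in> arc e ` {0..1}" | f where "f \<in> Fs" "x \<in> h f ` ball 0 1"
      using cover[OF xS] by blast
    then show ?thesis
    proof cases
      case 1
      then show ?thesis using \<Psi>_W by (auto simp: norm_eq_1 inner_e)
    next
      case 2
      then show ?thesis using \<Psi>_arc by auto
    next
      case 3
      then obtain z where z: "z \<in> cball 0 1" "x = h f z" using ball_subset_cball by blast
      obtain r s where rs: "r \<in> {0..1}" "s \<in> {0..4}" "z = of_real r * circ s"
        using z(1) unfolding polar[symmetric] by auto
      then have "\<Psi> x = N (cone_pt (\<alpha> f) r s)" using \<Psi>_face[OF 3(1) rs(1,2)] z(2) by simp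
      moreover have "cone_pt (\<alpha> f) r s \<noteq> 0" using cone_pt_nonzero \<alpha>(2,3)[OF 3(1) rs(2)] by blast
      ultimately show ?thesis unfolding N_def by simp
    qed
  qed
  ultimately show ?thesis using \<Psi>_W \<Psi>_arc by (intro exI[of _ \<Psi>]) blast
qed

text \<open>The sphere is simply connected, so the line map lifts to a map \<open>L\<close> into the
  sphere. At a vertex \<open>L\<close> is \<open>e1\<close> or \<open>- e1\<close>, and along an
  edge it changes between them exactly if the edge is in \<open>C\<close>.\<close>

lemma coboundary_exists:
  "\<exists>S. \<forall>x y. {x, y} \<in> E \<longrightarrow> ({x, y} \<in> C \<longleftrightarrow> (x \<in> S) \<noteq> (y \<in> S))"
proof -
  obtain \<Psi> where \<Psi>: "continuous_on S2 \<Psi>" "\<Psi> ` S2 \<subseteq> outer ` S2" "\<And>x. x \<in> W \<Longrightarrow> \<Psi> x = outer e1"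
    "\<And>e t. e \<in> E \<Longrightarrow> t \<in> {0..1} \<Longrightarrow> \<Psi> (arc e t) = outer (turn e t)"
    using continuous_line_map by blast
  have sc: "simply_connected S2" by (rule simply_connected_sphere) simp
  obtain L where L: "continuous_on S2 L" "L \<in> S2 \<rightarrow> S2" "\<And>y. y \<in> S2 \<Longrightarrow> outer (L y) = \<Psi> y"
    by (rule covering_space_lift[OF covering_space_outer sc locally_path_connected_sphere \<Psi>(1)])
       (use \<Psi>(2) in auto)
  have LW: "L x = e1 \<or> L x = - e1" if "x \<in> W" for x
  proof -
    have x: "x \<in> S2" using that W_sphere by blast
    then have "norm (L x) = 1" "norm e1 = 1" using L(2) by (auto simp: norm_eq_1 inner_e Pi_iff)
    moreover have "outer (L x) = outer e1" using L(3)[OF x] \<Psi>(3)[OF that] by simp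
    ultimately show ?thesis using outer_eq_iff by blast
  qed
  have e1: "e1 \<noteq> - e1"
  proof
    assume "e1 = - e1"
    then have "e1 \<bullet> e1 = - e1 \<bullet> e1" by metis
    then show False by (simp add: inner_e)
  qed
  define S where "S = {x. L x = e1}"
  have main: "e \<in> C \<longleftrightarrow> (arc e 0 \<in> S) \<noteq> (arc e 1 \<in> S)" if e: "e \<in> E" for e
  proof -
    have "(\<forall>t\<in>{0..1}. L (arc e t) = turn e t) \<or> (\<forall>t\<in>{0..1}. L (arc e t) = - turn e t)"
    proof (rule outer_lifts_agree)
      show "continuous_on {0..1} (\<lambda>t. L (arc e t))"
        by (rule continuous_on_compose2[OF L(1) cont_arc[OF e] arc_sphere[OF e]])
      show "(\<lambda>t. L (arc e t)) \<in> {0..1} \<rightarrow> S2" using L(2) arc_sphere[OF e] by (auto simp: Pi_iff image_subset_iff)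
      show "continuous_on {0..1} (turn e)" by (rule continuous_on_turn[OF continuous_on_id])
      show "outer (L (arc e t)) = outer (turn e t)" if "t \<in> {0..1}" for t
        using L(3)[of "arc e t"] \<Psi>(4)[OF e that] arc_sphere[OF e] that by (auto simp: image_subset_iff)
    qed auto
    then have "L (arc e 0) = turn e 0 \<and> L (arc e 1) = turn e 1 \<or> L (arc e 0) = - turn e 0 \<and> L (arc e 1) = - turn e 1"
      by auto
    then show ?thesis using e1 unfolding S_def turn_ends by (cases "e \<in> C") auto
  qed
  have "{x, y} \<in> C \<longleftrightarrow> (x \<in> S) \<noteq> (y \<in> S)" if xy: "{x, y} \<in> E" for x y
  proof -
    have "{x, y} = {arc {x, y} 0, arc {x, y} 1}" by (rule arc_ends[OF xy])
    then have "x = arc {x, y} 0 \<and> y = arc {x, y} 1 \<or> x = arc {x, y} 1 \<and> y = arc {x, y} 0"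
      unfolding doubleton_eq_iff .
    then show ?thesis using main[OF xy] by metis
  qed
  then show ?thesis by blast
qed

end

end

section \<open>Odd closed walks\<close>

lemma relpow_steps:
  assumes "\<And>i. i < n \<Longrightarrow> (w (m + i), w (Suc (m + i))) \<in> R"
  shows "(w m, w (m + n)) \<in> R ^^ n"
  using assms by (induction n) (auto intro: relpow_Suc_I)

context pair_graph
begin

lemma arc_sym: "(u, v) \<in> parcs G \<Longrightarrow> (v, u) \<in> parcs G"
  using pair_sym_arcs by (auto simp: symmetric_def dest: symD)

lemma walk_sym: "(u, v) \<in> parcs G ^^ n \<Longrightarrow> (v, u) \<in> parcs G ^^ n"
  by (rule relpow_sym[OF symI]) (rule arc_sym)

text \<open>Without odd closed walks, the parity of a walk from \<open>v\<close> to a fixed vertex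
  of its component is well defined and 2-colours the graph.\<close>

lemma odd_closed_walk:
  assumes nb: "\<nexists>A B. pverts G = A \<union> B \<and> A \<inter> B = {} \<and> parcs G \<subseteq> A \<times> B \<union> B \<times> A"
  shows "\<exists>u n. odd n \<and> (u, u) \<in> parcs G ^^ n"
proof (rule ccontr)
  assume "\<not> ?thesis"
  then have no: "\<And>u n. (u, u) \<in> parcs G ^^ n \<Longrightarrow> even n" by blast
  \<comment> \<open>\<open>SOME\<close> applied to equal predicates gives equal values, so
    \<open>r\<close> agrees at the two ends of an arc.\<close>
  define r where "r v = (SOME u. \<exists>n. (v, u) \<in> parcs G ^^ n)" for v
  have r: "\<exists>n. (v, r v) \<in> parcs G ^^ n" for v
    unfolding r_def by (rule someI_ex) (rule exI[of _ v], rule exI[of _ 0], simp)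
  define A where "A = {v \<in> pverts G. \<exists>n. even n \<and> (v, r v) \<in> parcs G ^^ n}"
  have r_eq: "r v = r v'" if "(v, v') \<in> parcs G" for v v'
  proof -
    have "(\<exists>n. (v, u) \<in> parcs G ^^ n) \<longleftrightarrow> (\<exists>n. (v', u) \<in> parcs G ^^ n)" for u
      using relpow_Suc_I2[OF that] relpow_Suc_I2[OF arc_sym[OF that]] by blast
    then show ?thesis by (simp add: r_def)
  qed
  have "(v \<in> A) \<noteq> (v' \<in> A)" if vv': "(v, v') \<in> parcs G" for v v'
  proof -
    have V: "v \<in> pverts G" "v' \<in> pverts G" using vv' in_arcsD1 in_arcsD2 by blast+
    have "\<not> (v \<in> A \<and> v' \<in> A)"
    proof
      assume "v \<in> A \<and> v' \<in> A"
      then obtain m n where mn: "even m" "even n" "(v, r v) \<in> parcs G ^^ m" "(v', r v') \<in> parcs G ^^ n"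
        unfolding A_def by auto
      have "(v', v) \<in> parcs G ^^ (n + m)"
        unfolding relpow_add using mn(4) walk_sym[OF mn(3)] r_eq[OF vv'] by auto
      then have "(v, v) \<in> parcs G ^^ Suc (n + m)" by (rule relpow_Suc_I2[OF vv'])
      then have "even (Suc (n + m))" by (rule no)
      then show False using mn(1,2) by simp
    qed
    moreover have "v \<in> A \<or> v' \<in> A"
    proof -
      obtain n where n: "(v, r v) \<in> parcs G ^^ n" using r by blast
      have "(v', r v') \<in> parcs G ^^ Suc n"
        using relpow_Suc_I2[OF arc_sym[OF vv'] n] r_eq[OF vv'] by simp
      show ?thesis
      proof (cases "even n")
        case True
        then show ?thesis using n V unfolding A_def by blast
      next
        case False
        then have "even (Suc n)" by simp
        then show ?thesis using \<open>(v', r v') \<in> parcs G ^^ Suc n\<close> V unfolding A_def by blast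
      qed
    qed
    ultimately show ?thesis by blast
  qed
  then have "parcs G \<subseteq> A \<times> (pverts G - A) \<union> (pverts G - A) \<times> A"
    using in_arcsD1 in_arcsD2 by fast
  moreover have "pverts G = A \<union> (pverts G - A)" by (auto simp: A_def)
  ultimately show False using nb by blast
qed

text \<open>A shortest odd closed walk does not repeat a vertex: splitting it there would give a shorter one.\<close>

lemma shortest_odd_closed_walk:
  assumes ex: "\<exists>u n. odd n \<and> (u, u) \<in> parcs G ^^ n"
  obtains k w where "odd k" "2 \<le> k" "\<And>i. (w i, w (Suc i)) \<in> parcs G" "\<And>i. w (i + k) = w i"
    "inj_on w {..<k}" "\<And>u n. odd n \<Longrightarrow> (u, u) \<in> parcs G ^^ n \<Longrightarrow> k \<le> n"
proof -
  define Q where "Q n \<longleftrightarrow> odd n \<and> (\<exists>u. (u, u) \<in> parcs G ^^ n)" for n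
  define k where "k = (LEAST n. Q n)"
  have "\<exists>n. Q n" using ex by (auto simp: Q_def)
  then have Qk: "Q k" unfolding k_def by (rule LeastI_ex)
  have min: "k \<le> n" if "odd n" "(u, u) \<in> parcs G ^^ n" for u n
    unfolding k_def by (rule Least_le) (use that in \<open>auto simp: Q_def\<close>)
  from Qk obtain u where u: "(u, u) \<in> parcs G ^^ k" and k: "odd k" by (auto simp: Q_def)
  then obtain g where g: "g 0 = u" "g k = u" "\<And>i. i < k \<Longrightarrow> (g i, g (Suc i)) \<in> parcs G"
    unfolding relpow_fun_conv by blast
  define w where "w i = g (i mod k)" for i
  have k0: "0 < k" using k by (rule odd_pos)
  have step: "(w i, w (Suc i)) \<in> parcs G" for i
  proof -
    have "w (Suc i) = g (Suc (i mod k))"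
      using g(1,2) by (auto simp: w_def mod_Suc)
    then show ?thesis using g(3)[of "i mod k"] k0 by (simp add: w_def)
  qed
  have per: "w (i + k) = w i" for i by (simp add: w_def)
  have "k \<noteq> 1" using u pair_no_loops by fastforce
  then have k2: "2 \<le> k" using k0 by linarith
  have ne: "w i \<noteq> w j" if ij: "i < j" "j < k" for i j
  proof
    assume eq: "w i = w j"
    have 1: "(w i, w i) \<in> parcs G ^^ (j - i)"
      using relpow_steps[of "j - i" w i "parcs G"] step ij eq by simp
    have 2: "(w i, w i) \<in> parcs G ^^ (k - (j - i))"
      using relpow_steps[of "k - (j - i)" w j "parcs G"] step ij eq per[of i] by (simp add: add.commute)
    show False
    proof (cases "odd (j - i)")
      case True
      then show False using min[OF True 1] ij by linarith
    next
      case False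
      then have "odd (k - (j - i))" using k ij by simp
      then show False using min[OF _ 2] ij by fastforce
    qed
  qed
  have "inj_on w {..<k}"
    by (rule inj_onI) (metis ne lessThan_iff linorder_neqE_nat)
  then show thesis using that[of k w] k k2 step per min by blast
qed

lemma cycle_of_walk:
  assumes k: "0 < k" and step: "\<And>i. (w i, w (Suc i)) \<in> parcs G" and per: "w k = w 0" and inj: "inj_on w {..<k}"
  shows "cycle (map (\<lambda>i. (w i, w (Suc i))) [0..<k])"
proof -
  let ?p = "\<lambda>m n. map (\<lambda>i. (w i, w (Suc i))) [m..<n]"
  have cas: "pcas (w m) (?p m (m + n)) (w (m + n))" for m n
  proof (induction n arbitrary: m)
    case (Suc n)
    have "[m..<m + Suc n] = m # [Suc m..<Suc m + n]" by (simp add: upt_rec)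
    then show ?case using Suc[of "Suc m"] by simp
  qed simp
  have verts: "pawalk_verts (w m) (?p m (m + n)) = map w [m..<Suc (m + n)]" for m n
  proof (induction n arbitrary: m)
    case (Suc n)
    have 1: "[m..<m + Suc n] = m # [Suc m..<Suc m + n]" by (simp add: upt_rec)
    have 2: "[m..<Suc (m + Suc n)] = m # [Suc m..<Suc (Suc m + n)]" by (simp add: upt_rec)
    show ?case unfolding 1 2 using Suc[of "Suc m"] by simp
  qed simp
  have v: "pawalk_verts (w 0) (?p 0 k) = map w [0..<Suc k]" using verts[of 0 k] by simp
  have "tl (map w [0..<Suc k]) = map w [1..<Suc k]" by (simp add: upt_rec del: upt_Suc)
  moreover have "distinct (map w [1..<Suc k])"
  proof -
    have "inj_on w {1..<Suc k}"
    proof (rule inj_onI)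
      fix i j assume ij: "i \<in> {1..<Suc k}" "j \<in> {1..<Suc k}" "w i = w j"
      define r where "r i = (if i = k then 0 else i)" for i
      have "w (r i) = w i" "w (r j) = w j" "r i < k" "r j < k" using per ij k by (auto simp: r_def)
      then have "r i = r j" using inj_onD[OF inj] ij by auto
      then show "i = j" using ij by (auto simp: r_def split: if_splits)
    qed
    then show ?thesis by (simp add: distinct_map del: upt_Suc)
  qed
  moreover have "awalk (w 0) (?p 0 k) (w 0)"
    unfolding awalk_def using cas[of 0 k] step per in_arcsD1[OF step[of 0]] by auto
  ultimately show ?thesis
    unfolding cycle_def using v k by (intro exI[of _ "w 0"]) auto
qed

end

section \<open>Lifting an embedding to the sphere\<close>

abbreviation cls :: "real^3 \<Rightarrow> (real^3) set" where "cls \<equiv> antipodal_class"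

lemma cls_eq_iff: "cls x = cls y \<longleftrightarrow> x = y \<or> x = - y"
  by (auto simp: antipodal_class_def doubleton_eq_iff)

lemma topspace_projective_plane: "topspace projective_plane = cls ` S2"
  by (simp add: projective_plane_def topspace_quotient_topology)

lemma sphere_neq_minus: "x \<in> S2 \<Longrightarrow> x \<noteq> - x"
  by (metis add_eq_0_iff dist_0_norm mem_sphere norm_zero scaleR_2 scaleR_eq_0_iff zero_neq_numeral zero_neq_one)

text \<open>\<open>outer\<close> is constant on antipodal classes, so the element chosen by
  \<open>SOME\<close> does not matter. This links the quotient topology to the covering
  \<open>outer\<close>.\<close>

definition proj_matrix :: "(real^3) set \<Rightarrow> real^3^3" where
  "proj_matrix c = outer (SOME x. x \<in> c)"

lemma proj_matrix_cls: "proj_matrix (cls x) = outer x"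
proof -
  have "(SOME y. y \<in> cls x) \<in> cls x" by (rule someI[of _ x]) (simp add: antipodal_class_def)
  then show ?thesis by (auto simp: proj_matrix_def antipodal_class_def)
qed

lemma continuous_map_proj_matrix: "continuous_map projective_plane euclidean proj_matrix"
proof -
  have "proj_matrix \<circ> cls = outer" by (auto simp: proj_matrix_cls)
  then have "continuous_map (top_of_set S2) euclidean (proj_matrix \<circ> cls)"
    by (simp add: continuous_on_outer)
  then show ?thesis
    unfolding projective_plane_def
    using continuous_compose_quotient_map[OF quotient_map_quotient_topology] by blast
qed

text \<open>After \<open>proj_matrix\<close> the map lands in the base of the covering
  \<open>outer\<close>, where maps from a convex set lift. Equality of the matrices is equality of
  the classes, so this is also a lift through \<open>cls\<close>.\<close>

lemma lift_to_sphere: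
  fixes g :: "'a::real_normed_vector \<Rightarrow> (real^3) set"
  assumes T: "convex T" and g: "continuous_map (top_of_set T) projective_plane g"
  obtains g' where "continuous_on T g'" "g' ` T \<subseteq> S2" "\<And>z. z \<in> T \<Longrightarrow> cls (g' z) = g z"
proof -
  have "continuous_map (top_of_set T) euclidean (proj_matrix \<circ> g)"
    using continuous_map_compose[OF g continuous_map_proj_matrix] .
  then have cont: "continuous_on T (proj_matrix \<circ> g)" by simp
  have cl: "\<exists>x\<in>S2. g z = cls x" if "z \<in> T" for z
    using continuous_map_image_subset_topspace[OF g] that by (auto simp: topspace_projective_plane)
  have im: "proj_matrix \<circ> g \<in> T \<rightarrow> outer ` S2"
    using cl by (fastforce simp: proj_matrix_cls)
  obtain g' where g': "continuous_on T g'" "g' \<in> T \<rightarrow> S2" "\<And>z. z \<in> T \<Longrightarrow> outer (g' z) = (proj_matrix \<circ> g) z"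
    using covering_space_lift[OF covering_space_outer convex_imp_simply_connected[OF T]
        convex_imp_locally_path_connected[OF T] cont im] by blast
  show thesis
  proof (rule that[OF g'(1)])
    show "g' ` T \<subseteq> S2" using g'(2) by blast
    fix z assume z: "z \<in> T"
    obtain x where x: "x \<in> S2" "g z = cls x" using cl[OF z] by blast
    have "outer (g' z) = outer x" using g'(3)[OF z] x by (simp add: proj_matrix_cls)
    moreover have "g' z \<in> S2" using g'(2) z by blast
    ultimately have "g' z = x \<or> g' z = - x" using outer_eq_iff[of "g' z" x] x by simp
    then show "cls (g' z) = g z" using x(2) by (simp add: cls_eq_iff)
  qed
qed

locale projective_embedding = pair_graph G for G :: "'a pair_pre_digraph" +
  fixes \<phi> :: "'a \<Rightarrow> (real^3) set" and \<gamma> :: "'a \<times> 'a \<Rightarrow> (real^3) set set"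
    and hF :: "(real^3) set set \<Rightarrow> complex \<Rightarrow> (real^3) set" and pF :: "(real^3) set set \<Rightarrow> ('a \<times> 'a) list"
  assumes emb: "graph_embedding projective_plane G \<phi> \<gamma>"
    and pF_length: "\<And>F. F \<in> embedding_faces projective_plane G \<phi> \<gamma> \<Longrightarrow> length (pF F) = 4"
    and pF_arcs: "\<And>F. F \<in> embedding_faces projective_plane G \<phi> \<gamma> \<Longrightarrow> set (pF F) \<subseteq> parcs G"
    and hF_cont: "\<And>F. F \<in> embedding_faces projective_plane G \<phi> \<gamma> \<Longrightarrow>
       continuous_map (top_of_set (cball 0 1)) projective_plane (hF F)"
    and hF_homeo: "\<And>F. F \<in> embedding_faces projective_plane G \<phi> \<gamma> \<Longrightarrow>
       homeomorphic_map (top_of_set (ball 0 1)) (subtopology projective_plane F) (hF F)"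
    and hF_side: "\<And>F i. F \<in> embedding_faces projective_plane G \<phi> \<gamma> \<Longrightarrow> i < 4 \<Longrightarrow>
       hF F (circ (real i)) = \<phi> (fst (pF F ! i)) \<and> hF F (circ (real i + 1)) = \<phi> (snd (pF F ! i)) \<and>
       bij_betw (\<lambda>t. hF F (circ (real i + t))) {0..1} (\<gamma> (pF F ! i))"
    and verts_nonempty: "pverts G \<noteq> {}"
begin

abbreviation faces where "faces \<equiv> embedding_faces projective_plane G \<phi> \<gamma>"

lemma phi_sphere: "v \<in> pverts G \<Longrightarrow> \<exists>x\<in>S2. \<phi> v = cls x"
proof -
  assume v: "v \<in> pverts G"
  have "\<phi> ` pverts G \<subseteq> cls ` S2"
    using emb unfolding graph_embedding_def topspace_projective_plane by (elim conjE)
  then show ?thesis using v by blast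
qed

lemma phi_inj: "u \<in> pverts G \<Longrightarrow> v \<in> pverts G \<Longrightarrow> \<phi> u = \<phi> v \<Longrightarrow> u = v"
proof -
  have "inj_on \<phi> (pverts G)" using emb unfolding graph_embedding_def by (elim conjE)
  then show "u \<in> pverts G \<Longrightarrow> v \<in> pverts G \<Longrightarrow> \<phi> u = \<phi> v \<Longrightarrow> u = v" by (simp add: inj_on_def)
qed

lemma gamma_arc: "(u, v) \<in> parcs G \<Longrightarrow> topological_arc projective_plane (\<phi> u) (\<phi> v) (\<gamma> (u, v))"
  and gamma_sym: "(u, v) \<in> parcs G \<Longrightarrow> \<gamma> (v, u) = \<gamma> (u, v)"
proof -
  have "\<forall>(u, v) \<in> parcs G. topological_arc projective_plane (\<phi> u) (\<phi> v) (\<gamma> (u, v)) \<and> \<gamma> (v, u) = \<gamma> (u, v)"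
    using emb unfolding graph_embedding_def by (elim conjE)
  then show "(u, v) \<in> parcs G \<Longrightarrow> topological_arc projective_plane (\<phi> u) (\<phi> v) (\<gamma> (u, v))"
    "(u, v) \<in> parcs G \<Longrightarrow> \<gamma> (v, u) = \<gamma> (u, v)" by auto
qed

lemma gamma_verts:
  assumes "(u, v) \<in> parcs G" shows "\<gamma> (u, v) \<inter> \<phi> ` pverts G = {\<phi> u, \<phi> v}"
proof -
  have "\<forall>(u, v) \<in> parcs G. \<gamma> (u, v) \<inter> \<phi> ` pverts G = {\<phi> u, \<phi> v}"
    using emb unfolding graph_embedding_def by (elim conjE)
  from bspec[OF this assms] show ?thesis by (simp only: case_prod_conv)
qed

lemma gamma_meet:
  assumes "(u, v) \<in> parcs G" "(x, y) \<in> parcs G" "{u, v} \<noteq> {x, y}"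
  shows "\<gamma> (u, v) \<inter> \<gamma> (x, y) \<subseteq> \<phi> ` pverts G"
proof -
  have "\<forall>(u, v) \<in> parcs G. \<forall>(x, y) \<in> parcs G. {u, v} \<noteq> {x, y} \<longrightarrow>
        \<gamma> (u, v) \<inter> \<gamma> (x, y) \<subseteq> \<phi> ` pverts G"
    using emb unfolding graph_embedding_def by (elim conjE)
  from bspec[OF this assms(1)]
  have "\<forall>(x, y) \<in> parcs G. {u, v} \<noteq> {x, y} \<longrightarrow> \<gamma> (u, v) \<inter> \<gamma> (x, y) \<subseteq> \<phi> ` pverts G"
    by (simp only: case_prod_conv)
  from bspec[OF this assms(2)]
  have "{u, v} \<noteq> {x, y} \<longrightarrow> \<gamma> (u, v) \<inter> \<gamma> (x, y) \<subseteq> \<phi> ` pverts G"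
    by (simp only: case_prod_conv)
  then show ?thesis using assms(3) by (rule mp)
qed

text \<open>A lift of the arc from \<open>u\<close> to \<open>v\<close>. Only the point set
  \<open>\<gamma> (u, v)\<close> is prescribed, so two lifts may differ by parametrization as well
  as by sign.\<close>

definition larc :: "'a \<Rightarrow> 'a \<Rightarrow> (real \<Rightarrow> real^3) \<Rightarrow> bool" where
  "larc u v a \<longleftrightarrow> continuous_on {0..1} a \<and> a ` {0..1} \<subseteq> S2 \<and> bij_betw (\<lambda>t. cls (a t)) {0..1} (\<gamma> (u, v)) \<and>
     cls (a 0) = \<phi> u \<and> cls (a 1) = \<phi> v"

lemma larc_minus: "larc u v a \<Longrightarrow> larc u v (\<lambda>t. - a t)"
proof -
  have c: "cls (- x) = cls x" for x by (simp add: cls_eq_iff)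
  assume "larc u v a"
  then show ?thesis unfolding larc_def c by (auto intro: continuous_on_minus)
qed

lemma larc_rev: "(u, v) \<in> parcs G \<Longrightarrow> larc u v a \<Longrightarrow> larc v u (\<lambda>t. a (1 - t))"
proof -
  assume uv: "(u, v) \<in> parcs G" and a: "larc u v a"
  have r: "bij_betw (\<lambda>t. 1 - t) {0..1::real} {0..1}"
    by (rule bij_betw_byWitness[where f' = "\<lambda>t. 1 - t"]) auto
  have "bij_betw ((\<lambda>t. cls (a t)) \<circ> (\<lambda>t. 1 - t)) {0..1} (\<gamma> (u, v))"
    using a by (intro bij_betw_trans[OF r]) (simp add: larc_def)
  moreover have "continuous_on {0..1} (\<lambda>t. a (1 - t))"
    by (rule continuous_on_compose2[of "{0..1}" a]) (use a in \<open>auto simp: larc_def intro!: continuous_intros\<close>)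
  ultimately show ?thesis
    using a gamma_sym[OF uv] by (auto simp: larc_def o_def)
qed

lemma larc_exists:
  assumes uv: "(u, v) \<in> parcs G" and x: "x \<in> S2" "cls x = \<phi> u"
  obtains a where "larc u v a" "a 0 = x"
proof -
  obtain g where g: "embedding_map (top_of_set {0..1::real}) projective_plane g" "g 0 = \<phi> u" "g 1 = \<phi> v"
    "g ` {0..1} = \<gamma> (u, v)"
    using gamma_arc[OF uv] unfolding topological_arc_def by blast
  then have hom: "homeomorphic_map (top_of_set {0..1}) (subtopology projective_plane (g ` {0..1})) g"
    by (simp add: embedding_map_def)
  have cont: "continuous_map (top_of_set {0..1}) projective_plane g"
    using homeomorphic_imp_continuous_map[OF hom] continuous_map_into_fulltopology by blast
  have inj: "inj_on g {0..1}" using homeomorphic_imp_injective_map[OF hom] by simp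
  obtain a where a: "continuous_on {0..1} a" "a ` {0..1} \<subseteq> S2" "\<And>t. t \<in> {0..1} \<Longrightarrow> cls (a t) = g t"
    using lift_to_sphere[OF convex_real_interval(5) cont] by blast
  have "bij_betw (\<lambda>t. cls (a t)) {0..1} (\<gamma> (u, v))"
    unfolding bij_betw_def using inj g(4) a(3) by (auto simp: inj_on_def image_def)
  then have la: "larc u v a" unfolding larc_def using a g by simp
  have "cls (a 0) = cls x" using la x by (simp add: larc_def)
  then have "a 0 = x \<or> - a 0 = x" by (auto simp: cls_eq_iff)
  then show thesis using that[OF la] that[OF larc_minus[OF la]] by blast
qed

lemma larc_inj:
  assumes "larc u v a" "s \<in> {0..1}" "t \<in> {0..1}" "cls (a s) = cls (a t)" shows "s = t"
  using assms bij_betw_imp_inj_on unfolding larc_def by (metis (mono_tags, lifting) inj_onD)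

lemma larc_in_gamma: "larc u v a \<Longrightarrow> x \<in> a ` {0..1} \<Longrightarrow> cls x \<in> \<gamma> (u, v)"
  unfolding larc_def bij_betw_def by auto

lemma larc_in_sphere: "larc u v a \<Longrightarrow> x \<in> a ` {0..1} \<Longrightarrow> x \<in> S2"
  unfolding larc_def by blast

lemma larc_disjoint_minus:
  assumes "larc u v a" "s \<in> {0..1}" "t \<in> {0..1}" shows "a s \<noteq> - a t"
proof
  assume eq: "a s = - a t"
  then have "s = t" using larc_inj[OF assms] by (simp add: cls_eq_iff)
  moreover have "a t \<in> S2" using assms(1,3) unfolding larc_def by blast
  ultimately show False using eq sphere_neq_minus by metis
qed

lemma larc_lift_eq:
  assumes a: "larc u v a" and b: "larc u v b" and t: "t \<in> {0..1}"
  shows "\<exists>s\<in>{0..1}. b t = a s \<or> b t = - a s"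
proof -
  have "cls (b t) \<in> (\<lambda>t. cls (b t)) ` {0..1}" using t by blast
  also have "\<dots> = (\<lambda>t. cls (a t)) ` {0..1}"
    using a b unfolding larc_def bij_betw_def by simp
  finally show ?thesis by (auto simp: cls_eq_iff)
qed

text \<open>Two lifts may project to different parametrizations, so points are compared instead of
  parameters: \<open>b\<close> runs in the union of the disjoint closed images of \<open>a\<close>
  and \<open>- a\<close> and, being connected, stays in the one where it starts.\<close>

lemma larc_unique:
  assumes a: "larc u v a" and b: "larc u v b" and 0: "b 0 = a 0"
  shows "b ` {0..1} = a ` {0..1} \<and> b 1 = a 1"
proof -
  have cl: "compact (c ` {0..1})" if "larc u v c" for c
    using that compact_continuous_image[of "{0..1}" c] by (auto simp: larc_def)
  have sub: "b ` {0..1} \<subseteq> a ` {0..1}"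
  proof (rule ccontr)
    assume n: "\<not> ?thesis"
    let ?A = "a ` {0..1}" and ?B = "(\<lambda>t. - a t) ` {0..1}"
    have conn: "topological_space_class.connected (b ` {0..1})"
      using b by (intro connected_continuous_image) (auto simp: larc_def)
    have "closed ?A" "closed ?B" using cl[OF a] cl[OF larc_minus[OF a]] compact_imp_closed by blast+
    moreover have "b ` {0..1} \<subseteq> ?A \<union> ?B" using larc_lift_eq[OF a b] by blast
    moreover have "?A \<inter> ?B \<inter> b ` {0..1} = {}" using larc_disjoint_minus[OF a] by blast
    moreover have "?A \<inter> b ` {0..1} \<noteq> {}"
    proof -
      have "b 0 \<in> b ` {0..1}" "a 0 \<in> ?A" by simp_all
      then have "b 0 \<in> ?A \<inter> b ` {0..1}" unfolding 0 by (rule IntI[rotated])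
      then show ?thesis by (metis empty_iff)
    qed
    moreover have "?B \<inter> b ` {0..1} \<noteq> {}" using n \<open>b ` {0..1} \<subseteq> ?A \<union> ?B\<close> by blast
    ultimately show False using conn unfolding connected_closed by blast
  qed
  have "a t \<in> b ` {0..1}" if t: "t \<in> {0..1}" for t
  proof -
    obtain s where s: "s \<in> {0..1}" "a t = b s \<or> a t = - b s" using larc_lift_eq[OF b a t] by blast
    obtain r where r: "r \<in> {0..1}" "b s = a r" using sub s(1) by blast
    then have "a t \<noteq> - b s" using larc_disjoint_minus[OF a t r(1)] by simp
    then show ?thesis using s by blast
  qed
  then have im: "b ` {0..1} = a ` {0..1}" using sub by blast
  have "cls (b 1) = cls (a 1)" using a b by (simp add: larc_def)
  then have "b 1 = a 1 \<or> b 1 = - a 1" by (simp add: cls_eq_iff)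
  moreover have "b 1 \<noteq> - a 1"
  proof -
    have "b 1 \<in> b ` {0..1}" by simp
    then obtain r where r: "r \<in> {0..1}" "b 1 = a r" unfolding im by blast
    show ?thesis unfolding r(2) by (rule larc_disjoint_minus[OF a r(1)]) simp
  qed
  ultimately have "b 1 = a 1" by blast
  then show ?thesis using im by blast
qed

lemma larc_start:
  assumes "larc u v a" "larc u v b" shows "b 0 = a 0 \<or> b 0 = - a 0"
proof -
  have "cls (b 0) = cls (a 0)" using assms by (simp add: larc_def)
  then show ?thesis by (simp add: cls_eq_iff)
qed

definition LW :: "(real^3) set" where "LW = {x \<in> S2. cls x \<in> \<phi> ` pverts G}"

definition LE :: "(real^3) set set" where "LE = {{a 0, a 1} | u v a. (u, v) \<in> parcs G \<and> larc u v a}"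

lemma LE_I: "(u, v) \<in> parcs G \<Longrightarrow> larc u v a \<Longrightarrow> {a 0, a 1} \<in> LE"
  unfolding LE_def by blast

definition Larc :: "(real^3) set \<Rightarrow> real \<Rightarrow> real^3" where
  "Larc e = (SOME a. (\<exists>u v. (u, v) \<in> parcs G \<and> larc u v a) \<and> {a 0, a 1} = e)"

lemma LarcE:
  assumes "e \<in> LE"
  obtains u v where "(u, v) \<in> parcs G" "larc u v (Larc e)" "{Larc e 0, Larc e 1} = e"
proof -
  have "\<exists>a. (\<exists>u v. (u, v) \<in> parcs G \<and> larc u v a) \<and> {a 0, a 1} = e"
    using assms unfolding LE_def by blast
  then have "(\<exists>u v. (u, v) \<in> parcs G \<and> larc u v (Larc e)) \<and> {Larc e 0, Larc e 1} = e"
    unfolding Larc_def by (rule someI_ex)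
  then show thesis using that by blast
qed

text \<open>\<open>Larc\<close> may choose a lift in the opposite direction or with another
  parametrization, but the ends determine the point set.\<close>

lemma Larc_image:
  assumes uv: "(u, v) \<in> parcs G" and a: "larc u v a"
  shows "Larc {a 0, a 1} ` {0..1} = a ` {0..1}"
proof -
  let ?e = "{a 0, a 1}"
  let ?b = "Larc ?e"
  have "?e \<in> LE" by (rule LE_I[OF assms])
  then obtain u' v' where b: "(u', v') \<in> parcs G" "larc u' v' ?b" "{?b 0, ?b 1} = ?e" by (rule LarcE)
  have V: "u \<in> pverts G" "v \<in> pverts G" "u' \<in> pverts G" "v' \<in> pverts G"
    using in_arcsD1 in_arcsD2 uv b(1) by blast+
  have ends: "cls (a 0) = \<phi> u" "cls (a 1) = \<phi> v" "cls (?b 0) = \<phi> u'" "cls (?b 1) = \<phi> v'"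
    using a b(2) by (simp_all add: larc_def)
  consider "?b 0 = a 0" "?b 1 = a 1" | "?b 0 = a 1" "?b 1 = a 0"
    using b(3) unfolding doubleton_eq_iff by blast
  then show ?thesis
  proof cases
    case 1
    then have "u' = u" "v' = v" using ends V phi_inj by metis+
    then show ?thesis using larc_unique[OF a] b(2) 1 by blast
  next
    case 2
    then have "u' = v" "v' = u" using ends V phi_inj by metis+
    then have l: "larc u v (\<lambda>t. ?b (1 - t))" using larc_rev b by blast
    have s0: "?b (1 - 0) = a 0" unfolding diff_zero by (rule 2(2))
    have "(\<lambda>t. ?b (1 - t)) ` {0..1} = a ` {0..1}" by (rule conjunct1[OF larc_unique[OF a l s0]])
    moreover have "(\<lambda>t. ?b (1 - t)) ` {0..1} = ?b ` {0..1}"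
    proof -
      have "(\<lambda>t. 1 - t) ` {0..1} = {0..1::real}" by simp
      then show ?thesis unfolding image_image[of ?b "\<lambda>t. 1 - t", symmetric] by simp
    qed
    ultimately show ?thesis by simp
  qed
qed

definition lift_face :: "(real^3) set set \<Rightarrow> complex \<Rightarrow> real^3" where
  "lift_face F = (SOME g. continuous_on (cball 0 1) g \<and> g ` cball 0 1 \<subseteq> S2 \<and> (\<forall>z\<in>cball 0 1. cls (g z) = hF F z))"

text \<open>The flag names one of the two antipodal lifts of a face.\<close>

definition LF :: "((real^3) set set \<times> bool) set" where "LF = faces \<times> UNIV"

definition Lh :: "(real^3) set set \<times> bool \<Rightarrow> complex \<Rightarrow> real^3" where
  "Lh f z = (if snd f then lift_face (fst f) z else - lift_face (fst f) z)"

definition Lq :: "(real^3) set set \<times> bool \<Rightarrow> nat \<Rightarrow> real^3" where "Lq f j = Lh f (circ (real j))"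

lemma lift_face:
  assumes "F \<in> faces"
  shows "continuous_on (cball 0 1) (lift_face F)" "lift_face F ` cball 0 1 \<subseteq> S2"
    "\<And>z. z \<in> cball 0 1 \<Longrightarrow> cls (lift_face F z) = hF F z"
proof -
  have "\<exists>g. continuous_on (cball 0 1) g \<and> g ` cball 0 1 \<subseteq> S2 \<and> (\<forall>z\<in>cball 0 1. cls (g z) = hF F z)"
    using lift_to_sphere[OF convex_cball hF_cont[OF assms]] by metis
  then have "continuous_on (cball 0 1) (lift_face F) \<and> lift_face F ` cball 0 1 \<subseteq> S2 \<and>
      (\<forall>z\<in>cball 0 1. cls (lift_face F z) = hF F z)"
    unfolding lift_face_def by (rule someI_ex)
  then show "continuous_on (cball 0 1) (lift_face F)" "lift_face F ` cball 0 1 \<subseteq> S2"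
    "\<And>z. z \<in> cball 0 1 \<Longrightarrow> cls (lift_face F z) = hF F z" by blast+
qed

lemma Lh:
  assumes "f \<in> LF"
  shows "continuous_on (cball 0 1) (Lh f)" "Lh f ` cball 0 1 \<subseteq> S2"
    "\<And>z. z \<in> cball 0 1 \<Longrightarrow> cls (Lh f z) = hF (fst f) z"
proof -
  have F: "fst f \<in> faces" using assms by (auto simp: LF_def)
  have c: "cls (- x) = cls x" for x by (simp add: cls_eq_iff)
  show "continuous_on (cball 0 1) (Lh f)"
    unfolding Lh_def using lift_face(1)[OF F] by (cases "snd f") (auto intro: continuous_on_minus)
  show "Lh f ` cball 0 1 \<subseteq> S2" using lift_face(2)[OF F] unfolding Lh_def by auto
  show "cls (Lh f z) = hF (fst f) z" if "z \<in> cball 0 1" for z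
    using lift_face(3)[OF F that] by (simp add: Lh_def c)
qed

lemma side_larc:
  assumes f: "f \<in> LF" and j: "j < 4"
  shows "pF (fst f) ! j \<in> parcs G"
    "larc (fst (pF (fst f) ! j)) (snd (pF (fst f) ! j)) (\<lambda>t. Lh f (circ (real j + t)))"
proof -
  have F: "fst f \<in> faces" using f by (auto simp: LF_def)
  show "pF (fst f) ! j \<in> parcs G"
    using pF_arcs[OF F] pF_length[OF F] j nth_mem by (metis subsetD)
  have "continuous_on {0..1} (\<lambda>t. Lh f (circ (real j + t)))"
    by (rule continuous_on_compose2[OF Lh(1)[OF f]]) (auto intro!: continuous_intros)
  moreover have "(\<lambda>t. Lh f (circ (real j + t))) ` {0..1} \<subseteq> S2"
    using Lh(2)[OF f] by (force simp: image_subset_iff)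
  moreover have cl: "cls (Lh f (circ s)) = hF (fst f) (circ s)" for s
    using Lh(3)[OF f] by simp
  ultimately show "larc (fst (pF (fst f) ! j)) (snd (pF (fst f) ! j)) (\<lambda>t. Lh f (circ (real j + t)))"
    unfolding larc_def cl using hF_side[OF F j] by simp
qed

lemma face_image:
  assumes "F \<in> faces"
  shows "hF F ` ball 0 1 = F" "inj_on (hF F) (ball 0 1)"
    "F \<subseteq> topspace projective_plane - (\<phi> ` pverts G \<union> \<Union>(\<gamma> ` parcs G))"
proof -
  show sub: "F \<subseteq> topspace projective_plane - (\<phi> ` pverts G \<union> \<Union>(\<gamma> ` parcs G))"
    using connected_components_of_subset[OF assms[unfolded embedding_faces_def]] by auto
  have "topspace (subtopology projective_plane F) = F" using sub by auto
  then show "hF F ` ball 0 1 = F" using homeomorphic_imp_surjective_map[OF hF_homeo[OF assms]] by simp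
  show "inj_on (hF F) (ball 0 1)" using homeomorphic_imp_injective_map[OF hF_homeo[OF assms]] by simp
qed

lemma sphere_quadrangulation_lift: "sphere_quadrangulation LW LE Larc LF Lh Lq"
proof
  have fin: "finite (pverts G)" by (rule pair_finite_verts)
  have "LW \<subseteq> (\<Union>v\<in>pverts G. {x. \<phi> v = cls x})" by (auto simp: LW_def)
  moreover have "finite {x. \<phi> v = cls x}" if v: "v \<in> pverts G" for v
  proof -
    obtain x where "\<phi> v = cls x" using phi_sphere[OF v] by blast
    then have "{x. \<phi> v = cls x} \<subseteq> {x, - x}" by (auto simp: cls_eq_iff)
    then show ?thesis by (rule finite_subset) simp
  qed
  ultimately show "finite LW" using fin by (meson finite_UN finite_subset)
  show "LW \<noteq> {}" using verts_nonempty phi_sphere unfolding LW_def by fastforce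
  show "LW \<subseteq> S2" by (auto simp: LW_def)
next
  fix e assume e: "e \<in> LE"
  then obtain u v where uv: "(u, v) \<in> parcs G" and a: "larc u v (Larc e)" and ends: "{Larc e 0, Larc e 1} = e"
    by (rule LarcE)
  show "continuous_on {0..1} (Larc e)" "Larc e ` {0..1} \<subseteq> S2" using a by (auto simp: larc_def)
  show "inj_on (Larc e) {0..1}" using larc_inj[OF a] by (auto intro!: inj_onI)
  show "e = {Larc e 0, Larc e 1}" using ends by simp
  have V: "u \<in> pverts G" "v \<in> pverts G" using uv in_arcsD1 in_arcsD2 by blast+
  show "Larc e ` {0..1} \<inter> LW = e"
  proof
    show "Larc e ` {0..1} \<inter> LW \<subseteq> e"
    proof
      fix x assume x: "x \<in> Larc e ` {0..1} \<inter> LW"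
      then obtain t where t: "t \<in> {0..1}" "x = Larc e t" by blast
      have "cls x \<in> \<gamma> (u, v)" using larc_in_gamma[OF a] x by blast
      then have "cls x \<in> {\<phi> u, \<phi> v}" using gamma_verts[OF uv] x by (auto simp: LW_def)
      then have "t = 0 \<or> t = 1"
        using larc_inj[OF a t(1), of 0] larc_inj[OF a t(1), of 1] a t(2) by (auto simp: larc_def)
      then show "x \<in> e" using t(2) ends by blast
    qed
    have "Larc e 0 \<in> LW" "Larc e 1 \<in> LW"
      using a V by (auto simp: LW_def larc_def image_subset_iff)
    moreover have "Larc e 0 \<in> Larc e ` {0..1}" "Larc e 1 \<in> Larc e ` {0..1}" by auto
    ultimately have "{Larc e 0, Larc e 1} \<subseteq> Larc e ` {0..1} \<inter> LW" by simp
    then show "e \<subseteq> Larc e ` {0..1} \<inter> LW" unfolding ends .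
  qed
next
  fix e e' assume e: "e \<in> LE" and e': "e' \<in> LE" and ne: "e \<noteq> e'"
  obtain u v where uv: "(u, v) \<in> parcs G" and a: "larc u v (Larc e)" and ends: "{Larc e 0, Larc e 1} = e"
    using e by (rule LarcE)
  obtain u' v' where uv': "(u', v') \<in> parcs G" and b: "larc u' v' (Larc e')" and ends': "{Larc e' 0, Larc e' 1} = e'"
    using e' by (rule LarcE)
  show "Larc e ` {0..1} \<inter> Larc e' ` {0..1} \<subseteq> LW"
  proof
    fix x assume x: "x \<in> Larc e ` {0..1} \<inter> Larc e' ` {0..1}"
    then have x1: "x \<in> Larc e ` {0..1}" and x2: "x \<in> Larc e' ` {0..1}" by (rule IntD1, rule IntD2)
    note g = larc_in_gamma[OF a x1] larc_in_gamma[OF b x2] and xS = larc_in_sphere[OF a x1]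
    show "x \<in> LW"
    proof (cases "{u, v} = {u', v'}")
      case False
      then show ?thesis using gamma_meet[OF uv uv'] g xS by (auto simp: LW_def)
    next
      case True
      \<comment> \<open>A lift of the same arc of \<open>G\<close> either starts where
        \<open>Larc e\<close> starts, and then it gives the same edge, or it is the antipodal lift,
        which is disjoint from \<open>Larc e\<close>.\<close>
      have no: False if c: "larc u v c" "{c 0, c 1} = e'" "x \<in> c ` {0..1}" for c
      proof (cases "c 0 = Larc e 0")
        case True
        then show False using larc_unique[OF a c(1)] c(2) ends ne by simp
      next
        case False
        then have "c 0 = - Larc e 0" using larc_start[OF a c(1)] by blast
        then have "c ` {0..1} = (\<lambda>t. - Larc e t) ` {0..1}"
          using larc_unique[OF larc_minus[OF a] c(1)] by simp
        then obtain t where t: "t \<in> {0..1}" "x = - Larc e t" using c(3) by auto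
        obtain r where "r \<in> {0..1}" "x = Larc e r" using x1 by blast
        then show False using larc_disjoint_minus[OF a _ t(1)] t(2) by metis
      qed
      consider "u' = u" "v' = v" | "u' = v" "v' = u" using True by (auto simp: doubleton_eq_iff)
      then show ?thesis
      proof cases
        case 1
        then show ?thesis using no[of "Larc e'"] b ends' x2 by blast
      next
        case 2
        have "larc u v (\<lambda>t. Larc e' (1 - t))" using larc_rev[OF uv' b] 2 by simp
        moreover have "x \<in> (\<lambda>t. Larc e' (1 - t)) ` {0..1}"
        proof -
          obtain t where "t \<in> {0..1}" "x = Larc e' t" using x2 by blast
          then show ?thesis by (intro image_eqI[of _ _ "1 - t"]) auto
        qed
        ultimately have False using no[of "\<lambda>t. Larc e' (1 - t)"] ends' by (simp add: insert_commute)
        then show ?thesis ..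
      qed
    qed
  qed
next
  fix f assume f: "f \<in> LF"
  show "continuous_on (cball 0 1) (Lh f)" "Lh f ` cball 0 1 \<subseteq> S2" by (rule Lh[OF f])+
  have "circ (real 4) = circ (real 0)" by simp
  then show "Lq f 4 = Lq f 0" unfolding Lq_def by simp
next
  fix f f' z z' assume f: "f \<in> LF" "f' \<in> LF" and z: "norm z < 1" "norm z' < 1" and eq: "Lh f z = Lh f' z'"
  have F: "fst f \<in> faces" "fst f' \<in> faces" using f by (auto simp: LF_def)
  have eq': "hF (fst f) z = hF (fst f') z'"
    using Lh(3)[OF f(1), of z] Lh(3)[OF f(2), of z'] z eq by simp
  have "hF (fst f) z \<in> fst f" "hF (fst f') z' \<in> fst f'" using face_image(1) F z by force+
  then have "\<not> disjnt (fst f) (fst f')" using eq' by (auto simp: disjnt_iff)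
  then have ff: "fst f = fst f'"
    using pairwise_disjoint_connected_components_of F unfolding embedding_faces_def
    by (meson pairwise_def)
  then have zz: "z = z'" using inj_onD[OF face_image(2)[OF F(1)]] eq' z by simp
  have "lift_face (fst f) z \<in> S2" using lift_face(2)[OF F(1)] z(1) by (force simp: image_subset_iff)
  then have "lift_face (fst f) z \<noteq> - lift_face (fst f) z" by (rule sphere_neq_minus)
  then have "snd f = snd f'" using eq ff zz unfolding Lh_def by (auto split: if_splits)
  then show "f = f' \<and> z = z'" using ff zz by (simp add: prod_eq_iff)
next
  fix f z assume f: "f \<in> LF" and z: "norm (z :: complex) < 1"
  then have F: "fst f \<in> faces" by (auto simp: LF_def)
  have "cls (Lh f z) \<in> fst f" using Lh(3)[OF f, of z] face_image(1)[OF F] z by force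
  then have no: "cls (Lh f z) \<notin> \<phi> ` pverts G" "cls (Lh f z) \<notin> \<Union>(\<gamma> ` parcs G)"
    using face_image(3)[OF F] by blast+
  show "Lh f z \<notin> LW" using no(1) by (auto simp: LW_def)
  fix e assume e: "e \<in> LE"
  then obtain u v where uv: "(u, v) \<in> parcs G" and a: "larc u v (Larc e)" by (rule LarcE)
  have "cls x \<in> \<gamma> (u, v)" if "x \<in> Larc e ` {0..1}" for x
    by (rule larc_in_gamma[OF a that])
  then show "Lh f z \<notin> Larc e ` {0..1}" using no(2) uv by blast
next
  fix x assume x: "x \<in> S2"
  consider "cls x \<in> \<phi> ` pverts G" | u v where "(u, v) \<in> parcs G" "cls x \<in> \<gamma> (u, v)"
    | F where "F \<in> faces" "cls x \<in> F"
  proof -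
    have "cls x \<in> topspace projective_plane" using x by (simp add: topspace_projective_plane)
    moreover have "\<Union>faces = topspace projective_plane - (\<phi> ` pverts G \<union> \<Union>(\<gamma> ` parcs G))"
      unfolding embedding_faces_def Union_connected_components_of by auto
    ultimately have "cls x \<in> \<phi> ` pverts G \<or> (\<exists>e\<in>parcs G. cls x \<in> \<gamma> e) \<or> cls x \<in> \<Union>faces"
      by simp blast
    then show thesis
    proof (elim disjE bexE UnionE)
      fix e assume "e \<in> parcs G" "cls x \<in> \<gamma> e"
      then show thesis using that(2)[of "fst e" "snd e"] by simp
    next
      assume "cls x \<in> \<phi> ` pverts G"
      then show thesis by (rule that(1))
    next
      fix F assume "cls x \<in> F" "F \<in> faces"
      then show thesis by (rule that(3)[rotated])
    qed
  qed
  then show "x \<in> LW \<or> (\<exists>e\<in>LE. x \<in> Larc e ` {0..1}) \<or> (\<exists>f\<in>LF. x \<in> Lh f ` ball 0 1)"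
  proof cases
    case 1
    then show ?thesis using x by (simp add: LW_def)
  next
    case 2
    obtain y where "y \<in> S2" "cls y = \<phi> u" using phi_sphere in_arcsD1[OF 2(1)] by metis
    then obtain a where a: "larc u v a" using larc_exists[OF 2(1)] by metis
    have "\<gamma> (u, v) = (\<lambda>t. cls (a t)) ` {0..1}" using a by (simp add: larc_def bij_betw_def)
    then obtain t where t: "t \<in> {0..1}" "cls x = cls (a t)" using 2(2) by auto
    have "\<exists>c. larc u v c \<and> x = c t" using t(2) a larc_minus[OF a] by (auto simp: cls_eq_iff)
    then obtain c where c: "larc u v c" "x = c t" by blast
    have "{c 0, c 1} \<in> LE" by (rule LE_I[OF 2(1) c(1)])
    moreover have "x \<in> Larc {c 0, c 1} ` {0..1}" unfolding Larc_image[OF 2(1) c(1)] c(2) using t(1) by (rule imageI)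
    ultimately show ?thesis by blast
  next
    case 3
    then obtain z where z: "z \<in> ball 0 1" "cls x = hF F z" using face_image(1)[OF 3(1)] by blast
    then have "cls x = cls (lift_face F z)" using lift_face(3)[OF 3(1), of z] by simp
    then have "x = Lh (F, True) z \<or> x = Lh (F, False) z" by (auto simp: cls_eq_iff Lh_def)
    then have "x \<in> Lh (F, True) ` ball 0 1 \<or> x \<in> Lh (F, False) ` ball 0 1" using z(1) by (elim disjE) simp_all
    moreover have "(F, True) \<in> LF" "(F, False) \<in> LF" using 3(1) by (auto simp: LF_def)
    ultimately show ?thesis by blast
  qed
next
  fix f and j :: nat assume f: "f \<in> LF" and j: "j < 4"
  let ?a = "\<lambda>t. Lh f (circ (real j + t))"
  note s = side_larc[OF f j]
  have p: "(fst (pF (fst f) ! j), snd (pF (fst f) ! j)) \<in> parcs G" using s(1) by simp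
  have q: "{Lq f j, Lq f (Suc j)} = {?a 0, ?a 1}" by (simp add: Lq_def add.commute)
  show "{Lq f j, Lq f (Suc j)} \<in> LE" unfolding q by (rule LE_I[OF p s(2)])
  show "bij_betw ?a {0..1} (Larc {Lq f j, Lq f (Suc j)} ` {0..1})"
    unfolding q Larc_image[OF p s(2)] bij_betw_def using larc_inj[OF s(2)] by (auto intro!: inj_onI)
next
  fix f and j :: nat assume "f \<in> LF" "j \<le> 4"
  then show "Lh f (circ (real j)) = Lq f j" by (simp add: Lq_def)
qed

end

lemma (in sphere_quadrangulation) quad_complex: "quad_complex W E Fs q"
proof
  show "finite W" "W \<noteq> {}" "finite Fs" by (rule finite_W W_nonempty finite_Fs)+
  show "\<exists>x y. e = {x, y} \<and> x \<noteq> y \<and> x \<in> W \<and> y \<in> W" if "e \<in> E" for e by (rule edge_two[OF that])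
  show "q f 4 = q f 0" if "f \<in> Fs" for f by (rule q4[OF that])
  show "side f j \<in> E" if "f \<in> Fs" "j < 4" for f j by (rule side_in_E[OF that])
  show "card {(f, j). f \<in> Fs \<and> j < 4 \<and> side f j = e} = 2" if "e \<in> E" for e
    using card_sides[OF that] by (simp only: sides_def)
  show "\<exists>S. \<forall>x y. {x, y} \<in> E \<longrightarrow> ({x, y} \<in> C \<longleftrightarrow> (x \<in> S) \<noteq> (y \<in> S))"
    if "\<And>f. f \<in> Fs \<Longrightarrow> even (card {j. j < (4::nat) \<and> side f j \<in> C})" for C
    by (rule coboundary_exists[OF that])
qed

section \<open>Walks in the lifted graph and the bound for a shortest odd one\<close>

context projective_embedding
begin

interpretation lift: quad_complex LW LE LF Lq
  using sphere_quadrangulation_lift by (rule sphere_quadrangulation.quad_complex)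

lemma card_LW: "card LW = 2 * card (pverts G)"
proof -
  have two: "card {x \<in> S2. cls x = \<phi> v} = 2" if v: "v \<in> pverts G" for v
  proof -
    obtain x where x: "x \<in> S2" "\<phi> v = cls x" using phi_sphere[OF v] by blast
    then have "{y \<in> S2. cls y = \<phi> v} = {x, - x}" by (auto simp: cls_eq_iff)
    then show ?thesis using sphere_neq_minus[OF x(1)] by simp
  qed
  have "LW = (\<Union>v\<in>pverts G. {x \<in> S2. cls x = \<phi> v})" by (auto simp: LW_def)
  also have "card \<dots> = (\<Sum>v\<in>pverts G. card {x \<in> S2. cls x = \<phi> v})"
  proof (rule card_UN_disjoint)
    show "finite (pverts G)" by (rule pair_finite_verts)
    show "\<forall>v\<in>pverts G. finite {x \<in> S2. cls x = \<phi> v}"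
      by (intro ballI card_ge_0_finite) (simp only: two zero_less_numeral)
    show "\<forall>u\<in>pverts G. \<forall>v\<in>pverts G. u \<noteq> v \<longrightarrow> {x \<in> S2. cls x = \<phi> u} \<inter> {x \<in> S2. cls x = \<phi> v} = {}"
    proof (intro ballI impI equals0I)
      fix u v x assume uv: "u \<in> pverts G" "v \<in> pverts G" "u \<noteq> v"
        and "x \<in> {x \<in> S2. cls x = \<phi> u} \<inter> {x \<in> S2. cls x = \<phi> v}"
      then have "cls x = \<phi> u" "cls x = \<phi> v" by blast+
      then have "\<phi> u = \<phi> v" by metis
      then show False using phi_inj uv by blast
    qed
  qed
  also have "\<dots> = 2 * card (pverts G)" using two by simp
  finally show ?thesis .
qed

definition ladj :: "(real^3) rel" where "ladj = {(x, y). {x, y} \<in> LE}"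

lemma ladjI: "(u, v) \<in> parcs G \<Longrightarrow> larc u v a \<Longrightarrow> (a 0, a 1) \<in> ladj"
  unfolding ladj_def using LE_I by simp

lemma ladjE:
  assumes "(x, y) \<in> ladj"
  obtains u v a where "(u, v) \<in> parcs G" "larc u v a" "a 0 = x" "a 1 = y"
proof -
  obtain u v a where a: "(u, v) \<in> parcs G" "larc u v a" "{x, y} = {a 0, a 1}"
    using assms unfolding ladj_def LE_def by blast
  consider "x = a 0" "y = a 1" | "x = a 1" "y = a 0" using a(3) unfolding doubleton_eq_iff by blast
  then show thesis
  proof cases
    case 1
    then show thesis using that[OF a(1,2)] by simp
  next
    case 2
    then show thesis using that[OF arc_sym[OF a(1)] larc_rev[OF a(1,2)]] by simp
  qed
qed

text \<open>Unique lifting of one step: the classes of its ends determine the arc of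
  \<open>G\<close>, and the start point determines the lift.\<close>

lemma ladj_unique:
  assumes "(x, y) \<in> ladj" "(x, y') \<in> ladj" "cls y = cls y'" shows "y = y'"
proof -
  obtain u v a where a: "(u, v) \<in> parcs G" "larc u v a" "a 0 = x" "a 1 = y" using assms(1) by (rule ladjE)
  obtain u' v' b where b: "(u', v') \<in> parcs G" "larc u' v' b" "b 0 = x" "b 1 = y'" using assms(2) by (rule ladjE)
  have V: "u \<in> pverts G" "v \<in> pverts G" "u' \<in> pverts G" "v' \<in> pverts G"
    using a(1) b(1) in_arcsD1 in_arcsD2 by blast+
  have "\<phi> u = \<phi> u'" "\<phi> v = \<phi> v'" using a b assms(3) unfolding larc_def by metis+
  then have "u' = u" "v' = v" using phi_inj V by metis+
  then have "larc u v b" using b(2) by simp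
  then show ?thesis using larc_unique[OF a(2)] a b by metis
qed

lemma ladj_minus: "(x, y) \<in> ladj \<Longrightarrow> (- x, - y) \<in> ladj"
proof (erule ladjE)
  fix u v a assume a: "(u, v) \<in> parcs G" "larc u v a" "a 0 = x" "a 1 = y"
  show "(- x, - y) \<in> ladj" using ladjI[OF a(1) larc_minus[OF a(2)]] a by simp
qed

lemma ladj_project:
  assumes "(x, y) \<in> ladj ^^ n" "cls x = \<phi> u" "u \<in> pverts G"
  shows "\<exists>v\<in>pverts G. cls y = \<phi> v \<and> (u, v) \<in> parcs G ^^ n"
  using assms(1)
proof (induction n arbitrary: y)
  case 0
  then show ?case using assms(2,3) by auto
next
  case (Suc n)
  then obtain z where z: "(x, z) \<in> ladj ^^ n" "(z, y) \<in> ladj" by auto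
  obtain v where v: "v \<in> pverts G" "cls z = \<phi> v" "(u, v) \<in> parcs G ^^ n" using Suc.IH[OF z(1)] by blast
  obtain v' w a where a: "(v', w) \<in> parcs G" "larc v' w a" "a 0 = z" "a 1 = y" using z(2) by (rule ladjE)
  have V: "v' \<in> pverts G" "w \<in> pverts G" using a(1) in_arcsD1 in_arcsD2 by blast+
  have "\<phi> v' = \<phi> v" using a(2,3) v(2) by (simp add: larc_def)
  then have "v' = v" using phi_inj V v(1) by blast
  then have "(u, w) \<in> parcs G ^^ Suc n" using relpow_Suc_I[OF v(3)] a(1) by blast
  moreover have "cls y = \<phi> w" using a(2,4) by (simp add: larc_def)
  ultimately show ?case using V(2) by blast
qed

text \<open>All faces have four sides, so the set of all edges is a closed cochain, hence the
  coboundary of a set, which 2-colours the lifted graph.\<close>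

lemma walk_parity:
  obtains S where "\<And>x y n. (x, y) \<in> ladj ^^ n \<Longrightarrow> odd n \<longleftrightarrow> (x \<in> S) \<noteq> (y \<in> S)"
proof -
  have "\<exists>S. \<forall>x y. {x, y} \<in> LE \<longrightarrow> ({x, y} \<in> LE \<longleftrightarrow> (x \<in> S) \<noteq> (y \<in> S))"
  proof (rule lift.cocycle)
    fix f assume f: "f \<in> LF"
    have "lift.side f j \<in> LE" if "j < 4" for j by (rule lift.side_in_E[OF f that])
    then have "{j. j < (4::nat) \<and> lift.side f j \<in> LE} = {..<4}" by auto
    then show "even (card {j. j < (4::nat) \<and> lift.side f j \<in> LE})" by simp
  qed
  then obtain S where S: "\<And>x y. (x, y) \<in> ladj \<Longrightarrow> (x \<in> S) \<noteq> (y \<in> S)" unfolding ladj_def by blast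
  have "odd n \<longleftrightarrow> (x \<in> S) \<noteq> (y \<in> S)" if "(x, y) \<in> ladj ^^ n" for x y n
    using that
  proof (induction n arbitrary: y)
    case (Suc n)
    then obtain z where z: "(x, z) \<in> ladj ^^ n" "(z, y) \<in> ladj" by auto
    show ?case unfolding even_Suc using Suc.IH[OF z(1)] S[OF z(2)] by argo
  qed simp
  then show thesis by (rule that)
qed

text \<open>
  The lift of a shortest odd closed walk is not closed, because the lifted graph is bipartite, so it
  joins antipodal points; two turns around the walk lift to an isometric cycle of length \<open>2 * k\<close>.
\<close>

lemma odd_closed_walk_bound:
  assumes k: "odd k" "2 \<le> k" and step: "\<And>i. (w i, w (Suc i)) \<in> parcs G" and per: "\<And>i. w (i + k) = w i"
    and min: "\<And>u n. odd n \<Longrightarrow> (u, u) \<in> parcs G ^^ n \<Longrightarrow> k \<le> n"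
  shows "k * (k - 1) < 2 * card (pverts G)"
proof -
  have V: "w i \<in> pverts G" for i using step in_arcsD1 by blast
  obtain S where S: "\<And>x y n. (x, y) \<in> ladj ^^ n \<Longrightarrow> odd n \<longleftrightarrow> (x \<in> S) \<noteq> (y \<in> S)"
    using walk_parity by blast
  have "\<exists>x. \<forall>i. (x i \<in> S2 \<and> cls (x i) = \<phi> (w i)) \<and> (x i, x (Suc i)) \<in> ladj"
  proof (rule dependent_nat_choice)
    show "\<exists>x. x \<in> S2 \<and> cls x = \<phi> (w 0)" using phi_sphere[OF V[of 0]] by metis
    fix x i assume x: "x \<in> S2 \<and> cls x = \<phi> (w i)"
    then obtain a where a: "larc (w i) (w (Suc i)) a" "a 0 = x" using larc_exists[OF step] by blast
    have "a 1 \<in> S2" using larc_in_sphere[OF a(1), of "a 1"] by simp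
    then show "\<exists>y. (y \<in> S2 \<and> cls y = \<phi> (w (Suc i))) \<and> (x, y) \<in> ladj"
      using ladjI[OF step a(1)] a by (auto simp: larc_def)
  qed
  then obtain x where x: "\<And>i. x i \<in> S2" "\<And>i. cls (x i) = \<phi> (w i)" "\<And>i. (x i, x (Suc i)) \<in> ladj" by blast
  have walk: "(x i, x (i + n)) \<in> ladj ^^ n" for i n
    by (rule relpow_steps) (rule x(3))
  \<comment> \<open>As \<open>k\<close> is odd, the colouring excludes a return to
    \<open>x 0\<close>, so \<open>x k\<close> is the antipode; unique lifting then carries the
    antipodal symmetry along the walk.\<close>
  have anti: "x (i + k) = - x i" for i
  proof (induction i)
    case 0
    have "cls (x k) = cls (x 0)" using x(2) per[of 0] by simp
    moreover have "x k \<noteq> x 0" using S[OF walk[of 0 k]] k(1) by auto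
    ultimately show ?case by (simp add: cls_eq_iff)
  next
    case (Suc i)
    have 1: "(- x i, x (Suc i + k)) \<in> ladj" using x(3)[of "i + k"] Suc by simp
    have 2: "(- x i, - x (Suc i)) \<in> ladj" by (rule ladj_minus[OF x(3)])
    have "cls (x (Suc i + k)) = cls (x (Suc i))" using x(2) per by metis
    then have "cls (x (Suc i + k)) = cls (- x (Suc i))" unfolding cls_eq_iff minus_minus by blast
    then show ?case by (rule ladj_unique[OF 1 2])
  qed
  interpret quad_complex_cycle LW LE LF Lq x k
  proof
    show "2 \<le> k" by (rule k(2))
    show "x (i + 2 * k) = x i" for i
    proof -
      have "x (i + 2 * k) = x (i + k + k)" by (rule arg_cong[where f = x]) simp
      then show ?thesis using anti[of "i + k"] anti[of i] by simp
    qed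
    show "{x i, x (Suc i)} \<in> LE" for i using x(3)[of i] by (simp add: ladj_def)
    fix i j L assume ij: "i \<le> j" "j \<le> i + k" and L: "(x i, x j) \<in> {(x, y). {x, y} \<in> LE} ^^ L"
    \<comment> \<open>The given walk is continued along the cycle to the antipode of
      \<open>x i\<close>. Its projection is a closed walk of odd length
      \<open>L + (i + k - j)\<close>, so minimality of \<open>k\<close> gives
      \<open>j - i \<le> L\<close>.\<close>
    have "(x j, x (i + k)) \<in> ladj ^^ (i + k - j)" using walk[of j "i + k - j"] ij by simp
    then have M: "(x i, x (i + k)) \<in> ladj ^^ (L + (i + k - j))"
      using L unfolding ladj_def relpow_add by blast
    have "odd (L + (i + k - j))" using S[OF M] S[OF walk[of i k]] k(1) by blast
    moreover have "(w i, w i) \<in> parcs G ^^ (L + (i + k - j))"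
    proof -
      obtain v where v: "v \<in> pverts G" "cls (x (i + k)) = \<phi> v" "(w i, v) \<in> parcs G ^^ (L + (i + k - j))"
        using ladj_project[OF M x(2) V] by blast
      have "\<phi> v = \<phi> (w i)" using v(2) x(2)[of "i + k"] per[of i] by simp
      then have "v = w i" by (rule phi_inj[OF v(1) V])
      then show ?thesis using v(3) by simp
    qed
    ultimately have "k \<le> L + (i + k - j)" by (rule min)
    then show "j - i \<le> L" using ij by linarith
  qed
  show ?thesis using card_W_bound unfolding card_LW .
qed

end

section \<open>The bound for projective quadrangulations\<close>

lemma projective_embedding_exists:
  assumes "projective_quadrangulation G" "pverts G \<noteq> {}"
  shows "\<exists>\<phi> \<gamma> hF pF. projective_embedding G \<phi> \<gamma> hF pF"
proof -
  obtain \<phi> \<gamma> where G: "pair_graph G" and emb: "graph_embedding projective_plane G \<phi> \<gamma>"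
    and faces: "\<And>F. F \<in> embedding_faces projective_plane G \<phi> \<gamma> \<Longrightarrow>
      \<exists>p. length p = 4 \<and> face_bounded_by projective_plane G \<phi> \<gamma> F p"
    using assms(1) unfolding projective_quadrangulation_def by blast
  define ok where "ok F h p \<longleftrightarrow> length p = 4 \<and> set p \<subseteq> parcs G \<and>
     continuous_map (top_of_set (cball 0 1)) projective_plane h \<and>
     homeomorphic_map (top_of_set (ball 0 1)) (subtopology projective_plane F) h \<and>
     (\<forall>i<4. h (circ (real i)) = \<phi> (fst (p ! i)) \<and> h (circ (real i + 1)) = \<phi> (snd (p ! i)) \<and>
       bij_betw (\<lambda>t. h (circ (real i + t))) {0..1} (\<gamma> (p ! i)))" for F h p
  have "\<exists>h p. ok F h p" if F: "F \<in> embedding_faces projective_plane G \<phi> \<gamma>" for F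
  proof -
    obtain p where p: "length p = 4" "face_bounded_by projective_plane G \<phi> \<gamma> F p" using faces[OF F] by blast
    obtain u where u: "pre_digraph.awalk (with_proj G) u p u"
      using p(2) unfolding face_bounded_by_def by blast
    obtain h where h: "continuous_map (top_of_set (cball 0 1)) projective_plane h"
      "homeomorphic_map (top_of_set (ball 0 1)) (subtopology projective_plane F) h"
      "\<forall>i < length p. let side = (\<lambda>t. h (cis (2 * pi * (real i + t) / real (length p))))
           in side 0 = \<phi> (fst (p ! i)) \<and> side 1 = \<phi> (snd (p ! i)) \<and> bij_betw side {0..1} (\<gamma> (p ! i))"
      using p(2) unfolding face_bounded_by_def by blast
    have "set p \<subseteq> parcs G" using u unfolding pre_digraph.awalk_def by simp
    then have "ok F h p"
      using p(1) h unfolding ok_def circ_def Let_def by simp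
    then show ?thesis by blast
  qed
  then obtain hF pF where ok: "\<And>F. F \<in> embedding_faces projective_plane G \<phi> \<gamma> \<Longrightarrow> ok F (hF F) (pF F)"
    by metis
  have "projective_embedding G \<phi> \<gamma> hF pF"
    unfolding projective_embedding_def projective_embedding_axioms_def
    using G emb assms(2) ok unfolding ok_def by simp
  then show ?thesis by blast
qed

theorem theorem3p2:
  fixes G :: "'a pair_pre_digraph" and n :: nat
  assumes "projective_quadrangulation G"
    and "\<not> bipartite G"
    and "card (pverts G) = n"
  shows "\<exists>p. odd_cycle G p \<and> real (length p) \<le> 1 / 2 * (1 + sqrt (8 * real n - 7))"
proof -
  have nb: "\<nexists>A B. pverts G = A \<union> B \<and> A \<inter> B = {} \<and> parcs G \<subseteq> A \<times> B \<union> B \<times> A"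
    using assms(2) unfolding bipartite_def .
  interpret pair_graph G using assms(1) unfolding projective_quadrangulation_def by simp
  obtain k w where k: "odd k" "2 \<le> k" and step: "\<And>i. (w i, w (Suc i)) \<in> parcs G"
    and per: "\<And>i. w (i + k) = w i" and inj: "inj_on w {..<k}"
    and min: "\<And>u n. odd n \<Longrightarrow> (u, u) \<in> parcs G ^^ n \<Longrightarrow> k \<le> n"
    using shortest_odd_closed_walk[OF odd_closed_walk[OF nb]] by metis
  define p where "p = map (\<lambda>i. (w i, w (Suc i))) [0..<k]"
  have "cycle p"
    unfolding p_def using k(2) step per[of 0] inj by (intro cycle_of_walk) auto
  then have "odd_cycle G p" using k(1) by (simp add: odd_cycle_def p_def)
  have "w 0 \<in> pverts G" using in_arcsD1[OF step] .
  then obtain \<phi> \<gamma> hF pF where pe: "projective_embedding G \<phi> \<gamma> hF pF"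
    using projective_embedding_exists[OF assms(1)] by blast
  have bound: "k * (k - 1) < 2 * n"
    unfolding assms(3)[symmetric]
    by (rule projective_embedding.odd_closed_walk_bound[OF pe k step per]) (rule min)
  \<comment> \<open>With \<open>k = 2 * m + 1\<close>, half of the strict bound reads
    \<open>(2 * m + 1) * m + 1 \<le> n\<close>. Eight times the left side minus 7 is the square of
    \<open>4 * m + 1\<close>, and \<open>k\<close> is half of
    \<open>1 + (4 * m + 1)\<close>.\<close>
  obtain m where m: "k = 2 * m + 1" using k(1) by (rule oddE)
  have "(2 * m + 1) * m + 1 \<le> n" using bound unfolding m by simp
  then have "real ((2 * m + 1) * m + 1) \<le> real n" by (rule of_nat_mono)
  then have "(4 * real m + 1)\<^sup>2 \<le> 8 * real n - 7"
    by (simp add: power2_eq_square algebra_simps)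
  then have "4 * real m + 1 \<le> sqrt (8 * real n - 7)" by (rule real_le_rsqrt)
  then have "real (length p) \<le> 1 / 2 * (1 + sqrt (8 * real n - 7))" by (simp add: p_def m)
  then show ?thesis using \<open>odd_cycle G p\<close> by blast
qed

end
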